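(* Suppose there is no largest inaccessible cardinal. Then the following ordinals are equal: (1) the supremum of the first-order sententially categorical cardinals; (2) the supremum of the second-order sententially categorical cardinals; (3) the supremum of the $\alpha$-order sententially categorical cardinals, for any absolutely definable ordinal $\alpha$. This common ordinal is less than or equal to (4) the least lightface $\Sigma_2$-correct cardinal. If moreover there is a proper class of inaccessible cardinals, then all four ordinals (1)–(4) are equal.
   Context: $V_\kappa$ is the rank-initial segment of the cumulative hierarchy. An ordinal $\alpha$ is absolutely definable if there is a first-order formula $\psi(x)$ such that for every inaccessible $\kappa$, $\alpha\in V_\kappa$ and $\alpha$ is the unique element of $V_\kappa$ satisfying $\psi$ in $V_\kappa$. An $\alpha$-order sentence about $V_\kappa$ is a first-order assertion about $V_{\kappa+\alpha}$; second-order quantifiers range over all subsets of $V_\kappa$. A cardinal $\kappa$ is sententially categorical of a given order if there is a sentence $\sigma$ of that order with $\kappa$ inaccessible, $V_\kappa\models\sigma$ and $V_\lambda\not\models\sigma$ for every inaccessible $\lambda\neq\kappa$. An ordinal $\delta$ is lightface $\Sigma_2$-correct if $V_\delta$ and $V$ satisfy the same parameter-free $\Sigma_2$ sentences. *)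

theory Defs
  imports Main "HOL-Library.Equipollence" "HOL-Library.Countable_Set"
begin

text \<open>
  The universe \<open>V\<close> of sets is an arbitrary type of the following class: a type of sets
  satisfying the ZFC axioms, where the classes and class functions of the axiom schemes are those
  of HOL. Choice is not listed because it follows from the choice principle of HOL together
  with separation and replacement.
\<close>

class zfc =
  fixes elts :: "'a \<Rightarrow> 'a set"
  assumes extensionality: "elts x = elts y \<Longrightarrow> x = y"
    and foundation: "wf {(x, y). x \<in> elts y}"
    and pairing: "\<exists>z. elts z = {x, y}"
    and union: "\<exists>z. elts z = (\<Union>y \<in> elts x. elts y)"
    and powerset: "\<exists>z. elts z = {y. elts y \<subseteq> elts x}"
    and infinity: "\<exists>z. (\<exists>e \<in> elts z. elts e = {}) \<and>
      (\<forall>x \<in> elts z. \<exists>y \<in> elts z. elts y = insert x (elts x))"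
    and separation: "\<exists>z. elts z = {y \<in> elts x. P y}"
    and replacement: "\<exists>z. elts z = F ` elts x"

definition small :: "'v::zfc set \<Rightarrow> bool"
  where "small X \<longleftrightarrow> X \<in> range elts"

definition set_of :: "'v::zfc set \<Rightarrow> 'v"
  where "set_of X = (THE x. elts x = X)"

lemma elts_set_of:
  assumes "small X"
  shows "elts (set_of X) = X"
proof -
  obtain x where x: "X = elts x"
    using assms by (auto simp: small_def)
  have "set_of X = x"
    unfolding set_of_def x by (rule the_equality) (simp_all add: extensionality)
  then show ?thesis
    by (simp add: x)
qed

lemma small_elts: "small (elts x)"
  by (simp add: small_def)

lemma small_image:
  fixes X :: "'v::zfc set" and F :: "'v \<Rightarrow> 'v"
  assumes "small X"
  shows "small (F ` X)"
proof -
  obtain x where "X = elts x"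
    using assms by (auto simp: small_def)
  moreover obtain z where "elts z = F ` elts x"
    using replacement[of F x] by blast
  ultimately show ?thesis
    using small_elts[of z] by simp
qed

lemma small_Un:
  assumes "small X" "small Y"
  shows "small (X \<union> Y)"
proof -
  obtain x y where xy: "X = elts x" "Y = elts y"
    using assms by (auto simp: small_def)
  obtain p where "elts p = {x, y}"
    using pairing[of x y] by blast
  moreover obtain u where "elts u = (\<Union>z \<in> elts p. elts z)"
    using union[of p] by blast
  ultimately have "elts u = X \<union> Y"
    using xy by auto
  then show ?thesis
    using small_elts[of u] by simp
qed


section \<open>Ordinals, the cumulative hierarchy and inaccessible cardinals\<close>

definition transitive :: "'v::zfc \<Rightarrow> bool"
  where "transitive x \<longleftrightarrow> (\<forall>y \<in> elts x. elts y \<subseteq> elts x)"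

definition Ord :: "'v::zfc \<Rightarrow> bool"
  where "Ord \<alpha> \<longleftrightarrow> transitive \<alpha> \<and> (\<forall>\<beta> \<in> elts \<alpha>. transitive \<beta>)"

text \<open>For ordinals, \<open>\<alpha> < \<beta>\<close> is \<open>\<alpha> \<in> elts \<beta>\<close> and \<open>\<alpha> \<le> \<beta>\<close> is inclusion.\<close>

abbreviation ord_le :: "'v::zfc \<Rightarrow> 'v \<Rightarrow> bool"  (infix \<open>\<preceq>\<close> 50)
  where "\<alpha> \<preceq> \<beta> \<equiv> elts \<alpha> \<subseteq> elts \<beta>"

text \<open>Ordinal addition: \<open>\<kappa> + \<alpha> = \<kappa> \<union> {\<kappa> + \<beta> | \<beta> < \<alpha>}\<close>.\<close>

function ord_add :: "'v::zfc \<Rightarrow> 'v \<Rightarrow> 'v"  (infixl \<open>\<oplus>\<close> 65)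
  where "\<kappa> \<oplus> \<alpha> = set_of (elts \<kappa> \<union> (\<lambda>\<beta>. \<kappa> \<oplus> \<beta>) ` elts \<alpha>)"
  by pat_completeness auto
termination
  by (relation "inv_image {(x, y). x \<in> elts y} snd") (auto simp: foundation wf_inv_image)

declare ord_add.simps [simp del]

lemma elts_ord_add: "elts (\<kappa> \<oplus> \<alpha>) = elts \<kappa> \<union> (\<lambda>\<beta>. \<kappa> \<oplus> \<beta>) ` elts \<alpha>"
  by (subst ord_add.simps) (simp add: elts_set_of small_Un small_image small_elts)

text \<open>\<open>Vset \<alpha>\<close> is \<open>V\<^sub>\<alpha> = (\<Union>\<beta><\<alpha>. Pow V\<^sub>\<beta>)\<close>.\<close>

function Vset :: "'v::zfc \<Rightarrow> 'v set"
  where "Vset \<alpha> = (\<Union>\<beta> \<in> elts \<alpha>. {x. elts x \<subseteq> Vset \<beta>})"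
  by pat_completeness auto
termination
  by (relation "{(x, y). x \<in> elts y}") (auto simp: foundation)

declare Vset.simps [simp del]

definition Card :: "'v::zfc \<Rightarrow> bool"
  where "Card \<kappa> \<longleftrightarrow> Ord \<kappa> \<and> (\<forall>\<beta> \<in> elts \<kappa>. \<not> elts \<beta> \<approx> elts \<kappa>)"

definition regular :: "'v::zfc \<Rightarrow> bool"
  where "regular \<kappa> \<longleftrightarrow> Card \<kappa> \<and> infinite (elts \<kappa>) \<and>
    (\<forall>\<beta> \<in> elts \<kappa>. \<forall>f. f ` elts \<beta> \<subseteq> elts \<kappa> \<longrightarrow> (\<exists>\<gamma> \<in> elts \<kappa>. f ` elts \<beta> \<subseteq> elts \<gamma>))"

definition strong_limit :: "'v::zfc \<Rightarrow> bool"
  where "strong_limit \<kappa> \<longleftrightarrow> Card \<kappa> \<and> (\<forall>\<beta> \<in> elts \<kappa>. Pow (elts \<beta>) \<prec> elts \<kappa>)"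

definition inaccessible :: "'v::zfc \<Rightarrow> bool"
  where "inaccessible \<kappa> \<longleftrightarrow> uncountable (elts \<kappa>) \<and> regular \<kappa> \<and> strong_limit \<kappa>"


section \<open>First-order logic in the language of set theory\<close>

datatype fm =
    Mem nat nat
  | Eq nat nat
  | Neg fm
  | Conj fm fm
  | Exists nat fm

abbreviation Forall :: "nat \<Rightarrow> fm \<Rightarrow> fm"
  where "Forall i \<phi> \<equiv> Neg (Exists i (Neg \<phi>))"

primrec fv :: "fm \<Rightarrow> nat set" where
  "fv (Mem i j) = {i, j}"
| "fv (Eq i j) = {i, j}"
| "fv (Neg \<phi>) = fv \<phi>"
| "fv (Conj \<phi> \<psi>) = fv \<phi> \<union> fv \<psi>"
| "fv (Exists i \<phi>) = fv \<phi> - {i}"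

primrec sat :: "'v::zfc set \<Rightarrow> (nat \<Rightarrow> 'v) \<Rightarrow> fm \<Rightarrow> bool" where
  "sat D s (Mem i j) \<longleftrightarrow> s i \<in> elts (s j)"
| "sat D s (Eq i j) \<longleftrightarrow> s i = s j"
| "sat D s (Neg \<phi>) \<longleftrightarrow> \<not> sat D s \<phi>"
| "sat D s (Conj \<phi> \<psi>) \<longleftrightarrow> sat D s \<phi> \<and> sat D s \<psi>"
| "sat D s (Exists i \<phi>) \<longleftrightarrow> (\<exists>x \<in> D. sat D (s(i := x)) \<phi>)"

definition sentence :: "fm \<Rightarrow> bool"
  where "sentence \<sigma> \<longleftrightarrow> fv \<sigma> = {}"

text \<open>
  Satisfaction depends only on the values of the free variables, so for sentences the choice of
  the assignment is immaterial (also when \<open>D\<close> is empty).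
\<close>

definition models :: "'v::zfc set \<Rightarrow> fm \<Rightarrow> bool"  (infix \<open>\<Turnstile>\<close> 50)
  where "D \<Turnstile> \<sigma> \<longleftrightarrow> (\<forall>s. sat D s \<sigma>)"

lemma sat_cong: "\<forall>i \<in> fv \<phi>. s i = t i \<Longrightarrow> sat D s \<phi> \<longleftrightarrow> sat D t \<phi>"
proof (induction \<phi> arbitrary: s t)
  case (Neg \<phi>)
  have "sat D s \<phi> \<longleftrightarrow> sat D t \<phi>"
    by (rule Neg.IH) (use Neg.prems in simp)
  then show ?case
    by simp
next
  case (Conj \<phi> \<psi>)
  have "sat D s \<phi> \<longleftrightarrow> sat D t \<phi>" "sat D s \<psi> \<longleftrightarrow> sat D t \<psi>"
    by (rule Conj.IH; use Conj.prems in simp)+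
  then show ?case
    by simp
next
  case (Exists i \<phi>)
  have "sat D (s(i := x)) \<phi> \<longleftrightarrow> sat D (t(i := x)) \<phi>" for x
    by (rule Exists.IH) (use Exists.prems in simp)
  then show ?case
    by simp
qed simp_all

lemma models_iff_sat:
  assumes "sentence \<sigma>"
  shows "D \<Turnstile> \<sigma> \<longleftrightarrow> sat D s \<sigma>"
proof -
  have "sat D t \<sigma> \<longleftrightarrow> sat D s \<sigma>" for t
    by (rule sat_cong) (use assms in \<open>simp add: sentence_def\<close>)
  then show ?thesis
    unfolding models_def by blast
qed

text \<open>The Levy hierarchy, with blocks of like quantifiers.\<close>

inductive Delta0 :: "fm \<Rightarrow> bool" where
  "Delta0 (Mem i j)"
| "Delta0 (Eq i j)"
| "Delta0 \<phi> \<Longrightarrow> Delta0 (Neg \<phi>)"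
| "Delta0 \<phi> \<Longrightarrow> Delta0 \<psi> \<Longrightarrow> Delta0 (Conj \<phi> \<psi>)"
| "Delta0 \<phi> \<Longrightarrow> i \<noteq> j \<Longrightarrow> Delta0 (Exists i (Conj (Mem i j) \<phi>))"

inductive Sigma_fm :: "nat \<Rightarrow> fm \<Rightarrow> bool" and Pi_fm :: "nat \<Rightarrow> fm \<Rightarrow> bool" where
  "Delta0 \<phi> \<Longrightarrow> Sigma_fm 0 \<phi>"
| "Delta0 \<phi> \<Longrightarrow> Pi_fm 0 \<phi>"
| "Pi_fm n \<phi> \<Longrightarrow> Sigma_fm (Suc n) \<phi>"
| "Sigma_fm n \<phi> \<Longrightarrow> Pi_fm (Suc n) \<phi>"
| "Sigma_fm (Suc n) \<phi> \<Longrightarrow> Sigma_fm (Suc n) (Exists i \<phi>)"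
| "Pi_fm (Suc n) \<phi> \<Longrightarrow> Pi_fm (Suc n) (Forall i \<phi>)"


section \<open>Second-order logic in the language of set theory\<close>

text \<open>
  \<open>SMemP i X\<close> says that the individual \<open>i\<close> belongs to the second-order
  variable \<open>X\<close>; \<open>SExists2\<close> quantifies over all subsets of the domain. The
  two sorts of variables have independent index sets.
\<close>

datatype sofm =
    SMem nat nat
  | SEq nat nat
  | SMemP nat nat
  | SNeg sofm
  | SConj sofm sofm
  | SExists nat sofm
  | SExists2 nat sofm

primrec sofv :: "sofm \<Rightarrow> nat set" where
  "sofv (SMem i j) = {i, j}"
| "sofv (SEq i j) = {i, j}"
| "sofv (SMemP i X) = {i}"
| "sofv (SNeg \<phi>) = sofv \<phi>"
| "sofv (SConj \<phi> \<psi>) = sofv \<phi> \<union> sofv \<psi>"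
| "sofv (SExists i \<phi>) = sofv \<phi> - {i}"
| "sofv (SExists2 X \<phi>) = sofv \<phi>"

primrec sofv2 :: "sofm \<Rightarrow> nat set" where
  "sofv2 (SMem i j) = {}"
| "sofv2 (SEq i j) = {}"
| "sofv2 (SMemP i X) = {X}"
| "sofv2 (SNeg \<phi>) = sofv2 \<phi>"
| "sofv2 (SConj \<phi> \<psi>) = sofv2 \<phi> \<union> sofv2 \<psi>"
| "sofv2 (SExists i \<phi>) = sofv2 \<phi>"
| "sofv2 (SExists2 X \<phi>) = sofv2 \<phi> - {X}"

primrec sosat :: "'v::zfc set \<Rightarrow> (nat \<Rightarrow> 'v) \<Rightarrow> (nat \<Rightarrow> 'v set) \<Rightarrow> sofm \<Rightarrow> bool" where
  "sosat D s S (SMem i j) \<longleftrightarrow> s i \<in> elts (s j)"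
| "sosat D s S (SEq i j) \<longleftrightarrow> s i = s j"
| "sosat D s S (SMemP i X) \<longleftrightarrow> s i \<in> S X"
| "sosat D s S (SNeg \<phi>) \<longleftrightarrow> \<not> sosat D s S \<phi>"
| "sosat D s S (SConj \<phi> \<psi>) \<longleftrightarrow> sosat D s S \<phi> \<and> sosat D s S \<psi>"
| "sosat D s S (SExists i \<phi>) \<longleftrightarrow> (\<exists>x \<in> D. sosat D (s(i := x)) S \<phi>)"
| "sosat D s S (SExists2 X \<phi>) \<longleftrightarrow> (\<exists>A \<subseteq> D. sosat D s (S(X := A)) \<phi>)"

definition so_sentence :: "sofm \<Rightarrow> bool"
  where "so_sentence \<sigma> \<longleftrightarrow> sofv \<sigma> = {} \<and> sofv2 \<sigma> = {}"

definition so_models :: "'v::zfc set \<Rightarrow> sofm \<Rightarrow> bool"  (infix \<open>\<Turnstile>\<^sub>2\<close> 50)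
  where "D \<Turnstile>\<^sub>2 \<sigma> \<longleftrightarrow> (\<forall>s S. sosat D s S \<sigma>)"


section \<open>Sentential categoricity, absolute definability and correctness\<close>

definition fo_sententially_categorical :: "'v::zfc \<Rightarrow> bool"
  where "fo_sententially_categorical \<kappa> \<longleftrightarrow>
    (\<exists>\<sigma>. sentence \<sigma> \<and> inaccessible \<kappa> \<and> Vset \<kappa> \<Turnstile> \<sigma> \<and>
      (\<forall>\<mu>. inaccessible \<mu> \<and> \<mu> \<noteq> \<kappa> \<longrightarrow> \<not> Vset \<mu> \<Turnstile> \<sigma>))"

definition so_sententially_categorical :: "'v::zfc \<Rightarrow> bool"
  where "so_sententially_categorical \<kappa> \<longleftrightarrow>
    (\<exists>\<sigma>. so_sentence \<sigma> \<and> inaccessible \<kappa> \<and> Vset \<kappa> \<Turnstile>\<^sub>2 \<sigma> \<and>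
      (\<forall>\<mu>. inaccessible \<mu> \<and> \<mu> \<noteq> \<kappa> \<longrightarrow> \<not> Vset \<mu> \<Turnstile>\<^sub>2 \<sigma>))"

definition order_sententially_categorical :: "'v::zfc \<Rightarrow> 'v \<Rightarrow> bool"
  where "order_sententially_categorical \<alpha> \<kappa> \<longleftrightarrow>
    (\<exists>\<sigma>. sentence \<sigma> \<and> inaccessible \<kappa> \<and> Vset (\<kappa> \<oplus> \<alpha>) \<Turnstile> \<sigma> \<and>
      (\<forall>\<mu>. inaccessible \<mu> \<and> \<mu> \<noteq> \<kappa> \<longrightarrow> \<not> Vset (\<mu> \<oplus> \<alpha>) \<Turnstile> \<sigma>))"

definition absolutely_definable :: "'v::zfc \<Rightarrow> bool"
  where "absolutely_definable \<alpha> \<longleftrightarrow> Ord \<alpha> \<and>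
    (\<exists>\<psi>. fv \<psi> \<subseteq> {0} \<and>
      (\<forall>\<kappa>. inaccessible \<kappa> \<longrightarrow>
        \<alpha> \<in> Vset \<kappa> \<and> (\<forall>x \<in> Vset \<kappa>. sat (Vset \<kappa>) (\<lambda>_. x) \<psi> \<longleftrightarrow> x = \<alpha>)))"

definition lightface_Sigma2_correct :: "'v::zfc \<Rightarrow> bool"
  where "lightface_Sigma2_correct \<delta> \<longleftrightarrow> Ord \<delta> \<and>
    (\<forall>\<sigma>. sentence \<sigma> \<and> Sigma_fm 2 \<sigma> \<longrightarrow> (Vset \<delta> \<Turnstile> \<sigma> \<longleftrightarrow> (UNIV :: 'v set) \<Turnstile> \<sigma>))"

definition is_ord_sup :: "'v::zfc set \<Rightarrow> 'v \<Rightarrow> bool"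
  where "is_ord_sup S \<theta> \<longleftrightarrow> Ord \<theta> \<and> (\<forall>\<kappa> \<in> S. \<kappa> \<preceq> \<theta>) \<and>
    (\<forall>\<beta>. Ord \<beta> \<and> (\<forall>\<kappa> \<in> S. \<kappa> \<preceq> \<beta>) \<longrightarrow> \<theta> \<preceq> \<beta>)"

definition is_ord_least :: "'v::zfc set \<Rightarrow> 'v \<Rightarrow> bool"
  where "is_ord_least S \<delta> \<longleftrightarrow> \<delta> \<in> S \<and> (\<forall>\<beta> \<in> S. \<delta> \<preceq> \<beta>)"

end

theory Submission
  imports Defs
begin

text \<open>
  Being \<open>V\<^sub>\<kappa>\<close> for an inaccessible \<open>\<kappa>\<close> is expressed by satisfaction of second-order
  ZFC, and this is absolute between the levels of the hierarchy. If a second-order or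
  \<open>\<alpha>\<close>-order sentence singles out \<open>\<kappa>\<close>, then the next inaccessible \<open>\<rho>\<close> is first-order
  categorical: \<open>V\<^sub>\<rho>\<close> is the level whose largest inaccessible satisfies that sentence. Conversely
  \<open>V\<^sub>\<kappa>\<close> is definable in \<open>V\<^sub>\<kappa>\<^sub>+\<^sub>\<alpha>\<close>, as the largest universe in it. So
  the sets of categorical cardinals are cofinal in each other.

  If \<open>\<kappa>\<close> is categorical via \<open>\<sigma>\<close>, then the existence of a universe satisfying \<open>\<sigma>\<close> is a
  true \<open>\<Sigma>\<^sub>2\<close> sentence, hence witnessed below every correct cardinal. With a proper class of
  inaccessibles, a true \<open>\<Sigma>\<^sub>2\<close> sentence holds in some inaccessible level, and the least
  inaccessible level where it holds is categorical; as inaccessible levels are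
  \<open>\<Sigma>\<^sub>1\<close>-elementary in the universe, the supremum is therefore itself correct.
\<close>

section \<open>Sets and ordinals\<close>

text \<open>Two obstacles shape the development. First, \<open>inaccessible\<close> speaks of HOL
  functions and equipollence, whereas the sentences to be built are first-order. The detour is
  \<open>universe\<close>: closure under all functions can be tested by one set variable
  \<open>F\<close> ranging over subsets of the candidate, with every other quantifier bounded. Being
  a universe is thus one universal quantifier before a Delta0 matrix, which keeps the existence of a
  universe with a given first-order property syntactically Sigma_2. Second, the correctness
  arguments need Skolem hulls in the class of all sets. As \<open>sat UNIV\<close> is an ordinary
  HOL predicate, full Tarski-Vaught chains are available: one yields a correct cardinal, others the
  hulls whose collapses land in \<open>Vset \<kappa>\<close>. Their size is measured by
  \<open>usmall\<close>, which applies to HOL sets of any type, so formulas and parameter lists need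
  no coding. In the \<alpha>-order case \<open>absolutely_definable\<close> serves twice: its
  formula lets \<open>Vset \<rho>\<close> name \<alpha>, and \<alpha> lying in every inaccessible
  level keeps \<kappa> \<oplus> \<alpha> below the next inaccessible.\<close>

lemma mem_induct [case_names step]:
  fixes x :: "'v::zfc"
  assumes "\<And>x. (\<And>y. y \<in> elts x \<Longrightarrow> P y) \<Longrightarrow> P x"
  shows "P x"
  using foundation
proof (induction x rule: wf_induct_rule)
  case (less x)
  then show ?case
    using assms by simp
qed

lemma mem_not_refl: "x \<notin> elts x"
  by (induction x rule: mem_induct) blast

lemma mem_not_sym: "x \<in> elts y \<Longrightarrow> y \<notin> elts x"
  by (induction x arbitrary: y rule: mem_induct) blast

lemma mem_minimal:
  fixes S :: "'v::zfc set"
  assumes "x \<in> S"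
  obtains m where "m \<in> S" "\<And>y. y \<in> elts m \<Longrightarrow> y \<notin> S"
proof -
  obtain m where "m \<in> S" "\<And>y. (y, m) \<in> {(x, y). x \<in> elts y} \<Longrightarrow> y \<notin> S"
    using wfE_min[OF foundation assms] by metis
  then show thesis
    using that by simp
qed

lemma elts_eq_iff: "elts x = elts y \<longleftrightarrow> x = y"
  using extensionality by blast

section \<open>Smallness and comparison of sizes\<close>

lemma small_subset:
  fixes X :: "'v::zfc set"
  assumes "small Y" "X \<subseteq> Y"
  shows "small X"
proof -
  obtain y where y: "Y = elts y"
    using assms(1) by (auto simp: small_def)
  obtain z where "elts z = {u \<in> elts y. u \<in> X}"
    using separation[of y "\<lambda>u. u \<in> X"] by blast
  then have "elts z = X"
    using assms(2) y by auto
  then show ?thesis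
    using small_elts[of z] by simp
qed

lemma small_pair: "small {x, y}"
  using pairing[of x y] by (metis small_elts)

lemma small_Union:
  fixes F :: "'v::zfc set"
  assumes "small F"
  shows "small (\<Union>(elts ` F))"
proof -
  obtain f where "F = elts f"
    using assms by (auto simp: small_def)
  then show ?thesis
    using union[of f] by (metis small_elts)
qed

lemma small_UN:
  fixes I :: "'v::zfc set" and X :: "'v \<Rightarrow> 'v set"
  assumes "small I" "\<And>i. i \<in> I \<Longrightarrow> small (X i)"
  shows "small (\<Union>i\<in>I. X i)"
proof -
  have "(\<Union>i\<in>I. X i) = \<Union>(elts ` (\<lambda>i. set_of (X i)) ` I)"
    using assms(2) by (auto simp: elts_set_of)
  then show ?thesis
    using small_Union[OF small_image[OF assms(1)], of "\<lambda>i. set_of (X i)"] by simp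
qed

lemma small_powerset: "small {y. elts y \<subseteq> elts x}"
  using powerset[of x] by (metis small_elts)

lemma powerset_eqpoll:
  fixes X :: "'v::zfc set"
  assumes "small X"
  shows "{y. elts y \<subseteq> X} \<approx> Pow X"
proof -
  have "A \<in> elts ` {y. elts y \<subseteq> X}" if "A \<subseteq> X" for A
    using elts_set_of[OF small_subset[OF assms that]] that by (intro image_eqI[of _ _ "set_of A"]) auto
  then have "bij_betw elts {y. elts y \<subseteq> X} (Pow X)"
    unfolding bij_betw_def inj_on_def by (auto simp: elts_eq_iff)
  then show ?thesis
    unfolding eqpoll_def by blast
qed

lemma lepoll_linear: "A \<lesssim> B \<or> B \<lesssim> A"
  unfolding lepoll_def using ordLeq_total[OF card_of_Well_order card_of_Well_order, of A B]
  by (simp add: card_of_ordLeq)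

lemma lesspoll_iff_not_lepoll: "A \<prec> B \<longleftrightarrow> \<not> B \<lesssim> A"
  unfolding lesspoll_def using lepoll_linear[of A B] lepoll_antisym eqpoll_sym eqpoll_imp_lepoll by blast

lemma Pow_lepoll_mono: "A \<lesssim> B \<Longrightarrow> Pow A \<lesssim> Pow B"
  unfolding lepoll_def by (metis image_Pow_surj inj_on_image_Pow image_Pow_mono)

section \<open>Ordinals and their suprema\<close>

lemma Ord_mem: "Ord \<alpha> \<Longrightarrow> \<beta> \<in> elts \<alpha> \<Longrightarrow> Ord \<beta>"
  unfolding Ord_def transitive_def by blast

lemma Ord_trans: "Ord \<gamma> \<Longrightarrow> \<alpha> \<in> elts \<beta> \<Longrightarrow> \<beta> \<in> elts \<gamma> \<Longrightarrow> \<alpha> \<in> elts \<gamma>"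
  unfolding Ord_def transitive_def by blast

lemma Ord_mem_imp_le: "Ord \<beta> \<Longrightarrow> \<alpha> \<in> elts \<beta> \<Longrightarrow> \<alpha> \<preceq> \<beta>"
  unfolding Ord_def transitive_def by blast

lemma Ord_transitive_subset:
  assumes "\<And>\<beta>. \<beta> \<in> elts \<alpha> \<Longrightarrow> Ord \<beta>" "transitive \<alpha>"
  shows "Ord \<alpha>"
  using assms unfolding Ord_def by blast

text \<open>Nested \<in>-inductions: if trichotomy failed for \<alpha> and \<beta>, the two
  induction hypotheses together would give them the same elements.\<close>

lemma Ord_linear:
  assumes "Ord \<alpha>" "Ord \<beta>"
  shows "\<alpha> \<in> elts \<beta> \<or> \<alpha> = \<beta> \<or> \<beta> \<in> elts \<alpha>"
  using assms
proof (induction \<alpha> arbitrary: \<beta> rule: mem_induct)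
  case (step \<alpha>)
  note IH = step
  show ?case
    using IH(3)
  proof (induction \<beta> rule: mem_induct)
    case (step \<beta>)
    show ?case
    proof (rule ccontr)
      assume neg: "\<not> (\<alpha> \<in> elts \<beta> \<or> \<alpha> = \<beta> \<or> \<beta> \<in> elts \<alpha>)"
      have "elts \<alpha> = elts \<beta>"
      proof (intro equalityI subsetI)
        fix x assume x: "x \<in> elts \<alpha>"
        then have "x \<in> elts \<beta> \<or> x = \<beta> \<or> \<beta> \<in> elts x"
          using IH(1) IH(2) step.prems Ord_mem by blast
        then show "x \<in> elts \<beta>"
          using neg x Ord_trans[OF IH(2)] by blast
      next
        fix x assume x: "x \<in> elts \<beta>"
        then have "\<alpha> \<in> elts x \<or> \<alpha> = x \<or> x \<in> elts \<alpha>"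
          using step.IH step.prems Ord_mem by blast
        then show "x \<in> elts \<alpha>"
          using neg x Ord_trans[OF step.prems] by blast
      qed
      then show False
        using neg by (simp add: elts_eq_iff)
    qed
  qed
qed

lemma Ord_le_iff: "Ord \<alpha> \<Longrightarrow> Ord \<beta> \<Longrightarrow> \<alpha> \<preceq> \<beta> \<longleftrightarrow> \<alpha> \<in> elts \<beta> \<or> \<alpha> = \<beta>"
  using Ord_linear[of \<alpha> \<beta>] Ord_mem_imp_le[of \<beta> \<alpha>] mem_not_refl[of \<beta>] by blast

lemma Ord_not_le: "Ord \<alpha> \<Longrightarrow> Ord \<beta> \<Longrightarrow> \<not> \<alpha> \<preceq> \<beta> \<longleftrightarrow> \<beta> \<in> elts \<alpha>"
  using Ord_linear[of \<alpha> \<beta>] Ord_le_iff[of \<alpha> \<beta>] mem_not_refl[of \<beta>] mem_not_sym[of \<alpha> \<beta>] by blast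

lemma Ord_least:
  fixes S :: "'v::zfc set"
  assumes "\<alpha> \<in> S" "\<And>\<beta>. \<beta> \<in> S \<Longrightarrow> Ord \<beta>"
  obtains \<mu> where "\<mu> \<in> S" "\<And>\<beta>. \<beta> \<in> S \<Longrightarrow> \<mu> \<preceq> \<beta>"
proof -
  obtain \<mu> where \<mu>: "\<mu> \<in> S" "\<And>\<beta>. \<beta> \<in> elts \<mu> \<Longrightarrow> \<beta> \<notin> S"
    using mem_minimal[OF assms(1)] by blast
  then have "\<mu> \<preceq> \<beta>" if "\<beta> \<in> S" for \<beta>
    using Ord_not_le[of \<mu> \<beta>] assms(2) that by blast
  then show thesis
    using that \<mu>(1) by blast
qed

lemma Ord_set_of:
  fixes S :: "'v::zfc set"
  assumes "small S" "\<And>\<beta>. \<beta> \<in> S \<Longrightarrow> Ord \<beta>" "\<And>\<beta>. \<beta> \<in> S \<Longrightarrow> elts \<beta> \<subseteq> S"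
  shows "Ord (set_of S)"
proof (rule Ord_transitive_subset)
  show "Ord \<beta>" if "\<beta> \<in> elts (set_of S)" for \<beta>
    using that assms(2) by (simp add: elts_set_of[OF assms(1)])
  show "transitive (set_of S)"
    unfolding transitive_def elts_set_of[OF assms(1)] using assms(3) by simp
qed

lemma Ord_Union:
  assumes "elts \<theta> = \<Union>(elts ` S)" "\<And>\<beta>. \<beta> \<in> S \<Longrightarrow> Ord \<beta>"
  shows "Ord \<theta>"
proof (rule Ord_transitive_subset)
  show "Ord \<beta>" if "\<beta> \<in> elts \<theta>" for \<beta>
    using that assms Ord_mem by blast
  show "transitive \<theta>"
    unfolding transitive_def assms(1) using assms(2) Ord_mem_imp_le by blast
qed

lemma is_ord_sup_exists:
  fixes S :: "'v::zfc set"
  assumes "small S" "\<And>\<beta>. \<beta> \<in> S \<Longrightarrow> Ord \<beta>"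
  shows "is_ord_sup S (set_of (\<Union>(elts ` S)))"
proof -
  have "Ord (set_of (\<Union>(elts ` S)))"
    using elts_set_of[OF small_Union[OF assms(1)]] assms(2) by (rule Ord_Union)
  then show ?thesis
    unfolding is_ord_sup_def elts_set_of[OF small_Union[OF assms(1)]] by blast
qed

lemma is_ord_sup_memD:
  assumes "is_ord_sup S \<theta>" "\<beta> \<in> elts \<theta>" "\<And>\<kappa>. \<kappa> \<in> S \<Longrightarrow> Ord \<kappa>"
  obtains \<kappa> where "\<kappa> \<in> S" "\<beta> \<in> elts \<kappa>"
proof -
  have "Ord \<beta>" "Ord \<theta>"
    using assms Ord_mem unfolding is_ord_sup_def by blast+
  then have "\<not> \<theta> \<preceq> \<beta>"
    using assms(2) mem_not_refl by blast
  then obtain \<kappa> where "\<kappa> \<in> S" "\<not> \<kappa> \<preceq> \<beta>"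
    using assms(1) \<open>Ord \<beta>\<close> unfolding is_ord_sup_def by blast
  then show thesis
    using that assms(3) Ord_not_le \<open>Ord \<beta>\<close> by blast
qed

text \<open>Mutually cofinal families have the same upper bounds; this is how the three suprema are
  identified.\<close>

lemma is_ord_sup_mutually_cofinal:
  assumes "is_ord_sup S \<theta>" "\<And>\<kappa>. \<kappa> \<in> S \<Longrightarrow> \<exists>\<mu>\<in>T. \<kappa> \<preceq> \<mu>" "\<And>\<mu>. \<mu> \<in> T \<Longrightarrow> \<exists>\<kappa>\<in>S. \<mu> \<preceq> \<kappa>"
  shows "is_ord_sup T \<theta>"
  unfolding is_ord_sup_def
proof (intro conjI ballI allI impI)
  show "Ord \<theta>"
    using assms(1) by (simp add: is_ord_sup_def)
  show "\<mu> \<preceq> \<theta>" if "\<mu> \<in> T" for \<mu>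
    using assms(1) assms(3)[OF that] unfolding is_ord_sup_def by blast
  show "\<theta> \<preceq> \<beta>" if \<beta>: "Ord \<beta> \<and> (\<forall>\<kappa>\<in>T. \<kappa> \<preceq> \<beta>)" for \<beta>
  proof -
    have "\<kappa> \<preceq> \<beta>" if "\<kappa> \<in> S" for \<kappa>
      using assms(2)[OF that] \<beta> by blast
    then show ?thesis
      using assms(1) \<beta> unfolding is_ord_sup_def by blast
  qed
qed

definition osucc :: "'v::zfc \<Rightarrow> 'v"
  where "osucc \<alpha> = set_of (insert \<alpha> (elts \<alpha>))"

lemma elts_osucc: "elts (osucc \<alpha>) = insert \<alpha> (elts \<alpha>)"
  unfolding osucc_def using small_Un[OF small_pair[of \<alpha> \<alpha>] small_elts[of \<alpha>]]
  by (simp add: elts_set_of)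

lemma Ord_osucc: "Ord \<alpha> \<Longrightarrow> Ord (osucc \<alpha>)"
  unfolding Ord_def transitive_def elts_osucc by blast

lemma Ord_upper_bound:
  fixes S :: "'v::zfc set"
  assumes "small S" "\<And>\<beta>. \<beta> \<in> S \<Longrightarrow> Ord \<beta>"
  obtains \<gamma> where "Ord \<gamma>" "S \<subseteq> elts \<gamma>"
proof -
  let ?\<theta> = "set_of (\<Union>(elts ` S))"
  have sup: "is_ord_sup S ?\<theta>"
    by (rule is_ord_sup_exists[OF assms])
  then have "Ord ?\<theta>" "\<And>\<beta>. \<beta> \<in> S \<Longrightarrow> \<beta> \<preceq> ?\<theta>"
    unfolding is_ord_sup_def by blast+
  then have "S \<subseteq> elts (osucc ?\<theta>)"
    using assms(2) by (auto simp: elts_osucc Ord_le_iff)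
  then show thesis
    using that Ord_osucc \<open>Ord ?\<theta>\<close> by blast
qed

text \<open>The Burali-Forti argument.\<close>

lemma not_small_Ord: "\<not> small {\<alpha> :: 'v::zfc. Ord \<alpha>}"
proof
  assume "small {\<alpha> :: 'v. Ord \<alpha>}"
  then obtain \<gamma> :: 'v where "Ord \<gamma>" "{\<alpha>. Ord \<alpha>} \<subseteq> elts \<gamma>"
    using Ord_upper_bound[of "{\<alpha>. Ord \<alpha>}"] by blast
  then have "\<gamma> \<in> elts \<gamma>"
    by blast
  then show False
    by (simp add: mem_not_refl)
qed

lemma small_lepoll:
  fixes X :: "'v::zfc set" and Y :: "'v set"
  assumes "small Y" "X \<lesssim> Y"
  shows "small X"
  using assms small_image small_subset unfolding lepoll_iff by blast

subsection \<open>Cardinals\<close>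

text \<open>A Hartogs argument. Suppose every ordinal injects into \<beta>. The ordinals are too
  many to inject into the power set \<open>?P\<close>, so by comparability \<open>?P\<close> injects
  into the ordinals, hence into one ordinal and then into \<beta>, against Cantor. The least ordinal
  that does not inject into \<beta> is the required cardinal.\<close>

lemma ex_larger_Card:
  fixes \<beta> :: "'v::zfc"
  assumes "Ord \<beta>"
  obtains \<gamma> where "Card \<gamma>" "\<beta> \<in> elts \<gamma>"
proof -
  let ?P = "{y. elts y \<subseteq> elts \<beta>}"
  have smallP: "small ?P"
    by (rule small_powerset)
  have P: "?P \<approx> Pow (elts \<beta>)"
    by (rule powerset_eqpoll[OF small_elts])
  have "\<exists>\<gamma>::'v. Ord \<gamma> \<and> \<not> elts \<gamma> \<lesssim> elts \<beta>"
  proof (rule ccontr)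
    assume "\<not> ?thesis"
    then have le: "\<And>\<gamma>::'v. Ord \<gamma> \<Longrightarrow> elts \<gamma> \<lesssim> elts \<beta>"
      by blast
    have "\<not> {\<alpha>::'v. Ord \<alpha>} \<lesssim> ?P"
      using small_lepoll[OF smallP] not_small_Ord by blast
    then obtain f where f: "inj_on f ?P" "f ` ?P \<subseteq> {\<alpha>::'v. Ord \<alpha>}"
      using lepoll_linear[of ?P "{\<alpha>::'v. Ord \<alpha>}"] unfolding lepoll_def by blast
    obtain \<gamma> where \<gamma>: "Ord \<gamma>" "f ` ?P \<subseteq> elts \<gamma>"
      using Ord_upper_bound[OF small_image[OF smallP], of f] f by blast
    then have "?P \<lesssim> elts \<gamma>"
      using f unfolding lepoll_def by blast
    then have "Pow (elts \<beta>) \<lesssim> elts \<beta>"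
      using P le[OF \<gamma>(1)] lepoll_trans lepoll_trans1 eqpoll_sym by blast
    then show False
      using lesspoll_Pow_self[of "elts \<beta>"] unfolding lesspoll_iff_not_lepoll by blast
  qed
  then obtain \<gamma>' where "\<gamma>' \<in> {\<gamma>::'v. Ord \<gamma> \<and> \<not> elts \<gamma> \<lesssim> elts \<beta>}"
    by blast
  then obtain \<gamma> :: 'v where \<gamma>: "\<gamma> \<in> {\<gamma>. Ord \<gamma> \<and> \<not> elts \<gamma> \<lesssim> elts \<beta>}"
      "\<And>\<alpha>. \<alpha> \<in> elts \<gamma> \<Longrightarrow> \<alpha> \<notin> {\<gamma>. Ord \<gamma> \<and> \<not> elts \<gamma> \<lesssim> elts \<beta>}"
    by (rule mem_minimal) blast
  then have "elts \<alpha> \<lesssim> elts \<beta>" if "\<alpha> \<in> elts \<gamma>" for \<alpha>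
    using that Ord_mem by blast
  then have "Card \<gamma>"
    using \<gamma>(1) eqpoll_sym lepoll_trans1 unfolding Card_def by blast
  moreover have "\<beta> \<in> elts \<gamma>"
    using Ord_not_le[of \<gamma> \<beta>] \<gamma>(1) assms subset_imp_lepoll by blast
  ultimately show thesis
    using that by blast
qed

text \<open>An ordinal \<beta> below the supremum is below some \<kappa> of the family; if \<beta>
  were equipollent to the supremum, then \<kappa>, lying between them, would be equipollent to
  \<beta>.\<close>

lemma Card_is_ord_sup:
  assumes "is_ord_sup S \<theta>" "\<And>\<kappa>. \<kappa> \<in> S \<Longrightarrow> Card \<kappa>"
  shows "Card \<theta>"
  unfolding Card_def
proof (intro conjI ballI notI)
  show "Ord \<theta>"
    using assms(1) by (simp add: is_ord_sup_def)
  fix \<beta> assume \<beta>: "\<beta> \<in> elts \<theta>" "elts \<beta> \<approx> elts \<theta>"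
  obtain \<kappa> where \<kappa>: "\<kappa> \<in> S" "\<beta> \<in> elts \<kappa>"
    using is_ord_sup_memD[OF assms(1) \<beta>(1)] assms(2) unfolding Card_def by blast
  have "elts \<kappa> \<lesssim> elts \<theta>"
    using assms(1) \<kappa>(1) subset_imp_lepoll unfolding is_ord_sup_def by blast
  then have "elts \<kappa> \<lesssim> elts \<beta>"
    using \<beta>(2) eqpoll_sym lepoll_trans2 by blast
  moreover have "Ord \<kappa>" "\<not> elts \<beta> \<approx> elts \<kappa>"
    using assms(2)[OF \<kappa>(1)] \<kappa>(2) unfolding Card_def by simp_all
  ultimately show False
    using subset_imp_lepoll[OF Ord_mem_imp_le[OF \<open>Ord \<kappa>\<close> \<kappa>(2)]] lepoll_antisym by blast
qed

section \<open>The cumulative hierarchy\<close>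

lemma mem_Vset_iff: "x \<in> Vset \<alpha> \<longleftrightarrow> (\<exists>\<beta>\<in>elts \<alpha>. elts x \<subseteq> Vset \<beta>)"
  by (subst Vset.simps) auto

lemma Vset_mono: "\<alpha> \<preceq> \<beta> \<Longrightarrow> Vset \<alpha> \<subseteq> Vset \<beta>"
  unfolding subset_iff[of "Vset \<alpha>"] mem_Vset_iff by blast

lemma Vset_subset_closed: "x \<in> Vset \<alpha> \<Longrightarrow> elts y \<subseteq> elts x \<Longrightarrow> y \<in> Vset \<alpha>"
  unfolding mem_Vset_iff by blast

lemma Vset_trans: "Ord \<alpha> \<Longrightarrow> x \<in> Vset \<alpha> \<Longrightarrow> y \<in> elts x \<Longrightarrow> y \<in> Vset \<alpha>"
  using Vset_mono Ord_mem_imp_le unfolding mem_Vset_iff[of x] by blast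

lemma small_Vset: "small (Vset \<alpha>)"
proof (induction \<alpha> rule: mem_induct)
  case (step \<alpha>)
  have "small {x. elts x \<subseteq> Vset \<beta>}" if "\<beta> \<in> elts \<alpha>" for \<beta>
    using small_powerset[of "set_of (Vset \<beta>)"] step[OF that] by (simp add: elts_set_of)
  then show ?case
    by (subst Vset.simps) (rule small_UN[OF small_elts])
qed

lemma elts_set_of_Vset: "elts (set_of (Vset \<alpha>)) = Vset \<alpha>"
  by (rule elts_set_of[OF small_Vset])

lemma Ord_subset_Vset: "Ord \<alpha> \<Longrightarrow> elts \<alpha> \<subseteq> Vset \<alpha>"
proof (induction \<alpha> rule: mem_induct)
  case (step \<alpha>)
  then show ?case
    using Ord_mem mem_Vset_iff by blast
qed

text \<open>No ordinal lies in its own level and levels are closed under subsets, so \<beta> in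
  \<open>Vset \<alpha>\<close> excludes \<alpha> \<preceq> \<beta>.\<close>

lemma Ord_mem_Vset_iff:
  assumes "Ord \<alpha>" "Ord \<beta>"
  shows "\<beta> \<in> Vset \<alpha> \<longleftrightarrow> \<beta> \<in> elts \<alpha>"
proof
  have "Ord \<alpha> \<Longrightarrow> \<alpha> \<notin> Vset \<alpha>" for \<alpha> :: 'a
  proof (induction \<alpha> rule: mem_induct)
    case (step \<alpha>)
    then show ?case
      using Ord_mem mem_Vset_iff[of \<alpha> \<alpha>] by blast
  qed
  note irrefl = this
  assume "\<beta> \<in> Vset \<alpha>"
  then have "\<not> \<alpha> \<preceq> \<beta>"
    using irrefl[OF assms(1)] Vset_subset_closed by blast
  then show "\<beta> \<in> elts \<alpha>"
    using Ord_not_le assms by blast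
next
  show "\<beta> \<in> elts \<alpha> \<Longrightarrow> \<beta> \<in> Vset \<alpha>"
    using Ord_subset_Vset[OF assms(1)] by blast
qed

lemma Vset_mem_Vset_iff:
  assumes "Ord \<alpha>" "Ord \<beta>"
  shows "set_of (Vset \<beta>) \<in> Vset \<alpha> \<longleftrightarrow> \<beta> \<in> elts \<alpha>"
proof
  assume "set_of (Vset \<beta>) \<in> Vset \<alpha>"
  then have "\<beta> \<in> Vset \<alpha>"
    by (rule Vset_subset_closed) (simp add: elts_set_of_Vset Ord_subset_Vset assms)
  then show "\<beta> \<in> elts \<alpha>"
    by (simp add: Ord_mem_Vset_iff assms)
next
  show "\<beta> \<in> elts \<alpha> \<Longrightarrow> set_of (Vset \<beta>) \<in> Vset \<alpha>"
    unfolding mem_Vset_iff by (auto simp: elts_set_of_Vset)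
qed

lemma Vset_inject: "Ord \<alpha> \<Longrightarrow> Ord \<beta> \<Longrightarrow> Vset \<alpha> = Vset \<beta> \<Longrightarrow> \<alpha> = \<beta>"
  using Ord_linear[of \<alpha> \<beta>] Ord_mem_Vset_iff[of \<alpha>] Ord_mem_Vset_iff[of \<beta>] mem_not_refl by metis

lemma small_subset_Vset:
  fixes X :: "'v::zfc set"
  assumes "small X" "\<And>x. x \<in> X \<Longrightarrow> \<exists>\<beta>. Ord \<beta> \<and> x \<in> Vset \<beta>"
  obtains \<gamma> where "Ord \<gamma>" "X \<subseteq> Vset \<gamma>"
proof -
  obtain b where b: "\<And>x. x \<in> X \<Longrightarrow> Ord (b x) \<and> x \<in> Vset (b x)"
    using assms(2) by metis
  obtain \<gamma> where \<gamma>: "Ord \<gamma>" "b ` X \<subseteq> elts \<gamma>"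
    using Ord_upper_bound[OF small_image[OF assms(1)], of b] b by blast
  have "x \<in> Vset \<gamma>" if "x \<in> X" for x
    using b[OF that] Vset_mono[OF Ord_mem_imp_le, of \<gamma> "b x"] \<gamma> that by blast
  then show thesis
    using that \<gamma> by blast
qed

lemma ex_mem_Vset: "\<exists>\<beta>. Ord \<beta> \<and> x \<in> Vset \<beta>"
proof (induction x rule: mem_induct)
  case (step x)
  obtain \<gamma> where "Ord \<gamma>" "elts x \<subseteq> Vset \<gamma>"
    using small_subset_Vset[OF small_elts step] by blast
  then have "x \<in> Vset (osucc \<gamma>)" "Ord (osucc \<gamma>)"
    by (auto simp: mem_Vset_iff elts_osucc Ord_osucc)
  then show ?case
    by blast
qed

section \<open>Mostowski collapse\<close>

text \<open>The recursion runs along true membership and discards elements outside \<open>M\<close>.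
  Hence \<open>M\<close> may be a proper class or fail to be transitive, and \<open>x\<close> need
  not belong to it.\<close>

function collapse :: "'v::zfc set \<Rightarrow> 'v \<Rightarrow> 'v"
  where "collapse M x = set_of (collapse M ` (elts x \<inter> M))"
  by pat_completeness auto
termination
  by (relation "inv_image {(x, y). x \<in> elts y} snd") (auto simp: foundation wf_inv_image)

declare collapse.simps [simp del]

lemma elts_collapse: "elts (collapse M x) = collapse M ` (elts x \<inter> M)"
  by (subst collapse.simps) (rule elts_set_of[OF small_image[OF small_subset[OF small_elts Int_lower1]]])

lemma collapse_Ord: "Ord x \<Longrightarrow> Ord (collapse M x)"
proof (induction x rule: mem_induct)
  case (step x)
  have "Ord \<beta>" if "\<beta> \<in> elts (collapse M x)" for \<beta>
    using that step Ord_mem[OF step.prems] by (auto simp: elts_collapse)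
  moreover have "transitive (collapse M x)"
    unfolding transitive_def elts_collapse using Ord_trans[OF step.prems]
    by (auto simp: elts_collapse)
  ultimately show ?case
    by (rule Ord_transitive_subset)
qed

text \<open>The hypothesis is extensionality of the structure \<open>M\<close>. A Skolem hull has it
  by elementarity, a set of ordinals by linearity.\<close>

lemma inj_on_collapse:
  assumes "\<And>x y. x \<in> M \<Longrightarrow> y \<in> M \<Longrightarrow> elts x \<inter> M = elts y \<inter> M \<Longrightarrow> x = y"
  shows "inj_on (collapse M) M"
proof -
  have "x \<in> M \<Longrightarrow> \<forall>y\<in>M. collapse M x = collapse M y \<longrightarrow> x = y" for x
  proof (induction x rule: mem_induct)
    case (step x)
    show ?case
    proof (intro ballI impI)
      fix y assume y: "y \<in> M" "collapse M x = collapse M y"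
      then have im: "collapse M ` (elts x \<inter> M) = collapse M ` (elts y \<inter> M)"
        by (metis elts_collapse)
      have "elts x \<inter> M = elts y \<inter> M"
      proof (intro equalityI subsetI)
        fix z assume z: "z \<in> elts x \<inter> M"
        then obtain w where "w \<in> elts y \<inter> M" "collapse M z = collapse M w"
          using im by (metis imageE imageI)
        then show "z \<in> elts y \<inter> M"
          using step.IH[of z] z by blast
      next
        fix w assume w: "w \<in> elts y \<inter> M"
        then obtain z where "z \<in> elts x \<inter> M" "collapse M z = collapse M w"
          using im by (metis imageE imageI)
        then show "w \<in> elts x \<inter> M"
          using step.IH[of z] w by blast
      qed
      then show "x = y"
        by (rule assms[OF step.prems y(1)])
    qed
  qed
  then show ?thesis
    unfolding inj_on_def by blast
qed

lemma collapse_mem_iff: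
  assumes "inj_on (collapse M) M" "x \<in> M" "y \<in> M"
  shows "collapse M x \<in> elts (collapse M y) \<longleftrightarrow> x \<in> elts y"
  using assms unfolding elts_collapse inj_on_def by blast

lemma collapse_fixes_transitive:
  assumes "T \<subseteq> M" "\<And>x. x \<in> T \<Longrightarrow> elts x \<subseteq> T" "x \<in> T"
  shows "collapse M x = x"
  using assms(3)
proof (induction x rule: mem_induct)
  case (step x)
  have "elts x \<inter> M = elts x"
    using assms(1) assms(2)[OF step.prems] by blast
  moreover have "collapse M ` elts x = elts x"
    using step assms(2)[OF step.prems] by (intro equalityI subsetI) force+
  ultimately show ?case
    by (simp add: elts_collapse flip: elts_eq_iff)
qed

text \<open>The collapse of a set of ordinals is its order type.\<close>

lemma small_Ord_eqpoll:
  fixes S :: "'v::zfc set"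
  assumes "small S" "\<And>\<beta>. \<beta> \<in> S \<Longrightarrow> Ord \<beta>"
  obtains \<mu> :: 'v where "Ord \<mu>" "S \<approx> elts \<mu>"
proof -
  have "x = y" if "x \<in> S" "y \<in> S" "elts x \<inter> S = elts y \<inter> S" for x y
    using Ord_linear[OF assms(2)[OF that(1)] assms(2)[OF that(2)]] that
      mem_not_refl[of x] mem_not_refl[of y] by blast
  then have "S \<approx> collapse S ` S"
    using inj_on_image_eqpoll_self[OF inj_on_collapse] eqpoll_sym by blast
  moreover have "Ord (set_of (collapse S ` S))"
    using assms(2) collapse_Ord by (intro Ord_set_of small_image assms(1)) (auto simp: elts_collapse)
  ultimately show thesis
    using that[of "set_of (collapse S ` S)"] elts_set_of[OF small_image[OF assms(1)], of "collapse S"]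
    by simp
qed

section \<open>Kuratowski pairs\<close>

definition upair :: "'v::zfc \<Rightarrow> 'v \<Rightarrow> 'v"
  where "upair x y = set_of {x, y}"

definition kpair :: "'v::zfc \<Rightarrow> 'v \<Rightarrow> 'v"
  where "kpair x y = upair (upair x x) (upair x y)"

lemma elts_upair: "elts (upair x y) = {x, y}"
  unfolding upair_def by (rule elts_set_of[OF small_pair])

lemma upair_eq_iff: "upair a b = upair c d \<longleftrightarrow> {a, b} = {c, d}"
  by (simp add: elts_upair flip: elts_eq_iff)

lemma kpair_eq_iff: "kpair a b = kpair c d \<longleftrightarrow> a = c \<and> b = d"
  unfolding kpair_def upair_eq_iff doubleton_eq_iff by blast

section \<open>Universes\<close>

text \<open>
  A common name for the class of all sets and for the levels \<open>V\<^sub>\<kappa>\<close> with \<open>\<kappa>\<close>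
  inaccessible: classes that satisfy second-order ZFC. The last clause is infinity, because
  a nonempty set without \<open>\<in>\<close>-maximal elements is infinite.
\<close>

definition universe :: "'v::zfc set \<Rightarrow> bool"
  where "universe D \<longleftrightarrow>
    (\<forall>x\<in>D. elts x \<subseteq> D) \<and>
    (\<forall>x\<in>D. \<exists>p\<in>D. elts p = {y. elts y \<subseteq> elts x}) \<and>
    (\<forall>x\<in>D. \<exists>u\<in>D. elts u = \<Union>(elts ` elts x)) \<and>
    (\<forall>x\<in>D. \<forall>y\<in>D. upair x y \<in> D) \<and>
    (\<forall>x\<in>D. \<forall>f. f ` elts x \<subseteq> D \<longrightarrow> (\<exists>z\<in>D. elts z = f ` elts x)) \<and>
    (\<exists>z\<in>D. elts z \<noteq> {} \<and> (\<forall>x\<in>elts z. \<exists>y\<in>elts z. x \<in> elts y))"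

lemma universe_UNIV: "universe (UNIV :: 'v::zfc set)"
proof -
  obtain z :: 'v where "(\<exists>e \<in> elts z. elts e = {}) \<and>
      (\<forall>x \<in> elts z. \<exists>y \<in> elts z. elts y = insert x (elts x))"
    using infinity by blast
  then have "elts z \<noteq> {} \<and> (\<forall>x\<in>elts z. \<exists>y\<in>elts z. x \<in> elts y)"
    by (metis empty_iff insertI1)
  then show ?thesis
    unfolding universe_def by (simp add: powerset union replacement) blast
qed

text \<open>The measured set may have any type, so products, lists and sets of formulas can be
  bounded directly in HOL; only sets of elements of \<open>D\<close> are turned back into
  elements.\<close>

definition usmall :: "'v::zfc set \<Rightarrow> 'b set \<Rightarrow> bool"
  where "usmall D X \<longleftrightarrow> (\<exists>x\<in>D. X \<lesssim> elts x)"

context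
  fixes D :: "'v::zfc set"
  assumes D: "universe D"
begin

lemma universe_trans: "x \<in> D \<Longrightarrow> y \<in> elts x \<Longrightarrow> y \<in> D"
  using D[unfolded universe_def, THEN conjunct1] by blast

lemma universe_powerset: "x \<in> D \<Longrightarrow> \<exists>p\<in>D. elts p = {y. elts y \<subseteq> elts x}"
  using D[unfolded universe_def, THEN conjunct2, THEN conjunct1] by blast

lemma universe_subset_closed: "x \<in> D \<Longrightarrow> elts y \<subseteq> elts x \<Longrightarrow> y \<in> D"
  using universe_powerset[of x] universe_trans[of _ y] by blast

lemma universe_Union: "x \<in> D \<Longrightarrow> \<exists>u\<in>D. elts u = \<Union>(elts ` elts x)"
  using D[unfolded universe_def, THEN conjunct2, THEN conjunct2, THEN conjunct1] by blast

lemma universe_upair: "x \<in> D \<Longrightarrow> y \<in> D \<Longrightarrow> upair x y \<in> D"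
  using D[unfolded universe_def, THEN conjunct2, THEN conjunct2, THEN conjunct2, THEN conjunct1] by blast

lemma universe_kpair: "x \<in> D \<Longrightarrow> y \<in> D \<Longrightarrow> kpair x y \<in> D"
  unfolding kpair_def by (intro universe_upair)

lemma universe_image: "x \<in> D \<Longrightarrow> f ` elts x \<subseteq> D \<Longrightarrow> \<exists>z\<in>D. elts z = f ` elts x"
  using D[unfolded universe_def, THEN conjunct2, THEN conjunct2, THEN conjunct2, THEN conjunct2, THEN conjunct1] by blast

lemma universe_UN:
  assumes "x \<in> D" "\<And>y. y \<in> elts x \<Longrightarrow> \<exists>z\<in>D. elts z = X y"
  shows "\<exists>z\<in>D. elts z = (\<Union>y\<in>elts x. X y)"
proof -
  obtain f where f: "\<And>y. y \<in> elts x \<Longrightarrow> f y \<in> D \<and> elts (f y) = X y"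
    using assms(2) by metis
  then obtain z where z: "z \<in> D" "elts z = f ` elts x"
    using universe_image[OF assms(1), of f] by blast
  obtain u where "u \<in> D" "elts u = \<Union>(elts ` elts z)"
    using universe_Union[OF z(1)] by blast
  moreover have "\<Union>(elts ` elts z) = (\<Union>y\<in>elts x. X y)"
    using f z(2) by auto
  ultimately show ?thesis
    by auto
qed

lemma universe_Un:
  assumes "x \<in> D" "y \<in> D"
  shows "\<exists>z\<in>D. elts z = elts x \<union> elts y"
  using universe_Union[OF universe_upair[OF assms]] by (simp add: elts_upair)

text \<open>On a finite set the converse of \<in> is acyclic and therefore well-founded, which would
  give an \<in>-maximal element.\<close>

lemma universe_infinite: "\<exists>z\<in>D. infinite (elts z)"
proof -
  obtain z where z: "z \<in> D" "elts z \<noteq> {}" "\<And>x. x \<in> elts z \<Longrightarrow> \<exists>y\<in>elts z. x \<in> elts y"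
    using D[unfolded universe_def, THEN conjunct2, THEN conjunct2, THEN conjunct2, THEN conjunct2, THEN conjunct2] by blast
  have "infinite (elts z)"
  proof
    assume fin: "finite (elts z)"
    have "wf ({(x, y). x \<in> elts y}\<inverse> \<inter> elts z \<times> elts z)"
    proof (rule finite_acyclic_wf)
      show "finite ({(x, y). x \<in> elts y}\<inverse> \<inter> elts z \<times> elts z)"
        using fin by simp
      have "acyclic ({(x, y). x \<in> elts y}\<inverse>)"
        using wf_acyclic[OF foundation] by (simp add: acyclic_converse)
      then show "acyclic ({(x, y). x \<in> elts y}\<inverse> \<inter> elts z \<times> elts z)"
        by (rule acyclic_subset) blast
    qed
    then obtain m where "m \<in> elts z"
      "\<And>y. (y, m) \<in> {(x, y). x \<in> elts y}\<inverse> \<inter> elts z \<times> elts z \<Longrightarrow> y \<notin> elts z"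
      using wfE_min z(2) by (metis ex_in_conv)
    then show False
      using z(3) by blast
  qed
  then show ?thesis
    using z(1) by blast
qed

lemma universe_osucc:
  assumes "\<alpha> \<in> D"
  shows "osucc \<alpha> \<in> D"
proof -
  obtain z where "z \<in> D" "elts z = elts \<alpha> \<union> elts (upair \<alpha> \<alpha>)"
    using universe_Un[OF assms universe_upair[OF assms assms]] by blast
  moreover have "elts (osucc \<alpha>) = elts \<alpha> \<union> elts (upair \<alpha> \<alpha>)"
    by (auto simp: elts_upair elts_osucc)
  ultimately show ?thesis
    by (metis elts_eq_iff)
qed

subsection \<open>Sets of the size of an element of a universe\<close>

lemma usmall_lepoll: "usmall D Y \<Longrightarrow> X \<lesssim> Y \<Longrightarrow> usmall D X"
  unfolding usmall_def using lepoll_trans by blast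

lemma usmall_image: "usmall D X \<Longrightarrow> usmall D (f ` X)"
  using usmall_lepoll image_lepoll by blast

lemma usmall_elts: "x \<in> D \<Longrightarrow> usmall D (elts x)"
  unfolding usmall_def by blast

text \<open>A map from \<open>elts x\<close> covering \<open>X\<close> is first cut down to the
  subset \<open>y\<close> of arguments with values in \<open>X\<close>, so that replacement applies
  inside \<open>D\<close>.\<close>

lemma usmall_mem:
  assumes "usmall D X" "X \<subseteq> D"
  shows "\<exists>z\<in>D. elts z = X"
proof -
  obtain x g where x: "x \<in> D" "X \<subseteq> g ` elts x"
    using assms(1) unfolding usmall_def lepoll_iff by blast
  obtain y where y: "elts y = {u \<in> elts x. g u \<in> X}"
    using separation[of x "\<lambda>u. g u \<in> X"] by blast
  then have "y \<in> D"
    using universe_subset_closed[OF x(1)] by blast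
  moreover have "g ` elts y = X"
    using x(2) y by auto
  ultimately show ?thesis
    using universe_image[of y g] assms(2) by simp
qed

lemma usmall_countable:
  assumes "countable X"
  shows "usmall D X"
proof -
  obtain z where z: "z \<in> D" "infinite (elts z)"
    using universe_infinite by blast
  have "X \<lesssim> (UNIV :: nat set)"
    using assms unfolding countable_def lepoll_def by blast
  then have "X \<lesssim> elts z"
    using z(2) unfolding infinite_le_lepoll by (rule lepoll_trans)
  then show ?thesis
    using z(1) unfolding usmall_def by blast
qed

lemma usmall_Times:
  assumes "usmall D X" "usmall D Y"
  shows "usmall D (X \<times> Y)"
proof -
  obtain x y where xy: "x \<in> D" "X \<lesssim> elts x" "y \<in> D" "Y \<lesssim> elts y"
    using assms unfolding usmall_def by blast
  have "\<exists>z\<in>D. elts z = (\<Union>a\<in>elts x. kpair a ` elts y)"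
    using universe_kpair universe_trans xy
    by (intro universe_UN universe_image) auto
  then obtain z where z: "z \<in> D" "elts z = (\<Union>a\<in>elts x. kpair a ` elts y)"
    by blast
  have "inj_on (\<lambda>(a, b). kpair a b) (elts x \<times> elts y)"
    unfolding inj_on_def by (auto simp: kpair_eq_iff)
  moreover have "(\<lambda>(a, b). kpair a b) ` (elts x \<times> elts y) \<subseteq> elts z"
    using z(2) by auto
  ultimately have "elts x \<times> elts y \<lesssim> elts z"
    unfolding lepoll_def by blast
  then have "X \<times> Y \<lesssim> elts z"
    using times_lepoll_mono[OF xy(2,4)] lepoll_trans by blast
  then show ?thesis
    using z(1) unfolding usmall_def by blast
qed

text \<open>Regularity of \<open>D\<close>: the chosen bounds \<open>e i\<close> form an element of
  \<open>D\<close>, and its union \<open>u\<close> bounds all members at once, so the family is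
  covered by an image of \<open>I \<times> elts u\<close>.\<close>

lemma usmall_UN:
  assumes "usmall D I" "\<And>i. i \<in> I \<Longrightarrow> usmall D (X i)"
  shows "usmall D (\<Union>i\<in>I. X i)"
proof -
  obtain e where e: "\<And>i. i \<in> I \<Longrightarrow> e i \<in> D \<and> X i \<lesssim> elts (e i)"
    using assms(2) unfolding usmall_def by metis
  then obtain z where z: "z \<in> D" "elts z = e ` I"
    using usmall_mem[OF usmall_image[OF assms(1)], of e] by blast
  obtain u where u: "u \<in> D" "elts u = \<Union>(elts ` elts z)"
    using universe_Union[OF z(1)] by blast
  obtain g where g: "\<And>i. i \<in> I \<Longrightarrow> X i \<subseteq> g i ` elts (e i)"
    using e unfolding lepoll_iff by metis
  have "(\<Union>i\<in>I. X i) \<subseteq> (\<lambda>(i, y). g i y) ` (I \<times> elts u)"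
  proof
    fix x assume "x \<in> (\<Union>i\<in>I. X i)"
    then obtain i where i: "i \<in> I" "x \<in> X i"
      by blast
    then obtain y where "y \<in> elts (e i)" "x = g i y"
      using g by blast
    moreover have "elts (e i) \<subseteq> elts u"
      using i(1) u(2) z(2) by blast
    ultimately show "x \<in> (\<lambda>(i, y). g i y) ` (I \<times> elts u)"
      using i(1) by (intro image_eqI[of _ _ "(i, y)"]) auto
  qed
  then show ?thesis
    by (rule usmall_lepoll[OF usmall_Times[OF assms(1) usmall_elts[OF u(1)]] subset_image_lepoll])
qed

lemma usmall_Un:
  assumes "usmall D X" "usmall D Y"
  shows "usmall D (X \<union> Y)"
  using usmall_UN[OF usmall_countable, of UNIV "\<lambda>b. if b then X else Y"] assms
  by (simp add: UNIV_bool Un_commute)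

lemma usmall_lists:
  assumes "usmall D X"
  shows "usmall D (lists X)"
proof -
  have "usmall D {l \<in> lists X. length l = n}" for n
  proof (induction n)
    case 0
    have "{l \<in> lists X. length l = 0} = {[]}"
      by auto
    then show ?case
      using usmall_countable[of "{[]}"] by simp
  next
    case (Suc n)
    have "{l \<in> lists X. length l = Suc n} \<subseteq> (\<lambda>(x, l). x # l) ` (X \<times> {l \<in> lists X. length l = n})"
      by (auto simp: length_Suc_conv image_iff)
    then show ?case
      by (rule usmall_lepoll[OF usmall_Times[OF assms Suc] subset_image_lepoll])
  qed
  moreover have "lists X = (\<Union>n. {l \<in> lists X. length l = n})"
    by auto
  ultimately show ?thesis
    using usmall_UN[OF usmall_countable, of UNIV "\<lambda>n::nat. {l \<in> lists X. length l = n}"] by simp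
qed

text \<open>By \<in>-induction every element of \<open>N\<close> is a small set of elements of
  \<open>D\<close>. This is what places a collapsed hull inside
  \<open>Vset \<kappa>\<close>.\<close>

lemma transitive_usmall_subset:
  assumes "usmall D N" "\<And>x. x \<in> N \<Longrightarrow> elts x \<subseteq> N"
  shows "N \<subseteq> D"
proof
  fix x assume "x \<in> N"
  then show "x \<in> D"
  proof (induction x rule: mem_induct)
    case (step x)
    then have "elts x \<subseteq> N"
      using assms(2) by blast
    then have "usmall D (elts x)" "elts x \<subseteq> D"
      using usmall_lepoll[OF assms(1) subset_imp_lepoll] step.IH by blast+
    then obtain z where "z \<in> D" "elts z = elts x"
      using usmall_mem by blast
    then show ?case
      by (simp add: elts_eq_iff)
  qed
qed

end

section \<open>Inaccessible cardinals and universes\<close>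

lemma inaccessible_Ord: "inaccessible \<kappa> \<Longrightarrow> Ord \<kappa>"
  unfolding inaccessible_def regular_def Card_def by blast

lemma inaccessible_Card: "inaccessible \<kappa> \<Longrightarrow> Card \<kappa>"
  unfolding inaccessible_def regular_def by blast

context
  fixes \<kappa> :: "'v::zfc"
  assumes \<kappa>: "inaccessible \<kappa>"
begin

lemma inaccessible_regular:
  "\<beta> \<in> elts \<kappa> \<Longrightarrow> f ` elts \<beta> \<subseteq> elts \<kappa> \<Longrightarrow> \<exists>\<gamma>\<in>elts \<kappa>. f ` elts \<beta> \<subseteq> elts \<gamma>"
  using \<kappa> unfolding inaccessible_def regular_def by blast

text \<open>\<open>regular\<close> only speaks of functions on an ordinal below \<kappa>. The order
  type of \<open>S\<close> is such an ordinal, because \<open>S\<close> is smaller than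
  \<kappa>.\<close>

lemma inaccessible_bounded:
  assumes "S \<subseteq> elts \<kappa>" "S \<prec> elts \<kappa>"
  shows "\<exists>\<gamma>\<in>elts \<kappa>. S \<subseteq> elts \<gamma>"
proof -
  have "Ord \<beta>" if "\<beta> \<in> S" for \<beta>
    using Ord_mem[OF inaccessible_Ord[OF \<kappa>]] assms(1) that by blast
  then obtain \<mu> :: 'v where \<mu>: "Ord \<mu>" "S \<approx> elts \<mu>"
    using small_Ord_eqpoll[OF small_subset[OF small_elts assms(1)]] by blast
  have "\<not> elts \<kappa> \<lesssim> elts \<mu>"
    using assms(2) lepoll_trans2[OF _ eqpoll_sym[OF \<mu>(2)]] unfolding lesspoll_iff_not_lepoll by blast
  then have mem: "\<mu> \<in> elts \<kappa>"
    using Ord_not_le[OF inaccessible_Ord[OF \<kappa>] \<mu>(1)] subset_imp_lepoll by blast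
  obtain f where "bij_betw f (elts \<mu>) S"
    using eqpoll_sym[OF \<mu>(2)] unfolding eqpoll_def by blast
  then have "f ` elts \<mu> = S"
    by (simp add: bij_betw_def)
  then show ?thesis
    using inaccessible_regular[OF mem, of f] assms(1) by simp
qed

lemma inaccessible_lesspoll_bound:
  assumes "X \<prec> elts \<kappa>"
  shows "\<exists>\<mu>\<in>elts \<kappa>. X \<lesssim> elts \<mu>"
proof -
  obtain g where g: "inj_on g X" "g ` X \<subseteq> elts \<kappa>"
    using assms unfolding lesspoll_def lepoll_def by blast
  moreover have "g ` X \<prec> elts \<kappa>"
    using image_lepoll assms by (rule lesspoll_trans1)
  ultimately obtain \<mu> where "\<mu> \<in> elts \<kappa>" "g ` X \<subseteq> elts \<mu>"
    using inaccessible_bounded by blast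
  then show ?thesis
    using g(1) unfolding lepoll_def by blast
qed

lemma inaccessible_infinite: "infinite (elts \<kappa>)"
  using \<kappa> countable_finite unfolding inaccessible_def by blast

lemma inaccessible_limit:
  assumes "\<beta> \<in> elts \<kappa>"
  shows "\<exists>\<gamma>\<in>elts \<kappa>. \<beta> \<in> elts \<gamma>"
  using inaccessible_bounded[of "{\<beta>}"] assms finite_lesspoll_infinite[OF inaccessible_infinite, of "{\<beta>}"]
  by simp

text \<open>Each stage \<open>{x. elts x \<subseteq> Vset \<gamma>}\<close> is smaller than \<kappa>
  since \<kappa> is a strong limit. If their union covered \<kappa>, the images of the stages would
  have bounds \<open>h \<gamma>\<close> below \<kappa>, regularity would bound these by some \<nu>,
  and \<nu> would itself be a value, hence a member of some \<open>h \<gamma>\<close>, itself in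
  \<nu>.\<close>

lemma inaccessible_Vset_lesspoll: "\<beta> \<in> elts \<kappa> \<Longrightarrow> Vset \<beta> \<prec> elts \<kappa>"
proof (induction \<beta> rule: mem_induct)
  case (step \<beta>)
  note ord = inaccessible_Ord[OF \<kappa>]
  have P: "{x. elts x \<subseteq> Vset \<gamma>} \<prec> elts \<kappa>" if "\<gamma> \<in> elts \<beta>" for \<gamma>
  proof -
    have "Vset \<gamma> \<prec> elts \<kappa>"
      using step.IH[OF that] Ord_trans[OF ord that step.prems] .
    then obtain \<mu> where \<mu>: "\<mu> \<in> elts \<kappa>" "Vset \<gamma> \<lesssim> elts \<mu>"
      using inaccessible_lesspoll_bound by blast
    have "{x. elts x \<subseteq> Vset \<gamma>} \<lesssim> Pow (elts \<mu>)"
      using powerset_eqpoll[OF small_Vset] Pow_lepoll_mono[OF \<mu>(2)] by (rule lepoll_trans1)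
    moreover have "Pow (elts \<mu>) \<prec> elts \<kappa>"
      using \<kappa> \<mu>(1) unfolding inaccessible_def strong_limit_def by blast
    ultimately show ?thesis
      by (rule lesspoll_trans1)
  qed
  have "\<not> elts \<kappa> \<lesssim> Vset \<beta>"
  proof
    assume "elts \<kappa> \<lesssim> Vset \<beta>"
    then obtain f :: "'v \<Rightarrow> 'v" where f: "elts \<kappa> \<subseteq> f ` Vset \<beta>"
      unfolding lepoll_iff by blast
    \<comment> \<open>Values of \<open>f\<close> outside \<kappa> are replaced by an arbitrary
      element of \<kappa>, so that the images of all stages are sets of ordinals below
      \<kappa>.\<close>
    define g where "g x = (if f x \<in> elts \<kappa> then f x else SOME y. y \<in> elts \<kappa>)" for x
    have "\<exists>y. y \<in> elts \<kappa>"
      using step.prems by blast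
    then have gk: "g x \<in> elts \<kappa>" for x
      unfolding g_def by (metis someI_ex)
    have "\<exists>h\<in>elts \<kappa>. g ` {x. elts x \<subseteq> Vset \<gamma>} \<subseteq> elts h" if "\<gamma> \<in> elts \<beta>" for \<gamma>
      using lesspoll_trans1[OF image_lepoll P[OF that], of g] gk
      by (intro inaccessible_bounded) auto
    then obtain h where h: "\<And>\<gamma>. \<gamma> \<in> elts \<beta> \<Longrightarrow> h \<gamma> \<in> elts \<kappa> \<and> g ` {x. elts x \<subseteq> Vset \<gamma>} \<subseteq> elts (h \<gamma>)"
      by metis
    then obtain \<nu> where \<nu>: "\<nu> \<in> elts \<kappa>" "h ` elts \<beta> \<subseteq> elts \<nu>"
      using inaccessible_regular[OF step.prems, of h] by blast
    obtain x where x: "x \<in> Vset \<beta>" "f x = \<nu>"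
      using f \<nu>(1) by blast
    then have "g x = \<nu>"
      using \<nu>(1) by (simp add: g_def)
    obtain \<gamma> where \<gamma>: "\<gamma> \<in> elts \<beta>" "elts x \<subseteq> Vset \<gamma>"
      using x(1) unfolding mem_Vset_iff[of x] by blast
    have "g x \<in> elts (h \<gamma>)"
      using h[OF \<gamma>(1)] \<gamma>(2) by blast
    then have "\<nu> \<in> elts (h \<gamma>)" "h \<gamma> \<in> elts \<nu>"
      using \<nu>(2) \<gamma>(1) \<open>g x = \<nu>\<close> by auto
    then show False
      using mem_not_sym by blast
  qed
  then show ?case
    by (simp add: lesspoll_iff_not_lepoll)
qed

lemma inaccessible_universe: "universe (Vset \<kappa>)"
  unfolding universe_def
proof (intro conjI ballI allI impI)
  note ord = inaccessible_Ord[OF \<kappa>]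
  have sub: "\<exists>z\<in>Vset \<kappa>. elts z = X" if "X \<subseteq> Vset \<beta>" "\<beta> \<in> elts \<kappa>" for X \<beta>
    using elts_set_of[OF small_subset[OF small_Vset that(1)]] that
    by (intro bexI[of _ "set_of X"]) (auto simp: mem_Vset_iff)
  \<comment> \<open>Fewer than \<kappa> many elements have bounded ranks; pairing and replacement
    both rest on this.\<close>
  have bd: "\<exists>\<gamma>\<in>elts \<kappa>. X \<subseteq> Vset \<gamma>" if X: "X \<subseteq> Vset \<kappa>" "X \<prec> elts \<kappa>" for X
  proof -
    obtain b where b: "\<And>x. x \<in> X \<Longrightarrow> b x \<in> elts \<kappa> \<and> elts x \<subseteq> Vset (b x)"
      using X(1) unfolding subset_iff[of X] mem_Vset_iff by metis
    moreover have "b ` X \<prec> elts \<kappa>"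
      using image_lepoll X(2) by (rule lesspoll_trans1)
    ultimately obtain \<gamma> where "\<gamma> \<in> elts \<kappa>" "b ` X \<subseteq> elts \<gamma>"
      using inaccessible_bounded[of "b ` X"] by blast
    moreover from this have "X \<subseteq> Vset \<gamma>"
      using b unfolding subset_iff[of X] mem_Vset_iff by blast
    ultimately show ?thesis
      by blast
  qed
  fix x assume x: "x \<in> Vset \<kappa>"
  show "elts x \<subseteq> Vset \<kappa>"
    using Vset_trans[OF ord x] by blast
  obtain \<beta> where \<beta>: "\<beta> \<in> elts \<kappa>" "elts x \<subseteq> Vset \<beta>"
    using x unfolding mem_Vset_iff[of x] by blast
  obtain \<gamma> where \<gamma>: "\<gamma> \<in> elts \<kappa>" "\<beta> \<in> elts \<gamma>"
    using inaccessible_limit[OF \<beta>(1)] by blast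
  have "{y. elts y \<subseteq> elts x} \<subseteq> Vset \<gamma>"
    using \<gamma>(2) \<beta>(2) unfolding subset_iff[of "{y. elts y \<subseteq> elts x}"] mem_Vset_iff by blast
  then show "\<exists>p\<in>Vset \<kappa>. elts p = {y. elts y \<subseteq> elts x}"
    using sub \<gamma>(1) by blast
  have "\<Union>(elts ` elts x) \<subseteq> Vset \<beta>"
    using Vset_trans[OF Ord_mem[OF ord \<beta>(1)]] \<beta>(2) by blast
  then show "\<exists>u\<in>Vset \<kappa>. elts u = \<Union>(elts ` elts x)"
    using sub \<beta>(1) by blast
  show "upair x y \<in> Vset \<kappa>" if y: "y \<in> Vset \<kappa>" for y
  proof -
    have "{x, y} \<prec> elts \<kappa>"
      by (simp add: finite_lesspoll_infinite[OF inaccessible_infinite])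
    then obtain \<gamma> where "\<gamma> \<in> elts \<kappa>" "{x, y} \<subseteq> Vset \<gamma>"
      using bd[of "{x, y}"] x y by blast
    then show ?thesis
      unfolding mem_Vset_iff elts_upair by blast
  qed
  fix f assume f: "f ` elts x \<subseteq> Vset \<kappa>"
  have "elts x \<lesssim> Vset \<beta>"
    by (rule subset_imp_lepoll[OF \<beta>(2)])
  then have "f ` elts x \<lesssim> Vset \<beta>"
    using image_lepoll lepoll_trans by blast
  then have "f ` elts x \<prec> elts \<kappa>"
    using inaccessible_Vset_lesspoll[OF \<beta>(1)] by (rule lesspoll_trans1)
  then show "\<exists>z\<in>Vset \<kappa>. elts z = f ` elts x"
    using bd[OF f] sub by blast
next
  note ord = inaccessible_Ord[OF \<kappa>]
  have "elts \<kappa> \<noteq> {}"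
    using inaccessible_infinite by auto
  then obtain \<beta> where \<beta>: "\<beta> \<in> elts \<kappa>"
    by blast
  obtain s where s: "\<And>\<beta>. \<beta> \<in> elts \<kappa> \<Longrightarrow> s \<beta> \<in> elts \<kappa> \<and> \<beta> \<in> elts (s \<beta>)"
    using inaccessible_limit by metis
  \<comment> \<open>An increasing sequence of length omega: its range is bounded because \<kappa> is
    uncountable and regular, and it is the set without \<in>-maximal element that the last clause of
    \<open>universe\<close> asks for.\<close>
  define h where "h n = (s ^^ n) \<beta>" for n
  have h: "h n \<in> elts \<kappa>" "h n \<in> elts (h (Suc n))" for n
    by (induction n) (auto simp: h_def s \<beta>)
  have "range h \<prec> elts \<kappa>"
    using countable_lepoll[of "range h" "elts \<kappa>"] \<kappa>
    unfolding lesspoll_iff_not_lepoll inaccessible_def by blast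
  then obtain \<gamma> where \<gamma>: "\<gamma> \<in> elts \<kappa>" "range h \<subseteq> elts \<gamma>"
    using inaccessible_bounded[of "range h"] h(1) by blast
  have z: "elts (set_of (range h)) = range h"
    by (rule elts_set_of[OF small_subset[OF small_elts \<gamma>(2)]])
  then have "elts (set_of (range h)) \<subseteq> Vset \<gamma>"
    using Ord_subset_Vset[OF Ord_mem[OF ord \<gamma>(1)]] \<gamma>(2) by simp
  then have "set_of (range h) \<in> Vset \<kappa>"
    using \<gamma>(1) unfolding mem_Vset_iff by blast
  then show "\<exists>z\<in>Vset \<kappa>. elts z \<noteq> {} \<and> (\<forall>x\<in>elts z. \<exists>y\<in>elts z. x \<in> elts y)"
    using h(2) z by (intro bexI[of _ "set_of (range h)"]) auto
qed

end

text \<open>Zermelo's characterization of the models of second-order ZFC. The cardinal is the height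
  of \<open>D\<close>, the set of its ordinals; \<open>D\<close> then computes both the levels
  \<open>Vset \<beta>\<close> and the ranks of its elements correctly.\<close>

lemma universe_eq_Vset:
  fixes D :: "'v::zfc set"
  assumes D: "universe D" and "small D"
  obtains \<kappa> where "inaccessible \<kappa>" "D = Vset \<kappa>"
proof -
  define \<kappa> where "\<kappa> = set_of {\<alpha> \<in> D. Ord \<alpha>}"
  have sm: "small {\<alpha> \<in> D. Ord \<alpha>}"
    by (rule small_subset[OF assms(2)]) blast
  then have elts\<kappa>: "elts \<kappa> = {\<alpha> \<in> D. Ord \<alpha>}"
    unfolding \<kappa>_def by (rule elts_set_of)
  have ord: "Ord \<kappa>"
    unfolding \<kappa>_def using universe_trans[OF D] Ord_mem by (intro Ord_set_of[OF sm]) blast+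
  then have notin: "\<kappa> \<notin> D"
    using elts\<kappa> mem_not_refl[of \<kappa>] by blast
  \<comment> \<open>If a small set were at least as large as the height, replacement would put
    \<kappa> into \<open>D\<close>, hence into itself. Being a cardinal, uncountability and the
    strong limit property all follow from this.\<close>
  have not_lepoll: "\<not> elts \<kappa> \<lesssim> X" if "usmall D X" for X :: "'b set"
  proof
    assume "elts \<kappa> \<lesssim> X"
    then have "usmall D (elts \<kappa>)"
      by (rule usmall_lepoll[OF D that])
    then obtain z where "z \<in> D" "elts z = elts \<kappa>"
      using usmall_mem[OF D, of "elts \<kappa>"] elts\<kappa> by blast
    then show False
      using notin by (simp add: elts_eq_iff)
  qed
  have "Card \<kappa>"
    unfolding Card_def using ord not_lepoll usmall_elts[OF D] eqpoll_sym eqpoll_imp_lepoll elts\<kappa> by blast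
  moreover have unc: "uncountable (elts \<kappa>)"
    using not_lepoll[OF usmall_countable[OF D], of "elts \<kappa>"] by blast
  moreover have "\<exists>\<gamma>\<in>elts \<kappa>. f ` elts \<beta> \<subseteq> elts \<gamma>" if \<beta>: "\<beta> \<in> elts \<kappa>" "f ` elts \<beta> \<subseteq> elts \<kappa>" for \<beta> f
  proof -
    obtain z where z: "z \<in> D" "elts z = f ` elts \<beta>"
      using universe_image[OF D, of \<beta> f] \<beta> elts\<kappa> by blast
    obtain u where u: "u \<in> D" "elts u = \<Union>(elts ` elts z)"
      using universe_Union[OF D z(1)] by blast
    have ordz: "Ord \<gamma>" if "\<gamma> \<in> elts z" for \<gamma>
      using that z(2) \<beta>(2) elts\<kappa> by blast
    then have "Ord u"
      by (rule Ord_Union[OF u(2)])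
    then have "osucc u \<in> elts \<kappa>"
      using universe_osucc[OF D u(1)] Ord_osucc elts\<kappa> by blast
    moreover have "f ` elts \<beta> \<subseteq> elts (osucc u)"
    proof
      fix \<gamma> assume "\<gamma> \<in> f ` elts \<beta>"
      then have "\<gamma> \<in> elts z"
        using z(2) by simp
      then have "\<gamma> \<preceq> u" "Ord \<gamma>"
        using u(2) ordz by auto
      then show "\<gamma> \<in> elts (osucc u)"
        using Ord_le_iff[of \<gamma> u] \<open>Ord u\<close> by (auto simp: elts_osucc)
    qed
    ultimately show ?thesis
      by blast
  qed
  moreover have "Pow (elts \<beta>) \<prec> elts \<kappa>" if "\<beta> \<in> elts \<kappa>" for \<beta>
  proof -
    obtain p where p: "p \<in> D" "elts p = {y. elts y \<subseteq> elts \<beta>}"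
      using universe_powerset[OF D, of \<beta>] \<open>\<beta> \<in> elts \<kappa>\<close> elts\<kappa> by blast
    then have "Pow (elts \<beta>) \<lesssim> elts p"
      using powerset_eqpoll[OF small_elts, of \<beta>] eqpoll_sym eqpoll_imp_lepoll by metis
    then show ?thesis
      using not_lepoll usmall_lepoll[OF D usmall_elts[OF D p(1)]] unfolding lesspoll_iff_not_lepoll
      by blast
  qed
  ultimately have inacc: "inaccessible \<kappa>"
    unfolding inaccessible_def regular_def strong_limit_def using countable_finite[of "elts \<kappa>"] by auto
  have V: "\<exists>z\<in>D. elts z = Vset \<beta>" if "\<beta> \<in> D" for \<beta>
    using that
  proof (induction \<beta> rule: mem_induct)
    case (step \<beta>)
    have "\<exists>z\<in>D. elts z = {x. elts x \<subseteq> Vset \<gamma>}" if "\<gamma> \<in> elts \<beta>" for \<gamma>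
      using universe_powerset[OF D] step.IH[OF that universe_trans[OF D step.prems that]] by metis
    then show ?case
      using universe_UN[OF D step.prems, of "\<lambda>\<gamma>. {x. elts x \<subseteq> Vset \<gamma>}"] by (simp add: Vset.simps[of \<beta>])
  qed
  have "x \<in> D" if x: "x \<in> Vset \<kappa>" for x
  proof -
    obtain \<beta> where "\<beta> \<in> D" "elts x \<subseteq> Vset \<beta>"
      using x elts\<kappa> unfolding mem_Vset_iff by blast
    then show ?thesis
      using V universe_subset_closed[OF D] by blast
  qed
  moreover have "x \<in> Vset \<kappa>" if x: "x \<in> D" for x
    using x
  proof (induction x rule: mem_induct)
    case (step x)
    then have "\<exists>\<beta>\<in>elts \<kappa>. elts y \<subseteq> Vset \<beta>" if "y \<in> elts x" for y
      using that universe_trans[OF D] unfolding mem_Vset_iff by blast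
    then obtain b where b: "\<And>y. y \<in> elts x \<Longrightarrow> b y \<in> elts \<kappa> \<and> elts y \<subseteq> Vset (b y)"
      by metis
    then obtain z where z: "z \<in> D" "elts z = b ` elts x"
      using universe_image[OF D step.prems, of b] elts\<kappa> by blast
    \<comment> \<open>The successors make every \<open>b y\<close> a member of \<open>u\<close> and
      not merely a subset, as \<open>mem_Vset_iff\<close> needs a strictly smaller stage.\<close>
    obtain u where u: "u \<in> D" "elts u = (\<Union>\<gamma>\<in>elts z. elts (osucc \<gamma>))"
      using universe_UN[OF D z(1), of "\<lambda>\<gamma>. elts (osucc \<gamma>)"] universe_osucc[OF D] universe_trans[OF D z(1)]
      by blast
    have "Ord \<gamma>" if "\<gamma> \<in> osucc ` elts z" for \<gamma>
      using that z(2) b elts\<kappa> by (auto simp: Ord_osucc)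
    then have "Ord u"
      by (intro Ord_Union[of u "osucc ` elts z"]) (simp_all add: u(2))
    then have "u \<in> elts \<kappa>"
      using u(1) elts\<kappa> by blast
    moreover have "elts x \<subseteq> Vset u"
    proof
      fix y assume "y \<in> elts x"
      then have "b y \<in> elts u" "elts y \<subseteq> Vset (b y)"
        using b u(2) z(2) by (auto simp: elts_osucc)
      then show "y \<in> Vset u"
        unfolding mem_Vset_iff by blast
    qed
    ultimately show ?case
      unfolding mem_Vset_iff by blast
  qed
  ultimately show thesis
    using that inacc by blast
qed

lemma inaccessible_iff_universe:
  "(\<exists>\<kappa>. inaccessible \<kappa> \<and> elts v = Vset \<kappa>) \<longleftrightarrow> universe (elts v)"
  using universe_eq_Vset[OF _ small_elts] inaccessible_universe by metis

lemma Vset_is_ord_sup: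
  assumes "is_ord_sup S \<theta>" "\<And>\<kappa>. \<kappa> \<in> S \<Longrightarrow> Ord \<kappa>"
  shows "Vset \<theta> = (\<Union>\<kappa>\<in>S. Vset \<kappa>)"
proof (intro equalityI subsetI)
  fix x assume "x \<in> Vset \<theta>"
  then obtain \<beta> where \<beta>: "\<beta> \<in> elts \<theta>" "elts x \<subseteq> Vset \<beta>"
    unfolding mem_Vset_iff[of x] by blast
  obtain \<kappa> where "\<kappa> \<in> S" "\<beta> \<in> elts \<kappa>"
    using is_ord_sup_memD[OF assms(1) \<beta>(1) assms(2)] by blast
  then show "x \<in> (\<Union>\<kappa>\<in>S. Vset \<kappa>)"
    using \<beta>(2) mem_Vset_iff[of x] by blast
next
  fix x assume "x \<in> (\<Union>\<kappa>\<in>S. Vset \<kappa>)"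
  then obtain \<kappa> where "\<kappa> \<in> S" "x \<in> Vset \<kappa>"
    by blast
  moreover have "\<kappa> \<preceq> \<theta>"
    using assms(1) \<open>\<kappa> \<in> S\<close> unfolding is_ord_sup_def by blast
  ultimately show "x \<in> Vset \<theta>"
    using Vset_mono by blast
qed

section \<open>Absoluteness in the Levy hierarchy\<close>

lemma Sigma_Pi_0: "(Sigma_fm n \<phi> \<longrightarrow> n = 0 \<longrightarrow> Delta0 \<phi>) \<and> (Pi_fm n \<phi> \<longrightarrow> n = 0 \<longrightarrow> Delta0 \<phi>)"
proof -
  have "Sigma_fm n \<phi> \<Longrightarrow> n = 0 \<Longrightarrow> Delta0 \<phi>" "Pi_fm n \<phi> \<Longrightarrow> n = 0 \<Longrightarrow> Delta0 \<phi>" for n \<phi>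
    by (auto elim: Sigma_fm.cases Pi_fm.cases)
  then show ?thesis
    by blast
qed

text \<open>At level one the rules can only put a block of universal quantifiers before a Delta0
  formula; the mutual induction is specialized to this case.\<close>

lemma Pi1_induct [consumes 1, case_names Delta0 Forall]:
  assumes "Pi_fm (Suc 0) \<phi>" and D: "\<And>\<phi>. Delta0 \<phi> \<Longrightarrow> P \<phi>" and F: "\<And>\<phi> i. P \<phi> \<Longrightarrow> P (Forall i \<phi>)"
  shows "P \<phi>"
proof -
  have "Sigma_fm m \<phi> \<Longrightarrow> True" "Pi_fm n \<phi> \<Longrightarrow> n = Suc 0 \<longrightarrow> P \<phi>" for m n \<phi>
    using Sigma_Pi_0 by (induction rule: Sigma_fm_Pi_fm.inducts) (auto intro: D F)
  then show ?thesis
    using assms(1) by blast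
qed

lemma Sigma2_induct [consumes 1, case_names Pi1 Exists]:
  assumes "Sigma_fm 2 \<phi>" and D: "\<And>\<phi>. Pi_fm (Suc 0) \<phi> \<Longrightarrow> P \<phi>" and F: "\<And>\<phi> i. P \<phi> \<Longrightarrow> P (Exists i \<phi>)"
  shows "P \<phi>"
proof -
  have "Sigma_fm m \<phi> \<Longrightarrow> m = Suc (Suc 0) \<longrightarrow> P \<phi>" "Pi_fm n \<phi> \<Longrightarrow> True" for m n \<phi>
    by (induction rule: Sigma_fm_Pi_fm.inducts) (auto intro: D F)
  then show ?thesis
    using assms(1) by (metis numeral_2_eq_2)
qed

lemma finite_fv: "finite (fv \<phi>)"
  by (induction \<phi>) auto

lemma Delta0_absolute:
  assumes "Delta0 \<phi>" "D \<subseteq> E" "\<And>x. x \<in> D \<Longrightarrow> elts x \<subseteq> D" "\<forall>i\<in>fv \<phi>. s i \<in> D"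
  shows "sat D s \<phi> \<longleftrightarrow> sat E s \<phi>"
  using assms(1,4)
proof (induction arbitrary: s)
  case (5 \<phi> i j)
  have "sat D (s(i := x)) \<phi> \<longleftrightarrow> sat E (s(i := x)) \<phi>" if "x \<in> elts (s j)" for x
    using that assms(3)[of "s j"] "5.prems" "5.hyps" by (intro "5.IH") auto
  moreover have "elts (s j) \<subseteq> D" "elts (s j) \<subseteq> E"
    using assms(2) assms(3)[of "s j"] "5.prems" "5.hyps" by auto
  ultimately show ?case
    using "5.hyps" by auto
qed auto

lemma Pi1_downward:
  assumes "Pi_fm (Suc 0) \<phi>" "D \<subseteq> E" "\<And>x. x \<in> D \<Longrightarrow> elts x \<subseteq> D"
    "\<forall>i\<in>fv \<phi>. s i \<in> D" "sat E s \<phi>"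
  shows "sat D s \<phi>"
  using assms(1,4,5)
proof (induction arbitrary: s rule: Pi1_induct)
  case (Delta0 \<phi>)
  then show ?case
    using Delta0_absolute[OF _ assms(2,3)] by blast
next
  case (Forall \<phi> i)
  have "sat D (s(i := x)) \<phi>" if "x \<in> D" for x
  proof (rule Forall.IH)
    show "\<forall>j\<in>fv \<phi>. (s(i := x)) j \<in> D"
      using that Forall.prems(1) by simp
    show "sat E (s(i := x)) \<phi>"
      using that Forall.prems(2) assms(2) by auto
  qed
  then show ?case
    by simp
qed

text \<open>The transfer of Pi_1 formulas is a hypothesis because it comes from different sources:
  from one inaccessible level to the supremum, and from the supremum to the class of all
  sets.\<close>

lemma Sigma2_upward:
  assumes "Sigma_fm 2 \<phi>" "D \<subseteq> E" "\<forall>i\<in>fv \<phi>. s i \<in> D" "sat D s \<phi>"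
    and Pi1: "\<And>\<phi> s. Pi_fm (Suc 0) \<phi> \<Longrightarrow> \<forall>i\<in>fv \<phi>. s i \<in> D \<Longrightarrow> sat D s \<phi> \<Longrightarrow> sat E s \<phi>"
  shows "sat E s \<phi>"
  using assms(1,3,4)
proof (induction arbitrary: s rule: Sigma2_induct)
  case (Pi1 \<phi>)
  then show ?case
    using assms(5) by blast
next
  case (Exists \<phi> i)
  then obtain x where x: "x \<in> D" "sat D (s(i := x)) \<phi>"
    by auto
  have "\<forall>j\<in>fv \<phi>. (s(i := x)) j \<in> D"
    using x(1) Exists.prems(1) by simp
  then have "sat E (s(i := x)) \<phi>"
    using x(2) by (rule Exists.IH)
  then show ?case
    using x(1) assms(2) by auto
qed

section \<open>Elementary substructures of the universe\<close>

instance fm :: countable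
  by countable_datatype

text \<open>Parameters come as a list whose \<open>nth\<close> serves as the assignment, so the
  values over a set \<open>X\<close> are indexed by formulas, variables and lists over
  \<open>X\<close>. Truth refers to the class of all sets.\<close>

definition skolem :: "fm \<Rightarrow> nat \<Rightarrow> 'v::zfc list \<Rightarrow> 'v"
  where "skolem \<phi> i l = (SOME x. sat UNIV ((nth l)(i := x)) \<phi>)"

definition skolem_step :: "'v::zfc set \<Rightarrow> 'v set"
  where "skolem_step X = (\<lambda>(\<phi>, i, l). skolem \<phi> i l) ` (UNIV \<times> UNIV \<times> lists X)"

lemma usmall_skolem_step: "universe D \<Longrightarrow> usmall D X \<Longrightarrow> usmall D (skolem_step X)"
  unfolding skolem_step_def
  by (rule usmall_image, assumption, intro usmall_Times usmall_lists)
    (simp_all add: usmall_countable)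

text \<open>The Tarski-Vaught test: the finitely many parameters of a formula occur at one stage,
  and the next stage contains the Skolem witness. The chain form covers both Skolem hulls and unions
  of levels.\<close>

lemma elementary_chain:
  fixes A :: "nat \<Rightarrow> 'v::zfc set"
  assumes mono: "\<And>n. A n \<subseteq> A (Suc n)" and ne: "A 0 \<noteq> {}"
    and sk: "\<And>n. skolem_step (A n) \<subseteq> A (Suc n)"
    and "\<forall>i\<in>fv \<phi>. s i \<in> (\<Union>n. A n)"
  shows "sat (\<Union>n. A n) s \<phi> \<longleftrightarrow> sat UNIV s \<phi>"
  using assms(4)
proof (induction \<phi> arbitrary: s)
  case (Neg \<phi>)
  then show ?case
    by simp
next
  case (Conj \<phi> \<psi>)
  then show ?case
    by simp
next
  case (Exists i \<phi>)
  let ?M = "\<Union>n. A n" and ?F = "fv (Exists i \<phi>)"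
  have IH: "sat ?M (s(i := x)) \<phi> \<longleftrightarrow> sat UNIV (s(i := x)) \<phi>" if "x \<in> ?M" for x
    using that Exists.prems by (intro Exists.IH) auto
  have "\<exists>y\<in>?M. sat UNIV (s(i := y)) \<phi>" if x: "sat UNIV (s(i := x)) \<phi>" for x
  proof -
    have le: "m \<le> n \<Longrightarrow> A m \<subseteq> A n" for m n
      using mono by (rule lift_Suc_mono_le)
    have "\<exists>n. \<forall>j\<in>?F. s j \<in> A n"
    proof -
      have "\<forall>j\<in>?F. \<exists>m. s j \<in> A m"
        using Exists.prems by simp
      then obtain m where m: "\<And>j. j \<in> ?F \<Longrightarrow> s j \<in> A (m j)"
        unfolding bchoice_iff by blast
      have "s j \<in> A (Max (m ` ?F))" if "j \<in> ?F" for j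
        using m[OF that] le[of "m j" "Max (m ` ?F)"] that finite_fv[of "Exists i \<phi>"] by auto
      then show ?thesis
        by blast
    qed
    then obtain n where n: "\<And>j. j \<in> ?F \<Longrightarrow> s j \<in> A n"
      by blast
    obtain a where a: "a \<in> A n"
      using ne le[of 0 n] by blast
    \<comment> \<open>The list reaches the largest free variable; the other positions are filled
      with an element \<open>a\<close> of the stage, so that \<open>l\<close> is a list over
      \<open>A n\<close>.\<close>
    define l where "l = map (\<lambda>j. if j \<in> ?F then s j else a) [0..<Suc (Max ?F)]"
    have l: "l \<in> lists (A n)"
      using n a by (auto simp: l_def)
    have "l ! j = s j" if "j \<in> ?F" for j
    proof -
      have "j < Suc (Max ?F)"
        using Max_ge[OF finite_fv[of "Exists i \<phi>"] that] by simp
      then show ?thesis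
        unfolding l_def using that by (subst nth_map) (simp_all del: upt_Suc)
    qed
    then have eq: "sat UNIV ((nth l)(i := y)) \<phi> \<longleftrightarrow> sat UNIV (s(i := y)) \<phi>" for y
      by (intro sat_cong) auto
    have "sat UNIV ((nth l)(i := x)) \<phi>"
      using x eq by simp
    then have "sat UNIV ((nth l)(i := skolem \<phi> i l)) \<phi>"
      unfolding skolem_def by (rule someI)
    then have "sat UNIV (s(i := skolem \<phi> i l)) \<phi>"
      using eq by simp
    moreover have "skolem \<phi> i l \<in> skolem_step (A n)"
      unfolding skolem_step_def using l by (intro image_eqI[of _ _ "(\<phi>, i, l)"]) simp_all
    then have "skolem \<phi> i l \<in> ?M"
      using sk[of n] by blast
    ultimately show ?thesis
      by blast
  qed
  then show ?case
    using IH by auto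
qed auto

lemma sat_isomorphic:
  assumes "inj_on \<pi> M" "\<And>x y. x \<in> M \<Longrightarrow> y \<in> M \<Longrightarrow> \<pi> x \<in> elts (\<pi> y) \<longleftrightarrow> x \<in> elts y"
    "\<forall>i\<in>fv \<phi>. s i \<in> M"
  shows "sat (\<pi> ` M) (\<pi> \<circ> s) \<phi> \<longleftrightarrow> sat M s \<phi>"
  using assms(3)
proof (induction \<phi> arbitrary: s)
  case (Eq i j)
  then show ?case
    using assms(1) by (auto simp: inj_on_def)
next
  case (Exists i \<phi>)
  have "sat (\<pi> ` M) ((\<pi> \<circ> s)(i := \<pi> x)) \<phi> \<longleftrightarrow> sat M (s(i := x)) \<phi>" if "x \<in> M" for x
  proof -
    have "\<forall>j\<in>fv \<phi>. (s(i := x)) j \<in> M"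
      using Exists.prems that by simp
    moreover have "\<pi> \<circ> s(i := x) = (\<pi> \<circ> s)(i := \<pi> x)"
      by auto
    ultimately show ?thesis
      using Exists.IH[of "s(i := x)"] by metis
  qed
  then show ?case
    by (simp add: comp_def)
qed (auto simp: assms(2))

text \<open>
  The collapse of a Skolem hull of some \<open>V\<^sub>\<beta>\<close> with \<open>\<beta> < \<kappa>\<close> is a transitive
  subset of \<open>V\<^sub>\<kappa>\<close> that contains the given parameters, so it carries failures of
  \<open>\<Pi>\<^sub>1\<close> statements from the whole universe down to \<open>V\<^sub>\<kappa>\<close>.
\<close>

theorem inaccessible_Pi1_upward:
  fixes \<kappa> :: "'v::zfc"
  assumes \<kappa>: "inaccessible \<kappa>" and "Pi_fm (Suc 0) \<phi>"
    and s: "\<forall>i\<in>fv \<phi>. s i \<in> Vset \<kappa>" and sat: "sat (Vset \<kappa>) s \<phi>"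
  shows "sat UNIV s \<phi>"
proof -
  have U: "universe (Vset \<kappa>)"
    by (rule inaccessible_universe[OF \<kappa>])
  \<comment> \<open>Including \<open>e\<close> ensures that \<open>Vset \<beta>\<close> below is
    nonempty, as \<open>elementary_chain\<close> demands of its first stage, even when \<phi> has no
    free variables.\<close>
  obtain e where e: "e \<in> Vset \<kappa>"
    using universe_infinite[OF U] by blast
  have "usmall (Vset \<kappa>) (insert e (s ` fv \<phi>))"
    using finite_fv[of \<phi>] by (intro usmall_countable[OF U] countable_finite) simp
  then obtain z where "z \<in> Vset \<kappa>" "elts z = insert e (s ` fv \<phi>)"
    using usmall_mem[OF U, of "insert e (s ` fv \<phi>)"] e s by blast
  then obtain \<beta> where \<beta>: "\<beta> \<in> elts \<kappa>" "insert e (s ` fv \<phi>) \<subseteq> Vset \<beta>"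
    unfolding mem_Vset_iff[of z] by metis
  \<comment> \<open>The hull starts from a whole level around the parameters: it is transitive, so
    the collapse fixes it pointwise.\<close>
  define A where "A = rec_nat (Vset \<beta>) (\<lambda>_ X. X \<union> skolem_step X)"
  have A0: "A 0 = Vset \<beta>" and AS: "A (Suc n) = A n \<union> skolem_step (A n)" for n
    by (simp_all add: A_def)
  define M where "M = (\<Union>n. A n)"
  have elem: "sat M t \<psi> \<longleftrightarrow> sat UNIV t \<psi>" if "\<forall>i\<in>fv \<psi>. t i \<in> M" for t \<psi>
    unfolding M_def using that \<beta>(2) by (intro elementary_chain) (auto simp: A0 AS M_def)
  have VM: "Vset \<beta> \<subseteq> M"
    unfolding M_def using A0 by blast
  have "usmall (Vset \<kappa>) (A n)" for n
  proof (induction n)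
    case 0
    have "set_of (Vset \<beta>) \<in> Vset \<kappa>"
      using Vset_mem_Vset_iff inaccessible_Ord[OF \<kappa>] Ord_mem \<beta>(1) by blast
    then show ?case
      using usmall_elts[OF U] elts_set_of_Vset A0 by metis
  next
    case (Suc n)
    then show ?case
      unfolding AS by (intro usmall_Un[OF U] usmall_skolem_step[OF U])
  qed
  then have "usmall (Vset \<kappa>) M"
    unfolding M_def by (intro usmall_UN[OF U usmall_countable[OF U]]) auto
  then have "usmall (Vset \<kappa>) (collapse M ` M)"
    by (rule usmall_image[OF U])
  moreover have trans: "elts x \<subseteq> collapse M ` M" if "x \<in> collapse M ` M" for x
    using that by (auto simp: elts_collapse)
  ultimately have sub: "collapse M ` M \<subseteq> Vset \<kappa>"
    by (rule transitive_usmall_subset[OF U])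
  have "x = y" if "x \<in> M" "y \<in> M" "elts x \<inter> M = elts y \<inter> M" for x y
  proof -
    have le: "elts u \<subseteq> elts w" if uw: "u \<in> M" "w \<in> M" "elts u \<inter> M \<subseteq> elts w" for u w
    proof (rule ccontr)
      \<comment> \<open>A failure of inclusion between members of \<open>M\<close> is a first-order
        fact about them, so elementarity supplies a witness inside \<open>M\<close>; hence
        \<open>M\<close> is extensional.\<close>
      let ?\<psi> = "Exists 2 (Conj (Mem 2 0) (Neg (Mem 2 1)))"
      assume "\<not> elts u \<subseteq> elts w"
      then have "sat UNIV ((\<lambda>_. w)(0 := u)) ?\<psi>"
        by auto
      moreover have "\<forall>i\<in>fv ?\<psi>. ((\<lambda>_. w)(0 := u)) i \<in> M"
        using uw by auto
      ultimately have "sat M ((\<lambda>_. w)(0 := u)) ?\<psi>"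
        using elem by blast
      then show False
        using uw(3) by auto
    qed
    have "elts x \<subseteq> elts y" "elts y \<subseteq> elts x"
      using that le[of x y] le[of y x] by blast+
    then show ?thesis
      using elts_eq_iff by blast
  qed
  then have inj: "inj_on (collapse M) M"
    by (rule inj_on_collapse)
  have fix_s: "collapse M (s i) = s i" if "i \<in> fv \<phi>" for i
  proof (rule collapse_fixes_transitive[OF VM])
    show "elts x \<subseteq> Vset \<beta>" if "x \<in> Vset \<beta>" for x
      using Vset_trans[OF Ord_mem[OF inaccessible_Ord[OF \<kappa>] \<beta>(1)] that] by blast
    show "s i \<in> Vset \<beta>"
      using \<beta>(2) that by blast
  qed
  have sM: "\<forall>i\<in>fv \<phi>. s i \<in> M"
    using \<beta>(2) VM by blast
  \<comment> \<open>The truth of \<phi> travels down from \<open>Vset \<kappa>\<close> to its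
    transitive subset, across the isomorphism to \<open>M\<close>, and then up to the universe by
    elementarity.\<close>
  have "sat (collapse M ` M) s \<phi>"
    using sM fix_s by (intro Pi1_downward[OF assms(2) sub trans _ sat]) force+
  then have "sat (collapse M ` M) (collapse M \<circ> s) \<phi>"
    using fix_s by (subst sat_cong[of _ _ s]) auto
  then have "sat M s \<phi>"
    using sat_isomorphic[OF inj collapse_mem_iff[OF inj] sM] by blast
  then show ?thesis
    using elem[OF sM] by blast
qed

text \<open>Cardinals are iterated omega times so that each level contains the Skolem values over
  the previous one. The union is an elementary substructure for all formulas, which is more than
  Sigma_2 correctness, and its height is a supremum of cardinals.\<close>

theorem ex_Sigma2_correct: "\<exists>\<delta>::'v::zfc. Card \<delta> \<and> lightface_Sigma2_correct \<delta>"
proof -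
  have "\<exists>\<gamma>::'v. Card \<gamma> \<and> \<beta> \<in> elts \<gamma> \<and> skolem_step (Vset \<beta>) \<subseteq> Vset \<gamma>" if "Ord \<beta>" for \<beta> :: 'v
  proof -
    have "usmall (UNIV :: 'v set) (Vset \<beta>)"
      using usmall_elts[OF universe_UNIV, of "set_of (Vset \<beta>)"] by (simp add: elts_set_of_Vset)
    then have "usmall (UNIV :: 'v set) (skolem_step (Vset \<beta>))"
      by (rule usmall_skolem_step[OF universe_UNIV])
    then obtain z where z: "elts z = skolem_step (Vset \<beta>)"
      using usmall_mem[OF universe_UNIV] by blast
    obtain \<gamma> where \<gamma>: "Ord \<gamma>" "elts z \<subseteq> Vset \<gamma>"
      using small_subset_Vset[OF small_elts ex_mem_Vset] by blast
    obtain \<epsilon> where \<epsilon>: "Ord \<epsilon>" "{\<beta>, \<gamma>} \<subseteq> elts \<epsilon>"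
      using Ord_upper_bound[OF small_pair[of \<beta> \<gamma>]] \<gamma>(1) \<open>Ord \<beta>\<close> by blast
    obtain \<nu> where \<nu>: "Card \<nu>" "\<epsilon> \<in> elts \<nu>"
      using ex_larger_Card[OF \<epsilon>(1)] by blast
    have ord: "Ord \<nu>"
      using \<nu>(1) by (simp add: Card_def)
    have "\<beta> \<in> elts \<nu>" "\<gamma> \<in> elts \<nu>"
      using Ord_trans[OF ord _ \<nu>(2)] \<epsilon>(2) by blast+
    then show ?thesis
      using \<nu>(1) z \<gamma>(2) Vset_mono[OF Ord_mem_imp_le[OF ord]] by blast
  qed
  then obtain f :: "'v \<Rightarrow> 'v" where
    f: "\<And>\<beta>. Ord \<beta> \<Longrightarrow> Card (f \<beta>) \<and> \<beta> \<in> elts (f \<beta>) \<and> skolem_step (Vset \<beta>) \<subseteq> Vset (f \<beta>)"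
    by metis
  obtain e :: 'v where e: "Ord e"
    using ex_mem_Vset by blast
  \<comment> \<open>With \<open>Suc n\<close> the sequence starts at \<open>f e\<close>, so already
    its first member is a cardinal.\<close>
  define d where "d n = (f ^^ Suc n) e" for n
  have d0: "d 0 = f e" and dS: "d (Suc n) = f (d n)" for n
    by (simp_all add: d_def)
  have card: "Card (d n)" for n
    by (induction n) (use f e in \<open>auto simp: d0 dS Card_def\<close>)
  then have ord: "Ord (d n)" for n
    unfolding Card_def by blast
  have "usmall (UNIV :: 'v set) (range d)"
    by (intro usmall_countable[OF universe_UNIV]) simp
  then obtain z where "elts z = range d"
    using usmall_mem[OF universe_UNIV] by blast
  then have "small (range d)"
    by (metis small_elts)
  then have sup: "is_ord_sup (range d) (set_of (\<Union>(elts ` range d)))" (is "is_ord_sup _ ?\<delta>")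
    using ord by (intro is_ord_sup_exists) auto
  have V: "Vset ?\<delta> = (\<Union>n. Vset (d n))"
    using Vset_is_ord_sup[OF sup] ord by auto
  have "sat (Vset ?\<delta>) s \<sigma> \<longleftrightarrow> sat UNIV s \<sigma>" if "sentence \<sigma>" for s \<sigma>
    unfolding V
  proof (rule elementary_chain)
    show "Vset (d n) \<subseteq> Vset (d (Suc n))" for n
      using f[OF ord, of n] ord[of "Suc n"] by (intro Vset_mono Ord_mem_imp_le) (auto simp: dS)
    show "Vset (d 0) \<noteq> {}"
      using f[OF e] Ord_subset_Vset[OF ord[of 0]] by (auto simp: d0)
    show "skolem_step (Vset (d n)) \<subseteq> Vset (d (Suc n))" for n
      using f[OF ord] by (simp add: dS)
    show "\<forall>i\<in>fv \<sigma>. s i \<in> (\<Union>n. Vset (d n))"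
      using that by (simp add: sentence_def)
  qed
  then have "lightface_Sigma2_correct ?\<delta>"
    using sup unfolding lightface_Sigma2_correct_def models_def is_ord_sup_def by blast
  moreover have "Card ?\<delta>"
    using Card_is_ord_sup[OF sup] card by blast
  ultimately show ?thesis
    by blast
qed

section \<open>Formulas about universes\<close>

definition Imp :: "fm \<Rightarrow> fm \<Rightarrow> fm"
  where "Imp \<phi> \<psi> = Neg (Conj \<phi> (Neg \<psi>))"

definition Disj :: "fm \<Rightarrow> fm \<Rightarrow> fm"
  where "Disj \<phi> \<psi> = Neg (Conj (Neg \<phi>) (Neg \<psi>))"

definition Iff :: "fm \<Rightarrow> fm \<Rightarrow> fm"
  where "Iff \<phi> \<psi> = Conj (Imp \<phi> \<psi>) (Imp \<psi> \<phi>)"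

definition BEx :: "nat \<Rightarrow> nat \<Rightarrow> fm \<Rightarrow> fm"
  where "BEx i j \<phi> = Exists i (Conj (Mem i j) \<phi>)"

definition BAll :: "nat \<Rightarrow> nat \<Rightarrow> fm \<Rightarrow> fm"
  where "BAll i j \<phi> = Neg (BEx i j (Neg \<phi>))"

lemma fv_connectives [simp]:
  "fv (Imp \<phi> \<psi>) = fv \<phi> \<union> fv \<psi>"
  "fv (Disj \<phi> \<psi>) = fv \<phi> \<union> fv \<psi>"
  "fv (Iff \<phi> \<psi>) = fv \<phi> \<union> fv \<psi>"
  "fv (BEx i j \<phi>) = insert j (fv \<phi>) - {i}"
  "fv (BAll i j \<phi>) = insert j (fv \<phi>) - {i}"
  by (auto simp: Imp_def Disj_def Iff_def BEx_def BAll_def)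

lemma sat_connectives [simp]:
  "sat D s (Imp \<phi> \<psi>) \<longleftrightarrow> (sat D s \<phi> \<longrightarrow> sat D s \<psi>)"
  "sat D s (Disj \<phi> \<psi>) \<longleftrightarrow> sat D s \<phi> \<or> sat D s \<psi>"
  "sat D s (Iff \<phi> \<psi>) \<longleftrightarrow> (sat D s \<phi> \<longleftrightarrow> sat D s \<psi>)"
  by (auto simp: Imp_def Disj_def Iff_def)

lemma sat_bounded:
  assumes "i \<noteq> j"
  shows "sat D s (BEx i j \<phi>) \<longleftrightarrow> (\<exists>x\<in>D. x \<in> elts (s j) \<and> sat D (s(i := x)) \<phi>)"
    and "sat D s (BAll i j \<phi>) \<longleftrightarrow> (\<forall>x\<in>D. x \<in> elts (s j) \<longrightarrow> sat D (s(i := x)) \<phi>)"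
  using assms by (auto simp: BEx_def BAll_def)

lemma sat_UNIV_bounded:
  assumes "i \<noteq> j"
  shows "sat UNIV s (BEx i j \<phi>) \<longleftrightarrow> (\<exists>x\<in>elts (s j). sat UNIV (s(i := x)) \<phi>)"
    and "sat UNIV s (BAll i j \<phi>) \<longleftrightarrow> (\<forall>x\<in>elts (s j). sat UNIV (s(i := x)) \<phi>)"
  using assms by (auto simp: sat_bounded)

lemma Delta0_bounded:
  assumes "Delta0 \<phi>"
  shows "i \<noteq> j \<Longrightarrow> Delta0 (BEx i j \<phi>)" "i \<noteq> j \<Longrightarrow> Delta0 (BAll i j \<phi>)"
    "Delta0 \<psi> \<Longrightarrow> Delta0 (Imp \<phi> \<psi>)" "Delta0 \<psi> \<Longrightarrow> Delta0 (Disj \<phi> \<psi>)"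
  using assms unfolding BEx_def BAll_def Imp_def Disj_def by (auto intro!: Delta0.intros)

text \<open>
  Variables 16 to 19 are reserved for the bound variables of the next four formulas,
  and variables from 20 on for relativized formulas.
\<close>

definition SubF :: "nat \<Rightarrow> nat \<Rightarrow> fm"
  where "SubF x y = BAll 19 x (Mem 19 y)"

definition UpairF :: "nat \<Rightarrow> nat \<Rightarrow> nat \<Rightarrow> fm"
  where "UpairF p x y = Conj (Conj (Mem x p) (Mem y p)) (BAll 19 p (Disj (Eq 19 x) (Eq 19 y)))"

definition KpairF :: "nat \<Rightarrow> nat \<Rightarrow> nat \<Rightarrow> fm"
  where "KpairF p x y =
    BEx 17 p (BEx 18 p (Conj (Conj (UpairF 17 x x) (UpairF 18 x y)) (UpairF p 17 18)))"

definition PairInF :: "nat \<Rightarrow> nat \<Rightarrow> nat \<Rightarrow> fm"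
  where "PairInF g x y = BEx 16 g (KpairF 16 x y)"

lemma Delta0_SubF: "x < 17 \<Longrightarrow> Delta0 (SubF x y)"
  unfolding SubF_def by (intro Delta0.intros Delta0_bounded) auto

lemma Delta0_UpairF: "p < 19 \<Longrightarrow> Delta0 (UpairF p x y)"
  unfolding UpairF_def by (intro Delta0.intros Delta0_bounded) auto

lemma Delta0_PairInF: "g < 16 \<Longrightarrow> Delta0 (PairInF g x y)"
  unfolding PairInF_def KpairF_def by (intro Delta0.intros Delta0_bounded Delta0_UpairF) auto

lemma fv_SubF: "x < 17 \<Longrightarrow> y < 17 \<Longrightarrow> fv (SubF x y) = {x, y}"
  by (auto simp: SubF_def)

lemma fv_PairInF: "g < 16 \<Longrightarrow> x < 16 \<Longrightarrow> y < 16 \<Longrightarrow> fv (PairInF g x y) = {g, x, y}"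
  by (auto simp: PairInF_def KpairF_def UpairF_def)

lemma sat_SubF: "x < 17 \<Longrightarrow> y < 17 \<Longrightarrow> sat UNIV s (SubF x y) \<longleftrightarrow> elts (s x) \<subseteq> elts (s y)"
  by (auto simp: SubF_def sat_UNIV_bounded)

lemma sat_UpairF: "p < 19 \<Longrightarrow> x < 19 \<Longrightarrow> y < 19 \<Longrightarrow> sat UNIV s (UpairF p x y) \<longleftrightarrow> s p = upair (s x) (s y)"
  by (auto simp: UpairF_def elts_upair sat_UNIV_bounded simp flip: elts_eq_iff)

lemma sat_PairInF:
  assumes "g < 16" "x < 16" "y < 16"
  shows "sat UNIV s (PairInF g x y) \<longleftrightarrow> kpair (s x) (s y) \<in> elts (s g)"
proof -
  have "sat UNIV s (PairInF g x y) \<longleftrightarrow>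
    (\<exists>p\<in>elts (s g). \<exists>a\<in>elts p. \<exists>b\<in>elts p.
      (a = upair (s x) (s x) \<and> b = upair (s x) (s y)) \<and> p = upair a b)"
    using assms by (simp add: PairInF_def KpairF_def sat_UpairF sat_UNIV_bounded)
  then show ?thesis
    by (auto simp: kpair_def elts_upair)
qed

text \<open>Variable 4 is a potential class \<open>F\<close> over the candidate. The clauses are
  transitivity, pairing, union, power set and infinity, and, for \<open>F\<close> included in the
  candidate, closure under subsets and replacement along \<open>F\<close>. Bounding sets such as
  \<open>r\<close> suffice, as subset closure trims them. All quantifiers are bounded, so the
  formula is Delta0.\<close>

definition universe_matrix :: "nat \<Rightarrow> fm"
  where "universe_matrix v =
    Conj (BAll 5 v (BAll 6 5 (Mem 6 v)))
   (Conj (BAll 5 v (BAll 6 v (BEx 7 v (Conj (Mem 5 7) (Mem 6 7)))))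
   (Conj (BAll 5 v (BEx 6 v (BAll 7 5 (BAll 8 7 (Mem 8 6)))))
   (Conj (BAll 5 v (BEx 6 v (BAll 7 v (Imp (SubF 7 5) (Mem 7 6)))))
   (Conj (BEx 5 v (Conj (BEx 6 5 (Eq 6 6)) (BAll 6 5 (BEx 7 5 (Mem 6 7)))))
   (Imp (SubF 4 v)
     (Conj (BAll 5 v (Imp (SubF 4 5) (Mem 4 v)))
       (BAll 5 v (Imp
         (BAll 6 5 (BAll 7 v (BAll 8 v (Imp (Conj (PairInF 4 6 7) (PairInF 4 6 8)) (Eq 7 8)))))
         (BEx 9 v (BAll 6 5 (BAll 7 v (Imp (PairInF 4 6 7) (Mem 7 9)))))))))))))"

definition universe_cond :: "'v::zfc \<Rightarrow> 'v \<Rightarrow> bool"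
  where "universe_cond v F \<longleftrightarrow>
    (\<forall>x\<in>elts v. \<forall>y\<in>elts x. y \<in> elts v) \<and>
    (\<forall>x\<in>elts v. \<forall>y\<in>elts v. \<exists>p\<in>elts v. x \<in> elts p \<and> y \<in> elts p) \<and>
    (\<forall>x\<in>elts v. \<exists>u\<in>elts v. \<forall>y\<in>elts x. \<forall>z\<in>elts y. z \<in> elts u) \<and>
    (\<forall>x\<in>elts v. \<exists>p\<in>elts v. \<forall>y\<in>elts v. elts y \<subseteq> elts x \<longrightarrow> y \<in> elts p) \<and>
    (\<exists>z\<in>elts v. (\<exists>x. x \<in> elts z) \<and> (\<forall>x\<in>elts z. \<exists>y\<in>elts z. x \<in> elts y)) \<and>
    (elts F \<subseteq> elts v \<longrightarrow>
      (\<forall>x\<in>elts v. elts F \<subseteq> elts x \<longrightarrow> F \<in> elts v) \<and>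
      (\<forall>x\<in>elts v.
        (\<forall>y\<in>elts x. \<forall>z\<in>elts v. \<forall>z'\<in>elts v. kpair y z \<in> elts F \<and> kpair y z' \<in> elts F \<longrightarrow> z = z') \<longrightarrow>
        (\<exists>r\<in>elts v. \<forall>y\<in>elts x. \<forall>z\<in>elts v. kpair y z \<in> elts F \<longrightarrow> z \<in> elts r)))"

lemma sat_universe_matrix:
  assumes "v < 4"
  shows "sat UNIV s (universe_matrix v) \<longleftrightarrow> universe_cond (s v) (s 4)"
proof -
  have neq: "v \<noteq> 4" "v \<noteq> 5" "v \<noteq> 6" "v \<noteq> 7" "v \<noteq> 8" "v \<noteq> 9" "v < 16" "v < 17"
    using assms by auto
  then show ?thesis
    unfolding universe_matrix_def universe_cond_def
    by (simp add: sat_SubF sat_PairInF sat_UNIV_bounded)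
qed

lemma Delta0_universe_matrix: "v < 4 \<Longrightarrow> Delta0 (universe_matrix v)"
  unfolding universe_matrix_def by (intro Delta0.intros Delta0_bounded Delta0_SubF Delta0_PairInF) auto

lemma fv_universe_matrix: "v < 4 \<Longrightarrow> fv (universe_matrix v) = {v, 4}"
  unfolding universe_matrix_def by (auto simp: fv_SubF fv_PairInF)

text \<open>
  The quantified \<open>F\<close> only matters when it is a subset of \<open>v\<close>, so being a universe is
  absolute between all classes that contain \<open>v\<close> and its subsets.
\<close>

lemma universe_cond_iff_universe:
  assumes D: "\<And>F. elts F \<subseteq> elts v \<Longrightarrow> F \<in> D"
  shows "(\<forall>F\<in>D. universe_cond v F) \<longleftrightarrow> universe (elts v)"
proof
  assume cond: "\<forall>F\<in>D. universe_cond v F"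
  then have c: "universe_cond v F" if "elts F \<subseteq> elts v" for F
    using D that by blast
  \<comment> \<open>The instance \<open>F = v\<close> meets the inclusion premise and gives the
    clauses that do not mention \<open>F\<close>.\<close>
  note c' = c[of v, OF subset_refl, unfolded universe_cond_def]
  have sub: "y \<in> elts v" if "x \<in> elts v" "elts y \<subseteq> elts x" for x y
  proof -
    have "elts y \<subseteq> elts v"
      using that c'[THEN conjunct1] by blast
    then show ?thesis
      using c[of y] that unfolding universe_cond_def by blast
  qed
  have sub': "\<exists>z\<in>elts v. elts z = X" if "x \<in> elts v" "X \<subseteq> elts x" for x X
    using sub[OF that(1), of "set_of X"] that elts_set_of[OF small_subset[OF small_elts that(2)]] by auto
  have upair: "upair x y \<in> elts v" if "x \<in> elts v" "y \<in> elts v" for x y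
  proof -
    obtain p where "p \<in> elts v" "x \<in> elts p \<and> y \<in> elts p"
      using c'[THEN conjunct2, THEN conjunct1] \<open>x \<in> elts v\<close> \<open>y \<in> elts v\<close> by blast
    then show ?thesis
      using sub[of p "upair x y"] by (simp add: elts_upair)
  qed
  show "universe (elts v)"
    unfolding universe_def
  proof (intro conjI ballI allI impI)
    fix x assume x: "x \<in> elts v"
    show "elts x \<subseteq> elts v"
      using c'[THEN conjunct1] x by blast
    show "upair x y \<in> elts v" if "y \<in> elts v" for y
      using upair x that by blast
    obtain p where p: "p \<in> elts v" "\<And>y. y \<in> elts v \<Longrightarrow> elts y \<subseteq> elts x \<Longrightarrow> y \<in> elts p"
      using c'[THEN conjunct2, THEN conjunct2, THEN conjunct2, THEN conjunct1] x by blast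
    have "{y. elts y \<subseteq> elts x} \<subseteq> elts p"
      using p(2) sub[OF x] by blast
    then show "\<exists>p\<in>elts v. elts p = {y. elts y \<subseteq> elts x}"
      by (rule sub'[OF p(1)])
    obtain u where u: "u \<in> elts v" "\<forall>y\<in>elts x. \<forall>z\<in>elts y. z \<in> elts u"
      using c'[THEN conjunct2, THEN conjunct2, THEN conjunct1] x by blast
    then have "\<Union>(elts ` elts x) \<subseteq> elts u"
      by blast
    then show "\<exists>u\<in>elts v. elts u = \<Union>(elts ` elts x)"
      by (rule sub'[OF u(1)])
    fix f assume f: "f ` elts x \<subseteq> elts v"
    \<comment> \<open>An arbitrary HOL function on \<open>x\<close> becomes a subset of
      \<open>v\<close> through its graph, so the single variable \<open>F\<close> captures
      second-order replacement.\<close>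
    define F where "F = set_of ((\<lambda>y. kpair y (f y)) ` elts x)"
    have F: "elts F = (\<lambda>y. kpair y (f y)) ` elts x"
      unfolding F_def by (rule elts_set_of[OF small_image[OF small_elts]])
    have "elts F \<subseteq> elts v"
      using f \<open>elts x \<subseteq> elts v\<close> unfolding F kpair_def by (auto intro!: upair)
    then have "(\<forall>x\<in>elts v.
        (\<forall>y\<in>elts x. \<forall>z\<in>elts v. \<forall>z'\<in>elts v. kpair y z \<in> elts F \<and> kpair y z' \<in> elts F \<longrightarrow> z = z') \<longrightarrow>
        (\<exists>r\<in>elts v. \<forall>y\<in>elts x. \<forall>z\<in>elts v. kpair y z \<in> elts F \<longrightarrow> z \<in> elts r))"
      using c[of F] unfolding universe_cond_def by simp
    moreover have "\<forall>y\<in>elts x. \<forall>z\<in>elts v. \<forall>z'\<in>elts v. kpair y z \<in> elts F \<and> kpair y z' \<in> elts F \<longrightarrow> z = z'"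
      by (auto simp: F kpair_eq_iff)
    ultimately obtain r where r: "r \<in> elts v" "\<forall>y\<in>elts x. \<forall>z\<in>elts v. kpair y z \<in> elts F \<longrightarrow> z \<in> elts r"
      using x by blast
    have "f ` elts x \<subseteq> elts r"
      using r(2) f by (auto simp: F)
    then show "\<exists>z\<in>elts v. elts z = f ` elts x"
      by (rule sub'[OF r(1)])
  next
    show "\<exists>z\<in>elts v. elts z \<noteq> {} \<and> (\<forall>x\<in>elts z. \<exists>y\<in>elts z. x \<in> elts y)"
      using c'[THEN conjunct2, THEN conjunct2, THEN conjunct2, THEN conjunct2, THEN conjunct1] by blast
  qed
next
  assume U: "universe (elts v)"
  note tr = universe_trans[OF U]
  have "universe_cond v F" for F
    unfolding universe_cond_def
  proof (intro conjI ballI impI)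
    show "y \<in> elts v" if "x \<in> elts v" "y \<in> elts x" for x y
      using that by (rule tr)
    show "\<exists>p\<in>elts v. x \<in> elts p \<and> y \<in> elts p" if "x \<in> elts v" "y \<in> elts v" for x y
      using universe_upair[OF U that] by (intro bexI[of _ "upair x y"]) (simp_all add: elts_upair)
    show "\<exists>u\<in>elts v. \<forall>y\<in>elts x. \<forall>z\<in>elts y. z \<in> elts u" if "x \<in> elts v" for x
      using universe_Union[OF U that] by auto
    show "\<exists>p\<in>elts v. \<forall>y\<in>elts v. elts y \<subseteq> elts x \<longrightarrow> y \<in> elts p" if "x \<in> elts v" for x
      using universe_powerset[OF U that] by auto
    show "\<exists>z\<in>elts v. (\<exists>x. x \<in> elts z) \<and> (\<forall>x\<in>elts z. \<exists>y\<in>elts z. x \<in> elts y)"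
      using U[unfolded universe_def, THEN conjunct2, THEN conjunct2, THEN conjunct2, THEN conjunct2, THEN conjunct2]
      by blast
    show "F \<in> elts v" if "x \<in> elts v" "elts F \<subseteq> elts x" for x
      using universe_subset_closed[OF U that] .
    fix x
    assume x: "x \<in> elts v" and fn: "\<forall>y\<in>elts x. \<forall>z\<in>elts v. \<forall>z'\<in>elts v.
      kpair y z \<in> elts F \<and> kpair y z' \<in> elts F \<longrightarrow> z = z'"
    \<comment> \<open>Arguments without a partner are sent to \<open>x\<close>, an element of
      \<open>v\<close>, so that all values stay in \<open>v\<close> and replacement applies.\<close>
    define f where "f y = (if \<exists>z\<in>elts v. kpair y z \<in> elts F
      then SOME z. z \<in> elts v \<and> kpair y z \<in> elts F else x)" for y
    have some: "f y \<in> elts v \<and> kpair y (f y) \<in> elts F" if "\<exists>z\<in>elts v. kpair y z \<in> elts F" for y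
      unfolding f_def using that someI_ex[of "\<lambda>z. z \<in> elts v \<and> kpair y z \<in> elts F"] by auto
    then have "f ` elts x \<subseteq> elts v"
      using x by (auto simp: f_def)
    then obtain r where r: "r \<in> elts v" "elts r = f ` elts x"
      using universe_image[OF U x] by blast
    have "z \<in> elts r" if "y \<in> elts x" "z \<in> elts v" "kpair y z \<in> elts F" for y z
    proof -
      have "f y = z"
        using some[of y] fn that by blast
      then show ?thesis
        using r(2) that(1) by blast
    qed
    then show "\<exists>r\<in>elts v. \<forall>y\<in>elts x. \<forall>z\<in>elts v. kpair y z \<in> elts F \<longrightarrow> z \<in> elts r"
      using r(1) by blast
  qed
  then show "\<forall>F\<in>D. universe_cond v F"
    by blast
qed

text \<open>A common setting for the class of all sets and all levels, including
  \<open>Vset (\<kappa> \<oplus> \<alpha>)\<close>: Delta0 formulas are absolute, and quantifying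
  over the subsets of an element means the same inside and outside.\<close>

definition supertransitive :: "'v::zfc set \<Rightarrow> bool"
  where "supertransitive D \<longleftrightarrow> (\<forall>x\<in>D. elts x \<subseteq> D \<and> (\<forall>y. elts y \<subseteq> elts x \<longrightarrow> y \<in> D))"

lemma supertransitive_UNIV: "supertransitive UNIV"
  by (simp add: supertransitive_def)

lemma supertransitive_Vset: "Ord \<gamma> \<Longrightarrow> supertransitive (Vset \<gamma>)"
  unfolding supertransitive_def using Vset_trans Vset_subset_closed by blast

definition universeF :: "nat \<Rightarrow> fm"
  where "universeF v = Forall 4 (universe_matrix v)"

lemma fv_universeF: "v < 4 \<Longrightarrow> fv (universeF v) = {v}"
  by (auto simp: universeF_def fv_universe_matrix)

lemma sat_universe_matrix_supertransitive:
  assumes "supertransitive D" "s v \<in> D" "s 4 \<in> D" "v < 4"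
  shows "sat D s (universe_matrix v) \<longleftrightarrow> universe_cond (s v) (s 4)"
proof -
  have "sat D s (universe_matrix v) \<longleftrightarrow> sat UNIV s (universe_matrix v)"
    using assms by (intro Delta0_absolute Delta0_universe_matrix)
      (auto simp: fv_universe_matrix supertransitive_def)
  then show ?thesis
    by (simp add: sat_universe_matrix assms(4))
qed

lemma sat_universeF:
  assumes D: "supertransitive D" and v: "s v \<in> D" "v < 4"
  shows "sat D s (universeF v) \<longleftrightarrow> universe (elts (s v))"
proof -
  have "sat D s (universeF v) \<longleftrightarrow> (\<forall>F\<in>D. universe_cond (s v) F)"
    unfolding universeF_def using sat_universe_matrix_supertransitive[OF D, of "s(4 := F)" v for F] v by simp
  also have "\<dots> \<longleftrightarrow> universe (elts (s v))"
    using D v(1) unfolding supertransitive_def by (intro universe_cond_iff_universe) blast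
  finally show ?thesis .
qed

section \<open>Relativization\<close>

text \<open>
  Individual variables are moved to the even numbers from 20 on and second-order variables to
  the odd ones, out of the way of the variables used elsewhere.
\<close>

primrec rel :: "nat \<Rightarrow> sofm \<Rightarrow> fm" where
  "rel m (SMem i j) = Mem (20 + 2 * i) (20 + 2 * j)"
| "rel m (SEq i j) = Eq (20 + 2 * i) (20 + 2 * j)"
| "rel m (SMemP i X) = Mem (20 + 2 * i) (21 + 2 * X)"
| "rel m (SNeg \<phi>) = Neg (rel m \<phi>)"
| "rel m (SConj \<phi> \<psi>) = Conj (rel m \<phi>) (rel m \<psi>)"
| "rel m (SExists i \<phi>) = BEx (20 + 2 * i) m (rel m \<phi>)"
| "rel m (SExists2 X \<phi>) = Exists (21 + 2 * X) (Conj (BAll 19 (21 + 2 * X) (Mem 19 m)) (rel m \<phi>))"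

lemma even_neq_odd: "20 + 2 * i \<noteq> 21 + 2 * (j::nat)"
  by presburger

text \<open>All subsets of \<open>elts (s m)\<close> are elements of \<open>D\<close>, so
  second-order quantification over that structure becomes first-order quantification in
  \<open>D\<close>.\<close>

lemma sat_rel:
  assumes D: "supertransitive D" and m: "s m \<in> D" "m < 19"
  shows "sat D s (rel m \<phi>) \<longleftrightarrow>
    sosat (elts (s m)) (\<lambda>i. s (20 + 2 * i)) (\<lambda>X. elts (s (21 + 2 * X))) \<phi>"
  using m(1)
proof (induction \<phi> arbitrary: s)
  case (SExists i \<phi>)
  have "sat D (s(20 + 2 * i := x)) (rel m \<phi>) \<longleftrightarrow>
    sosat (elts (s m)) ((\<lambda>i. s (20 + 2 * i))(i := x)) (\<lambda>X. elts (s (21 + 2 * X))) \<phi>" for x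
  proof -
    let ?s = "s(20 + 2 * i := x)"
    have "(\<lambda>j. ?s (20 + 2 * j)) = (\<lambda>i. s (20 + 2 * i))(i := x)"
      by auto
    moreover have "(\<lambda>X. elts (?s (21 + 2 * X))) = (\<lambda>X. elts (s (21 + 2 * X)))"
      using even_neq_odd by (metis fun_upd_other)
    moreover have "?s m = s m"
      using m(2) by simp
    ultimately show ?thesis
      using SExists.IH[of ?s] SExists.prems by metis
  qed
  moreover have "elts (s m) \<subseteq> D"
    using D SExists.prems unfolding supertransitive_def by blast
  ultimately show ?case
    using m(2) by (auto simp: sat_bounded)
next
  case (SExists2 X \<phi>)
  have eq: "sat D (s(21 + 2 * X := x)) (rel m \<phi>) \<longleftrightarrow>
    sosat (elts (s m)) (\<lambda>i. s (20 + 2 * i)) ((\<lambda>X. elts (s (21 + 2 * X)))(X := elts x)) \<phi>" for x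
  proof -
    let ?s = "s(21 + 2 * X := x)"
    have "(\<lambda>j. ?s (20 + 2 * j)) = (\<lambda>i. s (20 + 2 * i))"
      using even_neq_odd by (metis fun_upd_other)
    moreover have "(\<lambda>X. elts (?s (21 + 2 * X))) = (\<lambda>X. elts (s (21 + 2 * X)))(X := elts x)"
      by (rule ext) simp
    moreover have "?s m = s m"
      using m(2) by simp
    ultimately show ?thesis
      using SExists2.IH[of ?s] SExists2.prems by metis
  qed
  have sub: "sat D (s(21 + 2 * X := x)) (BAll 19 (21 + 2 * X) (Mem 19 m)) \<longleftrightarrow> elts x \<subseteq> elts (s m)"
    if "x \<in> D" for x
    using that D m(2) unfolding supertransitive_def by (auto simp: sat_bounded)
  have "sat D s (rel m (SExists2 X \<phi>)) \<longleftrightarrow> (\<exists>x\<in>D. elts x \<subseteq> elts (s m) \<and>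
    sosat (elts (s m)) (\<lambda>i. s (20 + 2 * i)) ((\<lambda>X. elts (s (21 + 2 * X)))(X := elts x)) \<phi>)"
    unfolding rel.simps sat.simps(4,5) using sub eq by (metis (no_types, lifting))
  also have "\<dots> \<longleftrightarrow> (\<exists>A\<subseteq>elts (s m).
    sosat (elts (s m)) (\<lambda>i. s (20 + 2 * i)) ((\<lambda>X. elts (s (21 + 2 * X)))(X := A)) \<phi>)"
  proof -
    have "\<exists>x\<in>D. elts x = A" if "A \<subseteq> elts (s m)" for A
      using elts_set_of[OF small_subset[OF small_elts that]] that D SExists2.prems
      unfolding supertransitive_def by (intro bexI[of _ "set_of A"]) auto
    then show ?thesis
      by metis
  qed
  finally show ?case
    by simp
qed auto

lemma sosat_cong:
  "\<forall>i\<in>sofv \<phi>. s i = t i \<Longrightarrow> \<forall>X\<in>sofv2 \<phi>. S X = T X \<Longrightarrow> sosat D s S \<phi> \<longleftrightarrow> sosat D t T \<phi>"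
proof (induction \<phi> arbitrary: s t S T)
  case (SConj \<phi> \<psi>)
  have "sosat D s S \<phi> \<longleftrightarrow> sosat D t T \<phi>" "sosat D s S \<psi> \<longleftrightarrow> sosat D t T \<psi>"
    by (rule SConj.IH; use SConj.prems in simp)+
  then show ?case
    by simp
next
  case (SExists i \<phi>)
  have "sosat D (s(i := x)) S \<phi> \<longleftrightarrow> sosat D (t(i := x)) T \<phi>" for x
    by (rule SExists.IH) (use SExists.prems in simp_all)
  then show ?case
    by simp
next
  case (SExists2 X \<phi>)
  have "sosat D s (S(X := A)) \<phi> \<longleftrightarrow> sosat D t (T(X := A)) \<phi>" for A
    by (rule SExists2.IH) (use SExists2.prems in simp_all)
  then show ?case
    by simp
next
  case (SNeg \<phi>)
  have "sosat D s S \<phi> \<longleftrightarrow> sosat D t T \<phi>"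
    by (rule SNeg.IH) (use SNeg.prems in simp_all)
  then show ?case
    by simp
qed simp_all

lemma sat_rel_sentence:
  assumes "supertransitive D" "s m \<in> D" "m < 19" "so_sentence \<sigma>"
  shows "sat D s (rel m \<sigma>) \<longleftrightarrow> elts (s m) \<Turnstile>\<^sub>2 \<sigma>"
proof -
  have "sosat (elts (s m)) t T \<sigma> \<longleftrightarrow>
    sosat (elts (s m)) (\<lambda>i. s (20 + 2 * i)) (\<lambda>X. elts (s (21 + 2 * X))) \<sigma>" for t T
    by (rule sosat_cong) (use assms(4) in \<open>simp_all add: so_sentence_def\<close>)
  then show ?thesis
    unfolding sat_rel[where s = s and m = m, OF assms(1-3)] so_models_def by blast
qed

lemma fv_rel_subset:
  "m < 19 \<Longrightarrow> fv (rel m \<phi>) \<subseteq> insert m ((\<lambda>i. 20 + 2 * i) ` sofv \<phi> \<union> (\<lambda>X. 21 + 2 * X) ` sofv2 \<phi>)"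
  by (induction \<phi>) auto

lemma fv_rel: "m < 19 \<Longrightarrow> so_sentence \<sigma> \<Longrightarrow> fv (rel m \<sigma>) \<subseteq> {m}"
  using fv_rel_subset[of m \<sigma>] by (simp add: so_sentence_def)

text \<open>Lets a single relativization \<open>rel\<close> serve both first-order and second-order
  sentences.\<close>

primrec so_embed :: "fm \<Rightarrow> sofm" where
  "so_embed (Mem i j) = SMem i j"
| "so_embed (Eq i j) = SEq i j"
| "so_embed (Neg \<phi>) = SNeg (so_embed \<phi>)"
| "so_embed (Conj \<phi> \<psi>) = SConj (so_embed \<phi>) (so_embed \<psi>)"
| "so_embed (Exists i \<phi>) = SExists i (so_embed \<phi>)"

lemma sosat_so_embed: "sosat D s S (so_embed \<phi>) \<longleftrightarrow> sat D s \<phi>"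
  by (induction \<phi> arbitrary: s) auto

lemma so_models_embed: "D \<Turnstile>\<^sub>2 so_embed \<sigma> \<longleftrightarrow> D \<Turnstile> \<sigma>"
  by (simp add: so_models_def models_def sosat_so_embed)

lemma so_sentence_embed: "sentence \<sigma> \<Longrightarrow> so_sentence (so_embed \<sigma>)"
proof -
  have "sofv (so_embed \<phi>) = fv \<phi>" "sofv2 (so_embed \<phi>) = {}" for \<phi>
    by (induction \<phi>) auto
  then show "sentence \<sigma> \<Longrightarrow> so_sentence (so_embed \<sigma>)"
    by (simp add: sentence_def so_sentence_def)
qed

text \<open>Without second-order quantifiers, relativization produces only bounded quantifiers. This
  keeps the sentence used against Sigma_2-correct ordinals at level two.\<close>

lemma Delta0_rel_embed: "m < 19 \<Longrightarrow> Delta0 (rel m (so_embed \<phi>))"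
  by (induction \<phi>) (auto intro!: Delta0.intros Delta0_bounded)

section \<open>The largest inaccessible cardinal of a level\<close>

text \<open>\<gamma> is arbitrary because two cases occur: the next inaccessible above \<kappa>, and
  \<kappa> \<oplus> \<alpha>.\<close>

definition top_inaccessible :: "'v::zfc \<Rightarrow> 'v \<Rightarrow> bool"
  where "top_inaccessible \<gamma> \<kappa> \<longleftrightarrow>
    inaccessible \<kappa> \<and> \<kappa> \<in> elts \<gamma> \<and> (\<forall>\<mu>. inaccessible \<mu> \<and> \<mu> \<in> elts \<gamma> \<longrightarrow> \<mu> \<preceq> \<kappa>)"

lemma universe_mem_Vset_iff:
  assumes "Ord \<gamma>"
  shows "v \<in> Vset \<gamma> \<and> universe (elts v) \<longleftrightarrow>
    (\<exists>\<kappa>. inaccessible \<kappa> \<and> \<kappa> \<in> elts \<gamma> \<and> v = set_of (Vset \<kappa>))"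
proof
  assume v: "v \<in> Vset \<gamma> \<and> universe (elts v)"
  then obtain \<kappa> where \<kappa>: "inaccessible \<kappa>" "elts v = Vset \<kappa>"
    using inaccessible_iff_universe by blast
  then have "v = set_of (Vset \<kappa>)"
    using elts_set_of_Vset elts_eq_iff by metis
  then show "\<exists>\<kappa>. inaccessible \<kappa> \<and> \<kappa> \<in> elts \<gamma> \<and> v = set_of (Vset \<kappa>)"
    using v \<kappa>(1) Vset_mem_Vset_iff[OF assms inaccessible_Ord[OF \<kappa>(1)]] by blast
next
  assume "\<exists>\<kappa>. inaccessible \<kappa> \<and> \<kappa> \<in> elts \<gamma> \<and> v = set_of (Vset \<kappa>)"
  then obtain \<kappa> where \<kappa>: "inaccessible \<kappa>" "\<kappa> \<in> elts \<gamma>" "v = set_of (Vset \<kappa>)"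
    by blast
  then show "v \<in> Vset \<gamma> \<and> universe (elts v)"
    using Vset_mem_Vset_iff[OF assms inaccessible_Ord[OF \<kappa>(1)]] inaccessible_universe[OF \<kappa>(1)]
    by (simp add: elts_set_of_Vset)
qed

text \<open>In \<chi>, variable 1 names the largest universe of the level. Between universes, \<in>
  or = is the order of the corresponding inaccessibles.\<close>

definition TopF :: "fm \<Rightarrow> fm"
  where "TopF \<chi> = Exists 1 (Conj (Conj (universeF 1)
    (Forall 2 (Imp (universeF 2) (Disj (Mem 2 1) (Eq 2 1))))) \<chi>)"

lemma sentence_TopF: "fv \<chi> \<subseteq> {1} \<Longrightarrow> sentence (TopF \<chi>)"
  by (auto simp: sentence_def TopF_def fv_universeF)

lemma sat_TopF:
  assumes "Ord \<gamma>"
  shows "sat (Vset \<gamma>) s (TopF \<chi>) \<longleftrightarrow>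
    (\<exists>\<kappa>. top_inaccessible \<gamma> \<kappa> \<and> sat (Vset \<gamma>) (s(1 := set_of (Vset \<kappa>))) \<chi>)"
proof -
  let ?D = "Vset \<gamma>" and ?V = "\<lambda>\<kappa>. set_of (Vset \<kappa>)"
  note D = supertransitive_Vset[OF assms]
  note ord = inaccessible_Ord
  have u1: "sat ?D (s(1 := v)) (universeF 1) \<longleftrightarrow> universe (elts v)" if "v \<in> ?D" for v
    using sat_universeF[OF D, of "s(1 := v)" 1] that by simp
  have u2: "sat ?D (s(1 := v, 2 := w)) (universeF 2) \<longleftrightarrow> universe (elts w)" if "w \<in> ?D" for v w
    using sat_universeF[OF D, of "s(1 := v, 2 := w)" 2] that by simp
  have W: "{v \<in> ?D. universe (elts v)} = ?V ` {\<kappa>. inaccessible \<kappa> \<and> \<kappa> \<in> elts \<gamma>}" (is "?W = _")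
    using universe_mem_Vset_iff[OF assms] by blast
  have "sat ?D s (TopF \<chi>) \<longleftrightarrow>
    (\<exists>v\<in>?W. (\<forall>w\<in>?W. w \<in> elts v \<or> w = v) \<and> sat ?D (s(1 := v)) \<chi>)"
    unfolding TopF_def using u1 u2 by auto
  also have "\<dots> \<longleftrightarrow> (\<exists>\<kappa>. inaccessible \<kappa> \<and> \<kappa> \<in> elts \<gamma> \<and>
      (\<forall>\<mu>. inaccessible \<mu> \<and> \<mu> \<in> elts \<gamma> \<longrightarrow> ?V \<mu> \<in> elts (?V \<kappa>) \<or> ?V \<mu> = ?V \<kappa>) \<and>
      sat ?D (s(1 := ?V \<kappa>)) \<chi>)"
    unfolding W by simp
  also have "\<dots> \<longleftrightarrow> (\<exists>\<kappa>. top_inaccessible \<gamma> \<kappa> \<and> sat ?D (s(1 := ?V \<kappa>)) \<chi>)"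
  proof -
    have "?V \<mu> \<in> elts (?V \<kappa>) \<or> ?V \<mu> = ?V \<kappa> \<longleftrightarrow> \<mu> \<preceq> \<kappa>" if "inaccessible \<mu>" "inaccessible \<kappa>" for \<mu> \<kappa>
    proof -
      have "?V \<mu> \<in> elts (?V \<kappa>) \<longleftrightarrow> \<mu> \<in> elts \<kappa>"
        using Vset_mem_Vset_iff[OF ord[OF that(2)] ord[OF that(1)]] by (simp add: elts_set_of_Vset)
      moreover have "?V \<mu> = ?V \<kappa> \<longleftrightarrow> \<mu> = \<kappa>"
        using Vset_inject[OF ord[OF that(1)] ord[OF that(2)]] by (metis elts_set_of_Vset)
      ultimately show ?thesis
        using Ord_le_iff[OF ord[OF that(1)] ord[OF that(2)]] by blast
    qed
    then show ?thesis
      unfolding top_inaccessible_def by (auto cong: conj_cong)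
  qed
  finally show ?thesis .
qed

text \<open>If \<rho> were below \<mu>, it would be an inaccessible below \<mu> and so \<rho>
  \<preceq> \<kappa>, although \<kappa> is in \<rho>.\<close>

lemma top_inaccessible_unique:
  assumes "top_inaccessible \<rho> \<kappa>" "top_inaccessible \<mu> \<kappa>" "inaccessible \<rho>" "inaccessible \<mu>"
  shows "\<rho> = \<mu>"
proof -
  have "\<not> \<rho> \<in> elts \<mu>" if "top_inaccessible \<rho> \<kappa>" "top_inaccessible \<mu> \<kappa>" "inaccessible \<rho>" for \<rho> \<mu> :: 'a
    using that mem_not_refl[of \<kappa>] unfolding top_inaccessible_def by blast
  then show ?thesis
    using assms Ord_linear[OF inaccessible_Ord[OF assms(3)] inaccessible_Ord[OF assms(4)]] by blast
qed

text \<open>The least inaccessible above \<kappa>; this is where the absence of a largest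
  inaccessible enters.\<close>

lemma ex_top_inaccessible:
  fixes \<kappa> :: "'v::zfc"
  assumes "\<not> (\<exists>\<kappa>::'v. inaccessible \<kappa> \<and> (\<forall>\<mu>. inaccessible \<mu> \<longrightarrow> \<mu> \<preceq> \<kappa>))" "inaccessible \<kappa>"
  obtains \<rho> where "inaccessible \<rho>" "top_inaccessible \<rho> \<kappa>"
proof -
  note ord = inaccessible_Ord
  obtain \<mu> where "inaccessible \<mu>" "\<not> \<mu> \<preceq> \<kappa>"
    using assms by blast
  then have "\<mu> \<in> {\<mu>. inaccessible \<mu> \<and> \<kappa> \<in> elts \<mu>}"
    using Ord_not_le[OF ord ord[OF assms(2)]] by blast
  then obtain \<rho> where \<rho>: "\<rho> \<in> {\<mu>. inaccessible \<mu> \<and> \<kappa> \<in> elts \<mu>}"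
    "\<And>\<mu>. \<mu> \<in> elts \<rho> \<Longrightarrow> \<mu> \<notin> {\<mu>. inaccessible \<mu> \<and> \<kappa> \<in> elts \<mu>}"
    by (rule mem_minimal) blast
  then have "top_inaccessible \<rho> \<kappa>"
    unfolding top_inaccessible_def using assms(2) Ord_not_le[OF ord ord[OF assms(2)]] by blast
  then show thesis
    using that \<rho>(1) by blast
qed

text \<open>The common core of the second-order and \<alpha>-order cases: among inaccessible levels
  \<open>TopF \<chi>\<close> says that \<kappa> is the largest inaccessible below, and that
  determines the level. Only \<chi> depends on the order considered.\<close>

lemma fo_sententially_categorical_next:
  fixes \<kappa> \<rho> :: "'v::zfc"
  assumes "inaccessible \<rho>" "top_inaccessible \<rho> \<kappa>" "fv \<chi> \<subseteq> {1}"
    and \<chi>: "\<And>\<mu> \<nu> s. inaccessible \<mu> \<Longrightarrow> top_inaccessible \<mu> \<nu> \<Longrightarrow>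
      sat (Vset \<mu>) (s(1 := set_of (Vset \<nu>))) \<chi> \<longleftrightarrow> \<nu> = \<kappa>"
  shows "fo_sententially_categorical \<rho>"
proof -
  have "Vset \<mu> \<Turnstile> TopF \<chi> \<longleftrightarrow> top_inaccessible \<mu> \<kappa>" if "inaccessible \<mu>" for \<mu>
    unfolding models_def sat_TopF[OF inaccessible_Ord[OF that]] using \<chi>[OF that] by blast
  then have "Vset \<mu> \<Turnstile> TopF \<chi> \<longleftrightarrow> \<mu> = \<rho>" if "inaccessible \<mu>" for \<mu>
    using that assms(1,2) top_inaccessible_unique by blast
  then show ?thesis
    unfolding fo_sententially_categorical_def using assms(1) sentence_TopF[OF assms(3)] by blast
qed

lemma top_inaccessible_le: "inaccessible \<rho> \<Longrightarrow> top_inaccessible \<rho> \<kappa> \<Longrightarrow> \<kappa> \<preceq> \<rho>"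
  unfolding top_inaccessible_def using Ord_mem_imp_le[OF inaccessible_Ord] by blast

lemma top_inaccessible_Vset_mem:
  "Ord \<gamma> \<Longrightarrow> top_inaccessible \<gamma> \<kappa> \<Longrightarrow> set_of (Vset \<kappa>) \<in> Vset \<gamma>"
  unfolding top_inaccessible_def using Vset_mem_Vset_iff inaccessible_Ord by blast

section \<open>Comparing the orders\<close>

lemma fo_imp_so_sententially_categorical:
  "fo_sententially_categorical \<kappa> \<Longrightarrow> so_sententially_categorical \<kappa>"
  unfolding fo_sententially_categorical_def so_sententially_categorical_def
  using so_sentence_embed so_models_embed by blast

lemma so_categorical_below_fo_categorical:
  fixes \<kappa> :: "'v::zfc"
  assumes no_largest: "\<not> (\<exists>\<kappa>::'v. inaccessible \<kappa> \<and> (\<forall>\<mu>. inaccessible \<mu> \<longrightarrow> \<mu> \<preceq> \<kappa>))"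
    and "so_sententially_categorical \<kappa>"
  shows "\<exists>\<rho>. fo_sententially_categorical \<rho> \<and> \<kappa> \<preceq> \<rho>"
proof -
  obtain \<sigma> where \<sigma>: "so_sentence \<sigma>" "inaccessible \<kappa>" "Vset \<kappa> \<Turnstile>\<^sub>2 \<sigma>"
    "\<And>\<mu>. inaccessible \<mu> \<Longrightarrow> \<mu> \<noteq> \<kappa> \<Longrightarrow> \<not> Vset \<mu> \<Turnstile>\<^sub>2 \<sigma>"
    using assms(2) unfolding so_sententially_categorical_def by blast
  obtain \<rho> where \<rho>: "inaccessible \<rho>" "top_inaccessible \<rho> \<kappa>"
    using ex_top_inaccessible[OF no_largest \<sigma>(2)] by blast
  have "fo_sententially_categorical \<rho>"
  proof (rule fo_sententially_categorical_next[OF \<rho>])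
    show "fv (rel 1 \<sigma>) \<subseteq> {1}"
      using fv_rel[OF _ \<sigma>(1)] by simp
    fix \<mu> \<nu> :: 'v and s :: "nat \<Rightarrow> 'v" assume \<mu>: "inaccessible \<mu>" "top_inaccessible \<mu> \<nu>"
    have "sat (Vset \<mu>) (s(1 := set_of (Vset \<nu>))) (rel 1 \<sigma>) \<longleftrightarrow> Vset \<nu> \<Turnstile>\<^sub>2 \<sigma>"
      using sat_rel_sentence[OF supertransitive_Vset[OF inaccessible_Ord[OF \<mu>(1)]], of "s(1 := set_of (Vset \<nu>))" 1, OF _ _ \<sigma>(1)]
        top_inaccessible_Vset_mem[OF inaccessible_Ord[OF \<mu>(1)] \<mu>(2)] by (simp add: elts_set_of_Vset)
    moreover have "inaccessible \<nu>"
      using \<mu>(2) by (simp add: top_inaccessible_def)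
    ultimately show "sat (Vset \<mu>) (s(1 := set_of (Vset \<nu>))) (rel 1 \<sigma>) \<longleftrightarrow> \<nu> = \<kappa>"
      using \<sigma>(3,4) by blast
  qed
  then show ?thesis
    using top_inaccessible_le[OF \<rho>] by blast
qed

section \<open>Ordinal addition and the levels above an inaccessible\<close>

lemma Vset_ord_add: "Vset (\<kappa> \<oplus> \<beta>) = Vset \<kappa> \<union> (\<Union>\<gamma>\<in>elts \<beta>. {x. elts x \<subseteq> Vset (\<kappa> \<oplus> \<gamma>)})"
  by (subst Vset.simps) (auto simp: elts_ord_add Vset.simps[of \<kappa>])

lemma Ord_ord_add:
  assumes "Ord \<kappa>"
  shows "Ord \<alpha> \<Longrightarrow> Ord (\<kappa> \<oplus> \<alpha>)"
proof (induction \<alpha> rule: mem_induct)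
  case (step \<alpha>)
  show ?case
  proof (rule Ord_transitive_subset)
    fix \<beta> assume "\<beta> \<in> elts (\<kappa> \<oplus> \<alpha>)"
    then show "Ord \<beta>"
      using step.IH Ord_mem[OF step.prems] Ord_mem[OF assms] by (auto simp: elts_ord_add)
  next
    have "\<kappa> \<oplus> \<gamma> \<in> (\<oplus>) \<kappa> ` elts \<alpha>" if "\<gamma> \<in> elts \<beta>" "\<beta> \<in> elts \<alpha>" for \<beta> \<gamma>
      using Ord_trans[OF step.prems that] by blast
    moreover have "elts \<beta> \<subseteq> elts \<kappa>" if "\<beta> \<in> elts \<kappa>" for \<beta>
      using Ord_mem_imp_le[OF assms that] .
    ultimately show "transitive (\<kappa> \<oplus> \<alpha>)"
      unfolding transitive_def by (auto simp: elts_ord_add)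
  qed
qed

lemma universe_ord_add_mem:
  assumes D: "universe D" and "\<kappa> \<in> D"
  shows "\<alpha> \<in> D \<Longrightarrow> \<kappa> \<oplus> \<alpha> \<in> D"
proof (induction \<alpha> rule: mem_induct)
  case (step \<alpha>)
  then obtain z where "z \<in> D" "elts z = (\<oplus>) \<kappa> ` elts \<alpha>"
    using universe_image[OF D step.prems, of "(\<oplus>) \<kappa>"] universe_trans[OF D step.prems] by blast
  then obtain w where "w \<in> D" "elts w = elts \<kappa> \<union> (\<oplus>) \<kappa> ` elts \<alpha>"
    using universe_Un[OF D assms(2)] by metis
  then show ?case
    by (metis elts_ord_add elts_eq_iff)
qed

text \<open>An inaccessible \<mu> above \<kappa> has \<alpha> in its level by absolute definability,
  so it is closed under computing \<kappa> \<oplus> \<alpha> and lies above that sum.\<close>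

lemma top_inaccessible_ord_add:
  assumes "inaccessible \<kappa>" "absolutely_definable \<alpha>" "elts \<alpha> \<noteq> {}"
  shows "top_inaccessible (\<kappa> \<oplus> \<alpha>) \<kappa>"
  unfolding top_inaccessible_def
proof (intro conjI allI impI)
  note ord = inaccessible_Ord[OF assms(1)]
  have ord\<alpha>: "Ord \<alpha>"
    using assms(2) by (simp add: absolutely_definable_def)
  show "inaccessible \<kappa>"
    by fact
  \<comment> \<open>The \<in>-minimal element of \<alpha> is zero; it exhibits \<kappa> as \<kappa>
    \<oplus> 0 in the sum.\<close>
  obtain z where z: "z \<in> elts \<alpha>" "\<And>y. y \<in> elts z \<Longrightarrow> y \<notin> elts \<alpha>"
    using assms(3) mem_minimal[of _ "elts \<alpha>"] by blast
  then have "elts z = {}"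
    using Ord_trans[OF ord\<alpha>] by blast
  then have "\<kappa> \<oplus> z = \<kappa>"
    using elts_ord_add[of \<kappa> z] by (simp add: elts_eq_iff)
  then show "\<kappa> \<in> elts (\<kappa> \<oplus> \<alpha>)"
    using z(1) unfolding elts_ord_add by force
  fix \<mu> assume \<mu>: "inaccessible \<mu> \<and> \<mu> \<in> elts (\<kappa> \<oplus> \<alpha>)"
  show "\<mu> \<preceq> \<kappa>"
  proof (rule ccontr)
    note ord\<mu> = inaccessible_Ord[of \<mu>]
    assume "\<not> \<mu> \<preceq> \<kappa>"
    then have "\<kappa> \<in> Vset \<mu>"
      using Ord_not_le[of \<mu> \<kappa>] ord ord\<mu> \<mu> Ord_mem_Vset_iff[of \<mu> \<kappa>] by blast
    moreover have "\<alpha> \<in> Vset \<mu>"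
      using assms(2) \<mu> unfolding absolutely_definable_def by blast
    ultimately have "\<kappa> \<oplus> \<alpha> \<in> Vset \<mu>"
      using universe_ord_add_mem[OF inaccessible_universe] \<mu> by blast
    then have "\<kappa> \<oplus> \<alpha> \<in> elts \<mu>"
      using Ord_mem_Vset_iff[OF ord\<mu> Ord_ord_add[OF ord ord\<alpha>]] \<mu> by blast
    then show False
      using \<mu> mem_not_sym by blast
  qed
qed

lemma fo_imp_order_sententially_categorical:
  fixes \<kappa> \<alpha> :: "'v::zfc"
  assumes "absolutely_definable \<alpha>" "fo_sententially_categorical \<kappa>"
  shows "order_sententially_categorical \<alpha> \<kappa>"
proof -
  obtain \<sigma> where \<sigma>: "sentence \<sigma>" "inaccessible \<kappa>" "Vset \<kappa> \<Turnstile> \<sigma>"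
    "\<And>\<mu>. inaccessible \<mu> \<Longrightarrow> \<mu> \<noteq> \<kappa> \<Longrightarrow> \<not> Vset \<mu> \<Turnstile> \<sigma>"
    using assms(2) unfolding fo_sententially_categorical_def by blast
  show ?thesis
  proof (cases "elts \<alpha> = {}")
    \<comment> \<open>For \<alpha> = 0 the level \<open>Vset \<kappa>\<close> is not an element of
      itself, so \<open>TopF\<close> could not name it; but here both notions of categoricity
      coincide.\<close>
    case True
    then have "\<mu> \<oplus> \<alpha> = \<mu>" for \<mu>
      using elts_ord_add[of \<mu> \<alpha>] by (simp add: elts_eq_iff)
    then show ?thesis
      using assms(2) by (simp add: order_sententially_categorical_def fo_sententially_categorical_def)
  next
    case False
    let ?\<chi> = "rel 1 (so_embed \<sigma>)"
    have so: "so_sentence (so_embed \<sigma>)"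
      by (rule so_sentence_embed[OF \<sigma>(1)])
    have "Vset (\<mu> \<oplus> \<alpha>) \<Turnstile> TopF ?\<chi> \<longleftrightarrow> Vset \<mu> \<Turnstile> \<sigma>" if "inaccessible \<mu>" for \<mu>
    proof -
      have ord: "Ord (\<mu> \<oplus> \<alpha>)"
        using Ord_ord_add[OF inaccessible_Ord[OF that]] assms(1) by (simp add: absolutely_definable_def)
      have top: "top_inaccessible (\<mu> \<oplus> \<alpha>) \<mu>"
        by (rule top_inaccessible_ord_add[OF that assms(1) False])
      have "\<nu> = \<mu>" if "top_inaccessible (\<mu> \<oplus> \<alpha>) \<nu>" for \<nu>
        using that top elts_eq_iff[of \<nu> \<mu>] unfolding top_inaccessible_def by blast
      then have "Vset (\<mu> \<oplus> \<alpha>) \<Turnstile> TopF ?\<chi> \<longleftrightarrow> (\<forall>s. sat (Vset (\<mu> \<oplus> \<alpha>)) (s(1 := set_of (Vset \<mu>))) ?\<chi>)"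
        unfolding models_def sat_TopF[OF ord] using top by blast
      also have "\<dots> \<longleftrightarrow> Vset \<mu> \<Turnstile> \<sigma>"
        using sat_rel_sentence[OF supertransitive_Vset[OF ord], of "s(1 := set_of (Vset \<mu>))" 1 for s, OF _ _ so]
          top_inaccessible_Vset_mem[OF ord top] by (simp add: elts_set_of_Vset so_models_embed)
      finally show ?thesis .
    qed
    then show ?thesis
      unfolding order_sententially_categorical_def
      using \<sigma> sentence_TopF[of ?\<chi>] fv_rel[OF _ so, of 1] by (intro exI[of _ "TopF ?\<chi>"]) simp
  qed
qed

text \<open>
  With variable 1 for \<open>V\<^sub>\<kappa>\<close>, this says that variable 3 is \<open>V\<^sub>\<kappa>\<^sub>+\<^sub>\<beta>\<close> for the
  value \<open>\<beta>\<close> of variable 0; variable 5 is (the graph of) the recursion that computes it.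
\<close>

definition LevelF :: fm
  where "LevelF = Exists 5 (Conj (PairInF 5 0 3) (Forall 6 (Forall 7 (Imp (PairInF 5 6 7)
    (Conj (BAll 8 6 (Exists 9 (PairInF 5 8 9)))
      (Forall 10 (Iff (Mem 10 7)
        (Disj (Mem 10 1) (BEx 8 6 (Exists 9 (Conj (PairInF 5 8 9) (SubF 10 9))))))))))))"

lemma fv_LevelF: "fv LevelF = {0, 1, 3}"
  by (auto simp: LevelF_def fv_PairInF fv_SubF)

text \<open>Any \<open>g\<close> obeying the recursion has the true levels as values, by
  \<in>-induction. Conversely a universe can form all levels up to \<open>s 0\<close> and the graph
  of the map, so the existential quantifier has a witness in \<open>D\<close>.\<close>

lemma sat_LevelF:
  assumes U: "universe D" and D: "supertransitive D" and s: "s 0 \<in> D" "s 1 \<in> D" "s 3 \<in> D"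
    and "transitive (s 0)" and \<kappa>: "elts (s 1) = Vset \<kappa>"
  shows "sat D s LevelF \<longleftrightarrow> elts (s 3) = Vset (\<kappa> \<oplus> s 0)"
proof -
  have pair: "sat D t (PairInF g x y) \<longleftrightarrow> kpair (t x) (t y) \<in> elts (t g)"
    if "t g \<in> D" "t x \<in> D" "t y \<in> D" "g < 16" "x < 16" "y < 16" for t g x y
    using that D sat_PairInF[of g x y t]
    by (subst Delta0_absolute[of _ D UNIV]) (auto simp: Delta0_PairInF fv_PairInF supertransitive_def)
  have sub: "sat D t (SubF x y) \<longleftrightarrow> elts (t x) \<subseteq> elts (t y)"
    if "t x \<in> D" "t y \<in> D" "x < 17" "y < 17" for t x y
    using that D sat_SubF[of x y t]
    by (subst Delta0_absolute[of _ D UNIV]) (auto simp: Delta0_SubF fv_SubF supertransitive_def)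
  define rec where "rec g \<longleftrightarrow> (\<forall>b\<in>D. \<forall>y\<in>D. kpair b y \<in> elts g \<longrightarrow>
      (\<forall>c\<in>D. c \<in> elts b \<longrightarrow> (\<exists>y'\<in>D. kpair c y' \<in> elts g)) \<and>
      (\<forall>z\<in>D. z \<in> elts y \<longleftrightarrow> z \<in> Vset \<kappa> \<or>
        (\<exists>c\<in>D. c \<in> elts b \<and> (\<exists>y'\<in>D. kpair c y' \<in> elts g \<and> elts z \<subseteq> elts y'))))" for g
  have rec_iff: "sat D s LevelF \<longleftrightarrow> (\<exists>g\<in>D. kpair (s 0) (s 3) \<in> elts g \<and> rec g)"
    unfolding LevelF_def rec_def using s \<kappa> by (simp add: pair sub sat_bounded cong: bex_cong ball_cong)
  have tr: "y \<in> D" if "x \<in> D" "y \<in> elts x" for x y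
    using D that unfolding supertransitive_def by blast
  have subD: "y \<in> D" if "x \<in> D" "elts y \<subseteq> elts x" for x y
    using D that unfolding supertransitive_def by blast
  have pairD: "b \<in> D \<and> y \<in> D" if "g \<in> D" "kpair b y \<in> elts g" for g b y
  proof -
    have "kpair b y \<in> D"
      using tr that by blast
    then have "upair b y \<in> D"
      using tr by (simp add: kpair_def elts_upair)
    then show ?thesis
      using tr by (simp add: elts_upair)
  qed
  show ?thesis
  proof
    assume "sat D s LevelF"
    then obtain g where g: "g \<in> D" "kpair (s 0) (s 3) \<in> elts g" "rec g"
      using rec_iff by blast
    \<comment> \<open>No functionality of \<open>g\<close> is asked for: the induction shows that
      every \<open>y\<close> paired with \<open>b\<close> is the level in question.\<close>
    have "elts y = Vset (\<kappa> \<oplus> b)" if "kpair b y \<in> elts g" for b y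
      using that
    proof (induction b arbitrary: y rule: mem_induct)
      case (step b)
      have bD: "b \<in> D" "y \<in> D"
        using pairD[OF g(1) step.prems] by auto
      have IH: "elts y' = Vset (\<kappa> \<oplus> c)" if "c \<in> elts b" "kpair c y' \<in> elts g" for c y'
        using step.IH that by blast
      have ex: "\<exists>y'\<in>D. kpair c y' \<in> elts g" if "c \<in> elts b" for c
        using g(3) bD step.prems that tr[OF bD(1) that] unfolding rec_def by blast
      have mem: "z \<in> elts y \<longleftrightarrow> z \<in> Vset \<kappa> \<or>
        (\<exists>c\<in>D. c \<in> elts b \<and> (\<exists>y'\<in>D. kpair c y' \<in> elts g \<and> elts z \<subseteq> elts y'))" if "z \<in> D" for z
        using g(3) bD step.prems that unfolding rec_def by blast
      show ?case
      proof (intro equalityI subsetI)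
        fix z assume z: "z \<in> elts y"
        then have "z \<in> D"
          using tr bD(2) by blast
        from mem[OF this] z consider "z \<in> Vset \<kappa>"
          | c y' where "c \<in> elts b" "kpair c y' \<in> elts g" "elts z \<subseteq> elts y'"
          by blast
        then show "z \<in> Vset (\<kappa> \<oplus> b)"
        proof cases
          case 1
          then show ?thesis
            unfolding Vset_ord_add[of \<kappa> b] by blast
        next
          case 2
          then show ?thesis
            using IH[OF 2(1,2)] unfolding Vset_ord_add[of \<kappa> b] by blast
        qed
      next
        fix z assume "z \<in> Vset (\<kappa> \<oplus> b)"
        then consider "z \<in> Vset \<kappa>" | c where "c \<in> elts b" "elts z \<subseteq> Vset (\<kappa> \<oplus> c)"
          unfolding Vset_ord_add[of \<kappa> b] by blast
        then show "z \<in> elts y"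
        proof cases
          case 1
          then have "z \<in> D"
            using tr[OF s(2)] \<kappa> by blast
          then show ?thesis
            using mem 1 by blast
        next
          case 2
          obtain y' where y': "y' \<in> D" "kpair c y' \<in> elts g"
            using ex[OF 2(1)] by blast
          then have "elts z \<subseteq> elts y'"
            using IH[OF 2(1)] 2(2) by blast
          then show ?thesis
            using mem[OF subD[OF y'(1)]] y' 2(1) tr[OF bD(1) 2(1)] by blast
        qed
      qed
    qed
    then show "elts (s 3) = Vset (\<kappa> \<oplus> s 0)"
      using g(2) by blast
  next
    assume s3: "elts (s 3) = Vset (\<kappa> \<oplus> s 0)"
    let ?V = "\<lambda>b. set_of (Vset (\<kappa> \<oplus> b))"
    have V: "?V b \<in> D" if "b \<in> D" for b
      using that
    proof (induction b rule: mem_induct)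
      case (step b)
      have "\<exists>z\<in>D. elts z = {x. elts x \<subseteq> Vset (\<kappa> \<oplus> c)}" if "c \<in> elts b" for c
        using universe_powerset[OF U step.IH[OF that tr[OF step.prems that]]] by (simp add: elts_set_of_Vset)
      then obtain z where "z \<in> D" "elts z = (\<Union>c\<in>elts b. {x. elts x \<subseteq> Vset (\<kappa> \<oplus> c)})"
        using universe_UN[OF U step.prems, of "\<lambda>c. {x. elts x \<subseteq> Vset (\<kappa> \<oplus> c)}"] by blast
      then obtain w where "w \<in> D" "elts w = Vset (\<kappa> \<oplus> b)"
        using universe_Un[OF U s(2)] \<kappa> Vset_ord_add[of \<kappa> b] by metis
      then show ?case
        by (metis elts_set_of_Vset elts_eq_iff)
    qed
    \<comment> \<open>The graph must be defined at \<open>s 0\<close> itself and on all elements of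
      its arguments; the successor of a transitive set is such a domain.\<close>
    define T where "T = osucc (s 0)"
    have T: "T \<in> D" "s 0 \<in> elts T" "\<And>x. x \<in> elts T \<Longrightarrow> elts x \<subseteq> elts T"
      using universe_osucc[OF U s(1)] \<open>transitive (s 0)\<close>
      by (auto simp: T_def elts_osucc transitive_def)
    obtain g where g: "g \<in> D" "elts g = (\<lambda>b. kpair b (?V b)) ` elts T"
      using universe_image[OF U T(1), of "\<lambda>b. kpair b (?V b)"] universe_kpair[OF U] V tr[OF T(1)] by blast
    have in_g: "kpair b y \<in> elts g \<longleftrightarrow> b \<in> elts T \<and> y = ?V b" for b y
      using g(2) by (auto simp: kpair_eq_iff)
    have "rec g"
      unfolding rec_def
    proof (intro ballI impI conjI)
      fix b y assume b: "kpair b y \<in> elts g"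
      then have bT: "b \<in> elts T" "y = ?V b"
        using in_g by auto
      show "\<exists>y'\<in>D. kpair c y' \<in> elts g" if "c \<in> D" "c \<in> elts b" for c
        using that in_g V T(3)[OF bT(1)] by blast
      fix z
      have "(\<exists>c\<in>D. c \<in> elts b \<and> (\<exists>y'\<in>D. kpair c y' \<in> elts g \<and> elts z \<subseteq> elts y')) \<longleftrightarrow>
        (\<exists>c\<in>elts b. elts z \<subseteq> Vset (\<kappa> \<oplus> c))"
        using in_g V T(3)[OF bT(1)] tr[OF tr[OF T(1) bT(1)]] by (auto simp: elts_set_of_Vset)
      moreover have "elts y = Vset \<kappa> \<union> (\<Union>c\<in>elts b. {x. elts x \<subseteq> Vset (\<kappa> \<oplus> c)})"
        unfolding bT(2) elts_set_of_Vset by (rule Vset_ord_add)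
      ultimately show "z \<in> elts y \<longleftrightarrow> z \<in> Vset \<kappa> \<or>
        (\<exists>c\<in>D. c \<in> elts b \<and> (\<exists>y'\<in>D. kpair c y' \<in> elts g \<and> elts z \<subseteq> elts y'))"
        by simp
    qed
    moreover have "s 3 = ?V (s 0)"
      using s3 by (metis elts_set_of_Vset elts_eq_iff)
    ultimately show "sat D s LevelF"
      using rec_iff g(1) in_g T(2) by blast
  qed
qed

text \<open>Inside an inaccessible level with largest inaccessible \<nu>, the formula \<psi>
  recovers \<alpha>, \<open>LevelF\<close> recovers \<open>Vset (\<nu> \<oplus> \<alpha>)\<close>,
  and relativization evaluates \<sigma> there. Variables 0, 1 and 3 hold \<alpha>,
  \<open>Vset \<nu>\<close> and the upper level.\<close>

lemma order_categorical_below_fo_categorical: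
  fixes \<kappa> \<alpha> :: "'v::zfc"
  assumes no_largest: "\<not> (\<exists>\<kappa>::'v. inaccessible \<kappa> \<and> (\<forall>\<mu>. inaccessible \<mu> \<longrightarrow> \<mu> \<preceq> \<kappa>))"
    and \<alpha>: "absolutely_definable \<alpha>" and "order_sententially_categorical \<alpha> \<kappa>"
  shows "\<exists>\<rho>. fo_sententially_categorical \<rho> \<and> \<kappa> \<preceq> \<rho>"
proof -
  obtain \<sigma> where \<sigma>: "sentence \<sigma>" "inaccessible \<kappa>" "Vset (\<kappa> \<oplus> \<alpha>) \<Turnstile> \<sigma>"
    "\<And>\<mu>. inaccessible \<mu> \<Longrightarrow> \<mu> \<noteq> \<kappa> \<Longrightarrow> \<not> Vset (\<mu> \<oplus> \<alpha>) \<Turnstile> \<sigma>"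
    using assms(3) unfolding order_sententially_categorical_def by blast
  obtain \<psi> where \<psi>: "fv \<psi> \<subseteq> {0}" "\<And>\<kappa>. inaccessible \<kappa> \<Longrightarrow> \<alpha> \<in> Vset \<kappa>"
    "\<And>\<kappa> x. inaccessible \<kappa> \<Longrightarrow> x \<in> Vset \<kappa> \<Longrightarrow> sat (Vset \<kappa>) (\<lambda>_. x) \<psi> \<longleftrightarrow> x = \<alpha>"
    using \<alpha> unfolding absolutely_definable_def by blast
  have so: "so_sentence (so_embed \<sigma>)"
    by (rule so_sentence_embed[OF \<sigma>(1)])
  have "transitive \<alpha>"
    using \<alpha> by (simp add: absolutely_definable_def Ord_def)
  obtain \<rho> where \<rho>: "inaccessible \<rho>" "top_inaccessible \<rho> \<kappa>"
    using ex_top_inaccessible[OF no_largest \<sigma>(2)] by blast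
  let ?\<chi> = "Exists 0 (Conj \<psi> (Exists 3 (Conj LevelF (rel 3 (so_embed \<sigma>)))))"
  have "fo_sententially_categorical \<rho>"
  proof (rule fo_sententially_categorical_next[OF \<rho>])
    show "fv ?\<chi> \<subseteq> {1}"
      using fv_rel[OF _ so, of 3] \<psi>(1) by (auto simp: fv_LevelF)
    fix \<mu> \<nu> :: 'v and s :: "nat \<Rightarrow> 'v" assume \<mu>: "inaccessible \<mu>" "top_inaccessible \<mu> \<nu>"
    let ?D = "Vset \<mu>" and ?s = "s(1 := set_of (Vset \<nu>))"
    have D: "supertransitive ?D"
      by (rule supertransitive_Vset[OF inaccessible_Ord[OF \<mu>(1)]])
    have U: "universe ?D"
      by (rule inaccessible_universe[OF \<mu>(1)])
    have \<nu>: "set_of (Vset \<nu>) \<in> ?D"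
      by (rule top_inaccessible_Vset_mem[OF inaccessible_Ord[OF \<mu>(1)] \<mu>(2)])
    have inacc: "inaccessible \<nu>" and "\<nu> \<in> elts \<mu>"
      using \<mu>(2) by (simp_all add: top_inaccessible_def)
    have "sat ?D (?s(0 := x)) \<psi> \<longleftrightarrow> x = \<alpha>" if "x \<in> ?D" for x
    proof -
      have "sat ?D (?s(0 := x)) \<psi> \<longleftrightarrow> sat ?D (\<lambda>_. x) \<psi>"
        using \<psi>(1) by (intro sat_cong) auto
      then show ?thesis
        using \<psi>(3)[OF \<mu>(1) that] by blast
    qed
    then have "sat ?D ?s ?\<chi> \<longleftrightarrow> (\<exists>w\<in>?D. sat ?D (?s(0 := \<alpha>, 3 := w)) LevelF \<and>
      sat ?D (?s(0 := \<alpha>, 3 := w)) (rel 3 (so_embed \<sigma>)))"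
      using \<psi>(2)[OF \<mu>(1)] by (auto simp del: fun_upd_apply)
    also have "\<dots> \<longleftrightarrow> (\<exists>w\<in>?D. elts w = Vset (\<nu> \<oplus> \<alpha>) \<and> elts w \<Turnstile> \<sigma>)"
    proof (rule bex_cong[OF refl])
      fix w assume w: "w \<in> ?D"
      let ?t = "?s(0 := \<alpha>, 3 := w)"
      have "sat ?D ?t LevelF \<longleftrightarrow> elts (?t 3) = Vset (\<nu> \<oplus> ?t 0)"
        using w \<nu> \<psi>(2)[OF \<mu>(1)] \<open>transitive \<alpha>\<close> by (intro sat_LevelF[OF U D]) (simp_all add: elts_set_of_Vset)
      moreover have "sat ?D ?t (rel 3 (so_embed \<sigma>)) \<longleftrightarrow> elts (?t 3) \<Turnstile> \<sigma>"
        using sat_rel_sentence[OF D, of ?t 3, OF _ _ so] w by (simp add: so_models_embed)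
      ultimately show "sat ?D ?t LevelF \<and> sat ?D ?t (rel 3 (so_embed \<sigma>)) \<longleftrightarrow>
        elts w = Vset (\<nu> \<oplus> \<alpha>) \<and> elts w \<Turnstile> \<sigma>"
        by simp
    qed
    also have "\<dots> \<longleftrightarrow> Vset (\<nu> \<oplus> \<alpha>) \<Turnstile> \<sigma>"
    proof -
      have ord: "Ord \<nu>" "Ord (\<nu> \<oplus> \<alpha>)" "Ord \<mu>"
        using inaccessible_Ord[OF inacc] inaccessible_Ord[OF \<mu>(1)] Ord_ord_add[of \<nu> \<alpha>] \<alpha>
        by (simp_all add: absolutely_definable_def)
      \<comment> \<open>Needed for the quantifier over \<open>w\<close> to have a witness: the level
        at \<nu> \<oplus> \<alpha> must be an element of \<open>Vset \<mu>\<close>.\<close>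
      have "\<nu> \<oplus> \<alpha> \<in> ?D"
        using Ord_mem_Vset_iff[OF ord(3,1)] \<open>\<nu> \<in> elts \<mu>\<close> \<psi>(2)[OF \<mu>(1)]
        by (intro universe_ord_add_mem[OF U]) simp_all
      then have "set_of (Vset (\<nu> \<oplus> \<alpha>)) \<in> ?D"
        using Ord_mem_Vset_iff[OF ord(3,2)] Vset_mem_Vset_iff[OF ord(3,2)] by blast
      then show ?thesis
        using elts_set_of_Vset[of "\<nu> \<oplus> \<alpha>"] by metis
    qed
    also have "\<dots> \<longleftrightarrow> \<nu> = \<kappa>"
      using \<sigma>(3,4) inacc by blast
    finally show "sat ?D ?s ?\<chi> \<longleftrightarrow> \<nu> = \<kappa>" .
  qed
  then show ?thesis
    using top_inaccessible_le[OF \<rho>] by blast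
qed

section \<open>Correctness\<close>

lemma fo_categorical_below_Sigma2_correct:
  fixes \<kappa> \<delta> :: "'v::zfc"
  assumes "lightface_Sigma2_correct \<delta>" "fo_sententially_categorical \<kappa>"
  shows "\<kappa> \<preceq> \<delta>"
proof -
  obtain \<sigma> where \<sigma>: "sentence \<sigma>" "inaccessible \<kappa>" "Vset \<kappa> \<Turnstile> \<sigma>"
    "\<And>\<mu>. inaccessible \<mu> \<Longrightarrow> \<mu> \<noteq> \<kappa> \<Longrightarrow> \<not> Vset \<mu> \<Turnstile> \<sigma>"
    using assms(2) unfolding fo_sententially_categorical_def by blast
  have so: "so_sentence (so_embed \<sigma>)"
    by (rule so_sentence_embed[OF \<sigma>(1)])
  have ord: "Ord \<delta>"
    using assms(1) by (simp add: lightface_Sigma2_correct_def)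
  \<comment> \<open>The quantifier over \<open>F\<close> is pulled in front of the conjunction to
    make the sentence syntactically Sigma_2. Variable 4 is not free in the relativized part, and
    \<open>D\<close> is nonempty once it contains \<open>v\<close>, so the meaning is
    unchanged.\<close>
  let ?\<phi> = "Conj (universe_matrix 1) (rel 1 (so_embed \<sigma>))"
  let ?\<tau> = "Exists 1 (Forall 4 ?\<phi>)"
  have "Delta0 ?\<phi>"
    by (intro Delta0.intros Delta0_universe_matrix Delta0_rel_embed) simp_all
  then have "Pi_fm (Suc 0) (Forall 4 ?\<phi>)"
    by (intro Sigma_fm_Pi_fm.intros)
  then have Sigma2: "Sigma_fm 2 ?\<tau>"
    unfolding numeral_2_eq_2 by (rule Sigma_fm_Pi_fm.intros(5)[OF Sigma_fm_Pi_fm.intros(3)])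
  have sent: "sentence ?\<tau>"
    using fv_rel[OF _ so, of 1] by (auto simp: sentence_def fv_universe_matrix)
  have meaning: "D \<Turnstile> ?\<tau> \<longleftrightarrow> (\<exists>v\<in>D. universe (elts v) \<and> elts v \<Turnstile> \<sigma>)" if D: "supertransitive D" for D :: "'v set"
  proof -
    have "sat D (s(1 := v)) (Forall 4 ?\<phi>) \<longleftrightarrow> universe (elts v) \<and> elts v \<Turnstile> \<sigma>" if v: "v \<in> D" for s v
    proof -
      have "sat D (s(1 := v)) (Forall 4 ?\<phi>) \<longleftrightarrow>
        sat D (s(1 := v)) (universeF 1) \<and> (\<forall>F\<in>D. sat D (s(1 := v, 4 := F)) (rel 1 (so_embed \<sigma>)))"
        unfolding universeF_def by auto
      also have "\<dots> \<longleftrightarrow> universe (elts v) \<and> elts v \<Turnstile> \<sigma>"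
        using sat_universeF[OF D, of "s(1 := v)" 1] sat_rel_sentence[OF D, of "s(1 := v, 4 := F)" 1 for F, OF _ _ so] v
        by (auto simp: so_models_embed)
      finally show ?thesis .
    qed
    then show ?thesis
      unfolding models_def sat.simps(5)[of _ _ 1] by (simp del: sat.simps)
  qed
  have "set_of (Vset \<kappa>) \<in> UNIV" "universe (elts (set_of (Vset \<kappa>)))" "elts (set_of (Vset \<kappa>)) \<Turnstile> \<sigma>"
    using inaccessible_universe[OF \<sigma>(2)] \<sigma>(3) by (simp_all add: elts_set_of_Vset)
  then have "(UNIV :: 'v set) \<Turnstile> ?\<tau>"
    using meaning[OF supertransitive_UNIV] by blast
  then have "Vset \<delta> \<Turnstile> ?\<tau>"
    using assms(1) sent Sigma2 unfolding lightface_Sigma2_correct_def by blast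
  then obtain v where v: "v \<in> Vset \<delta>" "universe (elts v)" "elts v \<Turnstile> \<sigma>"
    using meaning[OF supertransitive_Vset[OF ord]] by blast
  then obtain \<mu> where \<mu>: "inaccessible \<mu>" "\<mu> \<in> elts \<delta>" "v = set_of (Vset \<mu>)"
    using universe_mem_Vset_iff[OF ord, of v] by blast
  then have "\<mu> = \<kappa>"
    using \<sigma>(4)[OF \<mu>(1)] v(3) by (auto simp: elts_set_of_Vset)
  then show ?thesis
    using \<mu>(2) Ord_mem_imp_le[OF ord] by blast
qed

lemma least_inaccessible_model_fo_categorical:
  fixes \<rho> :: "'v::zfc"
  assumes "sentence \<sigma>" "inaccessible \<rho>" "Vset \<rho> \<Turnstile> \<sigma>"
  obtains \<kappa> :: 'v where "fo_sententially_categorical \<kappa>" "Vset \<kappa> \<Turnstile> \<sigma>"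
proof -
  have so: "so_sentence (so_embed \<sigma>)"
    by (rule so_sentence_embed[OF assms(1)])
  have "\<rho> \<in> {\<kappa>. inaccessible \<kappa> \<and> Vset \<kappa> \<Turnstile> \<sigma>}"
    using assms(2,3) by simp
  then obtain \<kappa> :: 'v where \<kappa>: "\<kappa> \<in> {\<kappa>. inaccessible \<kappa> \<and> Vset \<kappa> \<Turnstile> \<sigma>}"
    "\<And>\<mu>. \<mu> \<in> elts \<kappa> \<Longrightarrow> \<mu> \<notin> {\<kappa>. inaccessible \<kappa> \<and> Vset \<kappa> \<Turnstile> \<sigma>}"
    by (rule mem_minimal) blast
  \<comment> \<open>Leastness can be stated inside the level, since its universes are exactly the
    smaller inaccessible levels.\<close>
  let ?\<tau> = "Conj \<sigma> (Neg (Exists 1 (Conj (universeF 1) (rel 1 (so_embed \<sigma>)))))"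
  have sent: "sentence ?\<tau>"
    using fv_rel[OF _ so, of 1] assms(1) by (auto simp: sentence_def fv_universeF)
  have meaning: "Vset \<mu> \<Turnstile> ?\<tau> \<longleftrightarrow> Vset \<mu> \<Turnstile> \<sigma> \<and> \<not> (\<exists>\<nu>\<in>elts \<mu>. inaccessible \<nu> \<and> Vset \<nu> \<Turnstile> \<sigma>)"
    if \<mu>: "inaccessible \<mu>" for \<mu> :: 'v
  proof -
    note D = supertransitive_Vset[OF inaccessible_Ord[OF \<mu>]]
    have "sat (Vset \<mu>) s (Exists 1 (Conj (universeF 1) (rel 1 (so_embed \<sigma>)))) \<longleftrightarrow>
      (\<exists>v. (v \<in> Vset \<mu> \<and> universe (elts v)) \<and> elts v \<Turnstile> \<sigma>)" for s
      using sat_universeF[OF D, of "s(1 := v)" 1 for v] sat_rel_sentence[OF D, of "s(1 := v)" 1 for v, OF _ _ so]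
      by (auto simp: so_models_embed)
    also have "\<dots> \<longleftrightarrow> (\<exists>\<nu>\<in>elts \<mu>. inaccessible \<nu> \<and> Vset \<nu> \<Turnstile> \<sigma>)"
      unfolding universe_mem_Vset_iff[OF inaccessible_Ord[OF \<mu>]] using elts_set_of_Vset by metis
    finally show ?thesis
      unfolding models_def by (simp del: sat.simps(5))
  qed
  have "\<not> Vset \<mu> \<Turnstile> ?\<tau>" if \<mu>: "inaccessible \<mu>" "\<mu> \<noteq> \<kappa>" for \<mu> :: 'v
    using meaning[OF \<mu>(1)] \<kappa> \<mu> Ord_linear[OF inaccessible_Ord[OF \<mu>(1)], of \<kappa>] inaccessible_Ord[of \<kappa>] by blast
  moreover have "Vset \<kappa> \<Turnstile> ?\<tau>"
    using meaning[of \<kappa>] \<kappa> by blast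
  ultimately have "fo_sententially_categorical \<kappa>"
    unfolding fo_sententially_categorical_def using sent \<kappa>(1) by blast
  then show thesis
    using that \<kappa>(1) by blast
qed

text \<open>One set \<open>w\<close> collects witnesses for the whole existential block. A level
  containing it has all these witnesses, and the remaining Pi_1 formula passes down from the
  universe.\<close>

lemma Sigma2_reflected_by_inaccessibles:
  fixes s :: "nat \<Rightarrow> 'v::zfc"
  assumes "Sigma_fm 2 \<phi>" "sat UNIV s \<phi>"
  shows "\<exists>w. \<forall>\<kappa>. inaccessible \<kappa> \<longrightarrow> w \<in> Vset \<kappa> \<longrightarrow> (\<forall>i\<in>fv \<phi>. s i \<in> Vset \<kappa>) \<longrightarrow> sat (Vset \<kappa>) s \<phi>"
  using assms
proof (induction arbitrary: s rule: Sigma2_induct)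
  case (Pi1 \<phi>)
  have "sat (Vset \<kappa>) s \<phi>" if \<kappa>: "inaccessible \<kappa>" "\<forall>i\<in>fv \<phi>. s i \<in> Vset \<kappa>" for \<kappa>
    using Vset_trans[OF inaccessible_Ord[OF \<kappa>(1)]] by (intro Pi1_downward[OF Pi1(1) _ _ \<kappa>(2) Pi1(2)]) auto
  then show ?case
    by blast
next
  case (Exists \<phi> i)
  then obtain x where x: "sat UNIV (s(i := x)) \<phi>"
    by auto
  obtain w where w: "\<And>\<kappa>. inaccessible \<kappa> \<Longrightarrow> w \<in> Vset \<kappa> \<Longrightarrow> \<forall>j\<in>fv \<phi>. (s(i := x)) j \<in> Vset \<kappa> \<Longrightarrow>
      sat (Vset \<kappa>) (s(i := x)) \<phi>"
    using Exists.IH[OF x] by blast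
  \<comment> \<open>The pair packs the new witness \<open>x\<close> together with the set
    \<open>w\<close> for the inner formula; transitivity of the level recovers both.\<close>
  have "sat (Vset \<kappa>) s (Exists i \<phi>)"
    if \<kappa>: "inaccessible \<kappa>" "upair x w \<in> Vset \<kappa>" "\<forall>j\<in>fv (Exists i \<phi>). s j \<in> Vset \<kappa>" for \<kappa>
  proof -
    have xw: "x \<in> Vset \<kappa>" "w \<in> Vset \<kappa>"
      using Vset_trans[OF inaccessible_Ord[OF \<kappa>(1)] \<kappa>(2)] by (simp_all add: elts_upair)
    then have "sat (Vset \<kappa>) (s(i := x)) \<phi>"
      using \<kappa>(3) by (intro w[OF \<kappa>(1)]) auto
    then show ?thesis
      using xw(1) by auto
  qed
  then show ?case
    by blast
qed

lemma ex_inaccessible_Vset_mem: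
  fixes w :: "'v::zfc"
  assumes "\<not> small {\<kappa>::'v. inaccessible \<kappa>}"
  obtains \<kappa> :: 'v where "inaccessible \<kappa>" "w \<in> Vset \<kappa>"
proof -
  obtain \<beta> where \<beta>: "Ord \<beta>" "w \<in> Vset \<beta>"
    using ex_mem_Vset by blast
  have "\<not> {\<kappa>. inaccessible \<kappa>} \<subseteq> elts (osucc \<beta>)"
    using assms small_subset[OF small_elts] by blast
  then obtain \<kappa> where \<kappa>: "inaccessible \<kappa>" "\<kappa> \<notin> elts (osucc \<beta>)"
    by blast
  then have "\<not> \<kappa> \<preceq> \<beta>"
    using Ord_le_iff[OF inaccessible_Ord[OF \<kappa>(1)] \<beta>(1)] by (simp add: elts_osucc)
  then have "\<beta> \<preceq> \<kappa>"
    using Ord_not_le[OF inaccessible_Ord[OF \<kappa>(1)] \<beta>(1)] Ord_mem_imp_le[OF inaccessible_Ord[OF \<kappa>(1)]] by blast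
  then show thesis
    using that[OF \<kappa>(1)] Vset_mono \<beta>(2) by blast
qed

text \<open>A true Sigma_2 sentence first appears at a categorical level and is then carried up to
  the supremum. In the other direction, the witnesses at the supremum stay good because every finite
  set of parameters already lies in one categorical level, from which Pi_1 truth goes up.\<close>

lemma sup_fo_categorical_Sigma2_correct:
  fixes \<theta> :: "'v::zfc"
  assumes proper: "\<not> small {\<kappa>::'v. inaccessible \<kappa>}" and sup: "is_ord_sup {\<kappa>. fo_sententially_categorical \<kappa>} \<theta>"
  shows "lightface_Sigma2_correct \<theta>"
  unfolding lightface_Sigma2_correct_def
proof (intro conjI allI impI)
  show ord: "Ord \<theta>"
    using sup by (simp add: is_ord_sup_def)
  have inacc: "inaccessible \<kappa>" if "fo_sententially_categorical \<kappa>" for \<kappa> :: 'v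
    using that unfolding fo_sententially_categorical_def by blast
  have V: "Vset \<theta> = (\<Union>\<kappa>\<in>{\<kappa>. fo_sententially_categorical \<kappa>}. Vset \<kappa>)"
    using Vset_is_ord_sup[OF sup] inaccessible_Ord inacc by blast
  have le: "Vset \<kappa> \<subseteq> Vset \<theta>" if "fo_sententially_categorical \<kappa>" for \<kappa>
    using V that by blast
  fix \<sigma> assume \<sigma>: "sentence \<sigma> \<and> Sigma_fm 2 \<sigma>"
  then have fv: "fv \<sigma> = {}"
    by (simp add: sentence_def)
  have Pi1_down: "sat (Vset \<theta>) s \<phi>" if "Pi_fm (Suc 0) \<phi>" "\<forall>i\<in>fv \<phi>. s i \<in> Vset \<theta>" "sat UNIV s \<phi>" for s \<phi>
    using Vset_trans[OF ord] by (intro Pi1_downward[OF that(1) _ _ that(2,3)]) auto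
  show "Vset \<theta> \<Turnstile> \<sigma> \<longleftrightarrow> (UNIV :: 'v set) \<Turnstile> \<sigma>"
  proof
    assume "(UNIV :: 'v set) \<Turnstile> \<sigma>"
    then have "sat UNIV s \<sigma>" for s :: "nat \<Rightarrow> 'v"
      by (simp add: models_def)
    then obtain w :: 'v where w: "\<And>\<kappa>. inaccessible \<kappa> \<Longrightarrow> w \<in> Vset \<kappa> \<Longrightarrow> sat (Vset \<kappa>) (\<lambda>_. w) \<sigma>"
      using Sigma2_reflected_by_inaccessibles[of \<sigma>] \<sigma> fv sat_cong[of \<sigma>] by (metis empty_iff)
    obtain \<mu> :: 'v where \<mu>: "inaccessible \<mu>" "w \<in> Vset \<mu>"
      using ex_inaccessible_Vset_mem[OF proper] by blast
    have "Vset \<mu> \<Turnstile> \<sigma>"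
      using w[OF \<mu>] models_iff_sat \<sigma> by blast
    then obtain \<kappa> :: 'v where \<kappa>: "fo_sententially_categorical \<kappa>" "Vset \<kappa> \<Turnstile> \<sigma>"
      using least_inaccessible_model_fo_categorical[OF _ \<mu>(1)] \<sigma> by blast
    have "sat (Vset \<theta>) s \<sigma>" for s
    proof (rule Sigma2_upward[OF _ le[OF \<kappa>(1)]])
      show "Sigma_fm 2 \<sigma>" "sat (Vset \<kappa>) s \<sigma>" "\<forall>i\<in>fv \<sigma>. s i \<in> Vset \<kappa>"
        using \<sigma> \<kappa>(2) fv by (simp_all add: models_def)
      \<comment> \<open>There is no direct step from \<open>Vset \<kappa>\<close> to
        \<open>Vset \<theta>\<close>: Pi_1 truth is lifted to the whole universe and then
        restricted.\<close>
      show "sat (Vset \<theta>) t \<phi>"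
        if \<phi>: "Pi_fm (Suc 0) \<phi>" "\<forall>i\<in>fv \<phi>. t i \<in> Vset \<kappa>" "sat (Vset \<kappa>) t \<phi>" for t \<phi>
        using Pi1_down[OF \<phi>(1) _ inaccessible_Pi1_upward[OF inacc[OF \<kappa>(1)] \<phi>]] \<phi>(2) le[OF \<kappa>(1)] by blast
    qed
    then show "Vset \<theta> \<Turnstile> \<sigma>"
      by (simp add: models_def)
  next
    assume sat: "Vset \<theta> \<Turnstile> \<sigma>"
    \<comment> \<open>Without parameters some categorical cardinal is still required; the trivially
      true sentence below provides one, namely the least inaccessible.\<close>
    have chain: "\<exists>\<kappa>. fo_sententially_categorical \<kappa> \<and> (\<forall>i\<in>F. t i \<in> Vset \<kappa>)"
      if "finite F" "\<forall>i\<in>F. t i \<in> Vset \<theta>" for F :: "nat set" and t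
      using that
    proof (induction F)
      case empty
      obtain \<mu> :: 'v where \<mu>: "inaccessible \<mu>"
        using ex_inaccessible_Vset_mem[OF proper] by blast
      have "sentence (Forall 0 (Eq 0 0))" "Vset \<mu> \<Turnstile> Forall 0 (Eq 0 0)"
        by (simp_all add: sentence_def models_def)
      then show ?case
        using least_inaccessible_model_fo_categorical[OF _ \<mu>] by blast
    next
      case (insert i F)
      then obtain \<kappa> where \<kappa>: "fo_sententially_categorical \<kappa>" "\<forall>i\<in>F. t i \<in> Vset \<kappa>"
        by blast
      obtain \<mu> where \<mu>: "fo_sententially_categorical \<mu>" "t i \<in> Vset \<mu>"
        using insert.prems V by blast
      note ord' = inaccessible_Ord[OF inacc]
      consider "\<kappa> \<preceq> \<mu>" | "\<mu> \<preceq> \<kappa>"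
        using Ord_not_le[OF ord'[OF \<kappa>(1)] ord'[OF \<mu>(1)]] Ord_mem_imp_le[OF ord'[OF \<kappa>(1)]] by blast
      then show ?case
      proof cases
        case 1
        then show ?thesis
          using \<kappa>(2) \<mu> Vset_mono[OF 1] by blast
      next
        case 2
        then show ?thesis
          using \<kappa> \<mu>(2) Vset_mono[OF 2] by blast
      qed
    qed
    have "sat UNIV s \<sigma>" for s :: "nat \<Rightarrow> 'v"
    proof (rule Sigma2_upward[of _ "Vset \<theta>"])
      show "Sigma_fm 2 \<sigma>" "sat (Vset \<theta>) s \<sigma>" "\<forall>i\<in>fv \<sigma>. s i \<in> Vset \<theta>" "Vset \<theta> \<subseteq> UNIV"
        using \<sigma> sat fv by (simp_all add: models_def)
      \<comment> \<open>The detour runs the other way here: down to an inaccessible level containing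
        the parameters, then up to the universe.\<close>
      show "sat UNIV t \<phi>" if \<phi>: "Pi_fm (Suc 0) \<phi>" "\<forall>i\<in>fv \<phi>. t i \<in> Vset \<theta>" "sat (Vset \<theta>) t \<phi>" for t \<phi>
      proof -
        obtain \<kappa> where \<kappa>: "fo_sententially_categorical \<kappa>" "\<forall>i\<in>fv \<phi>. t i \<in> Vset \<kappa>"
          using chain[OF finite_fv \<phi>(2)] by blast
        have "sat (Vset \<kappa>) t \<phi>"
          using Vset_trans[OF inaccessible_Ord[OF inacc[OF \<kappa>(1)]]]
          by (intro Pi1_downward[OF \<phi>(1) le[OF \<kappa>(1)] _ \<kappa>(2) \<phi>(3)]) blast
        then show ?thesis
          by (rule inaccessible_Pi1_upward[OF inacc[OF \<kappa>(1)] \<phi>(1) \<kappa>(2)])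
      qed
    qed
    then show "(UNIV :: 'v set) \<Turnstile> \<sigma>"
      by (simp add: models_def)
  qed
qed

text \<open>There are only countably many sentences, and each characterizes at most one
  cardinal.\<close>

lemma small_fo_categorical: "small {\<kappa>::'v::zfc. fo_sententially_categorical \<kappa>}"
proof -
  let ?f = "\<lambda>\<sigma>. THE \<kappa>::'v. inaccessible \<kappa> \<and> Vset \<kappa> \<Turnstile> \<sigma>"
  have "\<kappa> \<in> range ?f" if cat: "fo_sententially_categorical \<kappa>" for \<kappa>
  proof -
    obtain \<sigma> where \<sigma>: "inaccessible \<kappa>" "Vset \<kappa> \<Turnstile> \<sigma>" "\<And>\<mu>. inaccessible \<mu> \<Longrightarrow> \<mu> \<noteq> \<kappa> \<Longrightarrow> \<not> Vset \<mu> \<Turnstile> \<sigma>"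
      using cat unfolding fo_sententially_categorical_def by blast
    then have "?f \<sigma> = \<kappa>"
      by (intro the_equality) blast+
    then show ?thesis
      by blast
  qed
  then have "{\<kappa>. fo_sententially_categorical \<kappa>} \<subseteq> range ?f"
    by blast
  moreover have "countable (range ?f)"
    by (rule countable_image[OF countableI_type])
  ultimately have "countable {\<kappa>::'v. fo_sententially_categorical \<kappa>}"
    by (rule countable_subset)
  then obtain z :: 'v where "elts z = {\<kappa>. fo_sententially_categorical \<kappa>}"
    using usmall_mem[OF universe_UNIV usmall_countable[OF universe_UNIV]] by blast
  then show ?thesis
    by (metis small_elts)
qed

theorem theorem14:
  assumes no_largest: "\<not> (\<exists>\<kappa>::'v::zfc. inaccessible \<kappa> \<and> (\<forall>\<mu>. inaccessible \<mu> \<longrightarrow> \<mu> \<preceq> \<kappa>))"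
  shows "\<exists>\<theta> \<delta> :: 'v.
    is_ord_sup {\<kappa>. fo_sententially_categorical \<kappa>} \<theta> \<and>
    is_ord_sup {\<kappa>. so_sententially_categorical \<kappa>} \<theta> \<and>
    (\<forall>\<alpha>. absolutely_definable \<alpha> \<longrightarrow>
      is_ord_sup {\<kappa>. order_sententially_categorical \<alpha> \<kappa>} \<theta>) \<and>
    is_ord_least {\<delta>. Card \<delta> \<and> lightface_Sigma2_correct \<delta>} \<delta> \<and>
    \<theta> \<preceq> \<delta> \<and>
    (\<not> small {\<kappa>::'v. inaccessible \<kappa>} \<longrightarrow> \<theta> = \<delta>)"
proof -
  have inacc: "inaccessible \<kappa>" if "fo_sententially_categorical \<kappa>" for \<kappa> :: 'v
    using that unfolding fo_sententially_categorical_def by blast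
  obtain \<theta> :: 'v where \<theta>: "is_ord_sup {\<kappa>. fo_sententially_categorical \<kappa>} \<theta>"
    using is_ord_sup_exists[OF small_fo_categorical] inaccessible_Ord inacc by blast
  have so: "is_ord_sup {\<kappa>. so_sententially_categorical \<kappa>} \<theta>"
    using fo_imp_so_sententially_categorical so_categorical_below_fo_categorical[OF no_largest]
    by (intro is_ord_sup_mutually_cofinal[OF \<theta>]) auto
  have order: "is_ord_sup {\<kappa>. order_sententially_categorical \<alpha> \<kappa>} \<theta>" if "absolutely_definable \<alpha>" for \<alpha>
    using fo_imp_order_sententially_categorical[OF that] order_categorical_below_fo_categorical[OF no_largest that]
    by (intro is_ord_sup_mutually_cofinal[OF \<theta>]) auto
  have le: "\<theta> \<preceq> \<delta>" if "lightface_Sigma2_correct \<delta>" for \<delta>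
    using \<theta> that fo_categorical_below_Sigma2_correct[OF that]
    unfolding is_ord_sup_def lightface_Sigma2_correct_def by blast
  obtain \<delta>' :: 'v where "\<delta>' \<in> {\<delta>. Card \<delta> \<and> lightface_Sigma2_correct \<delta>}"
    using ex_Sigma2_correct by blast
  then obtain \<delta> :: 'v where \<delta>: "\<delta> \<in> {\<delta>. Card \<delta> \<and> lightface_Sigma2_correct \<delta>}"
    "\<And>\<beta>. \<beta> \<in> {\<delta>. Card \<delta> \<and> lightface_Sigma2_correct \<delta>} \<Longrightarrow> \<delta> \<preceq> \<beta>"
    by (rule Ord_least[where S = "{\<delta>. Card \<delta> \<and> lightface_Sigma2_correct \<delta>}"])
      (simp_all add: lightface_Sigma2_correct_def)
  have "\<theta> = \<delta>" if "\<not> small {\<kappa>::'v. inaccessible \<kappa>}"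
  proof -
    \<comment> \<open>As a supremum of cardinals, \<theta> itself competes in the class over which
      \<delta> is least.\<close>
    have "Card \<theta>"
      using Card_is_ord_sup[OF \<theta>] inaccessible_Card inacc by blast
    then have "\<delta> \<preceq> \<theta>"
      using \<delta>(2) sup_fo_categorical_Sigma2_correct[OF that \<theta>] by blast
    then have "elts \<theta> = elts \<delta>"
      using le \<delta>(1) by blast
    then show ?thesis
      by (rule extensionality)
  qed
  then show ?thesis
    using \<theta> so order \<delta> le unfolding is_ord_least_def by blast
qed

end
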